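(* Consider a sequence of linear models indexed by $n$, $$Y = X b^0 + \epsilon,$$ where $X\in\mathbb{R}^{n\times p}$ has i.i.d. entries from $N(0,1/n)$, $\epsilon\sim N(0,\sigma^2 I_{n})$ is independent of $X$, $b^0\in\mathbb{R}^p$, $p=p_n$, and $k=k_n=\#\{j: b^0_j\neq 0\}$. Suppose there exists $\delta>0$ such that $$\min_{j:\, b^0_j\neq 0}|b^0_j| \ge 2\sigma(1+\delta)\sqrt{2\log p},$$ and suppose $p\to\infty$, $k/p\to 0$ and $k^2\log p/n\to 0$. Then for any $q\in(0,1)$, the SLOPE estimator $$\hat b=\operatorname{argmin}_{b\in\mathbb{R}^p}\Big\{\tfrac12\|Y-Xb\|_2^2+\sum_{i=1}^p\lambda_i|b|_{(i)}\Big\}$$ with tuning sequence $\lambda_i=\lambda_i(q,\delta)=\sigma(1+\delta)\,\Phi^{-1}\!\left(1-\frac{qi}{2p}\right)$, $i=1,\dots,p$, satisfies $$FDR\to 0\quad\text{and}\quad \Pi\to 1\qquad (n\to\infty).$$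
   Context: $|b|_{(1)}\ge\dots\ge|b|_{(p)}$ denote the ordered absolute values of the entries of $b$; $\Phi$ is the standard normal cumulative distribution function. With $V=\#\{j: b^0_j=0,\ \hat b_j\neq 0\}$, $R=\#\{j:\hat b_j\neq 0\}$, $TR=\#\{j: b^0_j\neq 0,\ \hat b_j\neq 0\}$, the False Discovery Rate is $FDR=\mathbb{E}\big(V/(R\vee 1)\big)$ and the Power is $\Pi=\mathbb{E}(TR)/k$. *)

theory Defs
  imports "HOL-Probability.Probability"
begin

definition N01 :: "real measure" where
  "N01 = density lborel std_normal_density"

definition Phi :: "real \<Rightarrow> real" where
  "Phi x = measure N01 {..x}"

definition Phi_inv :: "real \<Rightarrow> real" where
  "Phi_inv u = (THE x. Phi x = u)"

(* Index set of the underlying i.i.d. N(0,1) variables for sample size n and dimension p: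
   Inl (i,j) <-> design entry X_ij (i<n, j<p),  Inr i <-> noise entry (i<n). *)
definition idx :: "nat \<Rightarrow> nat \<Rightarrow> ((nat \<times> nat) + nat) set" where
  "idx n p = Inl ` ({..<n} \<times> {..<p}) \<union> Inr ` {..<n}"

definition Omega :: "nat \<Rightarrow> nat \<Rightarrow> (((nat \<times> nat) + nat) \<Rightarrow> real) measure" where
  "Omega n p = PiM (idx n p) (\<lambda>_. N01)"

definition Xmat :: "nat \<Rightarrow> (((nat \<times> nat) + nat) \<Rightarrow> real) \<Rightarrow> nat \<Rightarrow> nat \<Rightarrow> real" where
  "Xmat n \<omega> i j = \<omega> (Inl (i, j)) / sqrt (real n)"

definition noise :: "real \<Rightarrow> (((nat \<times> nat) + nat) \<Rightarrow> real) \<Rightarrow> nat \<Rightarrow> real" where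
  "noise \<sigma> \<omega> i = \<sigma> * \<omega> (Inr i)"

definition Yvec :: "nat \<Rightarrow> nat \<Rightarrow> real \<Rightarrow> (nat \<Rightarrow> real) \<Rightarrow> (((nat \<times> nat) + nat) \<Rightarrow> real) \<Rightarrow> nat \<Rightarrow> real" where
  "Yvec n p \<sigma> b0 \<omega> i = (\<Sum>j<p. Xmat n \<omega> i j * b0 j) + noise \<sigma> \<omega> i"

(* |b|_(1) >= ... >= |b|_(p): decreasingly sorted absolute values, as a list (index 0 = |b|_(1)) *)
definition sorted_abs :: "nat \<Rightarrow> (nat \<Rightarrow> real) \<Rightarrow> real list" where
  "sorted_abs p b = rev (sort (map (\<lambda>j. \<bar>b j\<bar>) [0..<p]))"

definition slope_pen :: "nat \<Rightarrow> (nat \<Rightarrow> real) \<Rightarrow> (nat \<Rightarrow> real) \<Rightarrow> real" where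
  "slope_pen p lam b = (\<Sum>i\<in>{1..p}. lam i * (sorted_abs p b ! (i - 1)))"

definition slope_obj :: "nat \<Rightarrow> nat \<Rightarrow> (nat \<Rightarrow> nat \<Rightarrow> real) \<Rightarrow> (nat \<Rightarrow> real) \<Rightarrow> (nat \<Rightarrow> real) \<Rightarrow> (nat \<Rightarrow> real) \<Rightarrow> real" where
  "slope_obj n p X Y lam b =
     (1/2) * (\<Sum>i<n. (Y i - (\<Sum>j<p. X i j * b j))\<^sup>2) + slope_pen p lam b"

definition Rp :: "nat \<Rightarrow> (nat \<Rightarrow> real) set" where
  "Rp p = {b. \<forall>j\<ge>p. b j = 0}"

definition slope_lambda :: "real \<Rightarrow> real \<Rightarrow> real \<Rightarrow> nat \<Rightarrow> nat \<Rightarrow> real" where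
  "slope_lambda \<sigma> \<delta> q p i = \<sigma> * (1 + \<delta>) * Phi_inv (1 - q * real i / (2 * real p))"

definition sparsity :: "nat \<Rightarrow> (nat \<Rightarrow> real) \<Rightarrow> nat" where
  "sparsity p b0 = card {j\<in>{..<p}. b0 j \<noteq> 0}"

definition false_disc :: "nat \<Rightarrow> (nat \<Rightarrow> real) \<Rightarrow> (nat \<Rightarrow> real) \<Rightarrow> nat" where
  "false_disc p b0 bh = card {j\<in>{..<p}. b0 j = 0 \<and> bh j \<noteq> 0}"

definition num_disc :: "nat \<Rightarrow> (nat \<Rightarrow> real) \<Rightarrow> nat" where
  "num_disc p bh = card {j\<in>{..<p}. bh j \<noteq> 0}"

definition true_disc :: "nat \<Rightarrow> (nat \<Rightarrow> real) \<Rightarrow> (nat \<Rightarrow> real) \<Rightarrow> nat" where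
  "true_disc p b0 bh = card {j\<in>{..<p}. b0 j \<noteq> 0 \<and> bh j \<noteq> 0}"

definition FDR :: "nat \<Rightarrow> nat \<Rightarrow> (nat \<Rightarrow> real) \<Rightarrow> ((((nat \<times> nat) + nat) \<Rightarrow> real) \<Rightarrow> nat \<Rightarrow> real) \<Rightarrow> real" where
  "FDR n p b0 bhat = (\<integral>\<omega>. real (false_disc p b0 (bhat \<omega>)) / real (max (num_disc p (bhat \<omega>)) 1) \<partial>Omega n p)"

definition Power :: "nat \<Rightarrow> nat \<Rightarrow> (nat \<Rightarrow> real) \<Rightarrow> ((((nat \<times> nat) + nat) \<Rightarrow> real) \<Rightarrow> nat \<Rightarrow> real) \<Rightarrow> real" where
  "Power n p b0 bhat = (\<integral>\<omega>. real (true_disc p b0 (bhat \<omega>)) \<partial>Omega n p) / real (sparsity p b0)"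

end

theory Submission
  imports Defs
begin

text \<open>
  Write \<open>v = b - b0\<close>. Up to a constant the objective is \<open>Q v = v'Gv / 2 - w'v + J (b0 + v)\<close>
  with the Gram matrix \<open>G = X'X\<close>, \<open>w = X'\<epsilon>\<close> and the sorted l1 norm \<open>J\<close>. Let \<open>T\<close> consist of the true
  support and the few null indices where the noise correlation exceeds the quantile of level
  \<open>L k\<close>, for a large constant \<open>L\<close>.

  On \<open>T\<close> the Gram matrix is close to the identity, so that \<open>Q u > Q 0\<close> whenever \<open>u\<close> is supported on
  \<open>T\<close> and has norm \<open>r\<close>, with \<open>r\<close> of order \<open>\<sigma> sqrt (k log (p / k))\<close>. If the part of \<open>v\<close> in \<open>T\<close>
  has norm at most \<open>r\<close>, deleting the part of \<open>v\<close> outside \<open>T\<close> strictly decreases \<open>Q\<close>: the residual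
  correlations outside \<open>T\<close> have partial sums strictly below those of \<open>\<lambda>\<close> shifted by \<open>card T\<close>.
  Convexity along the segment from \<open>0\<close> to the minimizer then forces its part in \<open>T\<close> to have norm
  at most \<open>r\<close>, hence it vanishes outside \<open>T\<close> and has at most \<open>card T - k\<close> false discoveries.
  The coordinatewise bound by \<open>\<lambda> 1\<close> on the gradient rules out missed signals.

  Besides the concentration of the column norms, all probabilistic input comes from one fact: the
  normalized correlations of a column of the design (or of the noise vector) with the other columns
  are i.i.d. standard normal.
\<close>

section \<open>The sorted l1 norm\<close>

text \<open>The quadratic form may be degenerate when \<open>p\<close> exceeds \<open>n\<close>, so
  coercivity is available only on vectors supported on a set of size of order \<open>k\<close>. The
  true support alone is too small for \<open>T\<close>: at a rank just above \<open>k\<close>, no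
  null outside \<open>T\<close> may exceed the threshold, while the number of exceedances is only
  known to be o(k). Moving those indices into \<open>T\<close> removes the conflict at the price of
  o(k) possible false discoveries. The factor \<open>1 + \<delta>\<close> acts twice. Thresholds
  inflated by some \<open>a > 1\<close> are exceeded by o(k) nulls at a rank proportional to
  \<open>k\<close>, because the ratio of the Gaussian tails at \<open>a * x\<close> and at
  \<open>x\<close> vanishes; this sends the FDR to 0. The margin between \<open>a\<close> and
  \<open>1 + \<delta>\<close> pays for the fluctuation \<open>\<tau>\<close> of the column norms and
  for the slack \<open>\<kappa>\<close> given to cross terms. The condition k^2 log p / n -> 0 says
  that \<open>\<theta>\<close> is small: off-diagonal Gram entries along a row over at most 2k
  indices have norm of order sqrt (k log p / n), and a further factor sqrt k comes from
  Cauchy-Schwarz or from the radius \<open>r\<close>.\<close>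

lemma sum_mult_le_of_partial_sums:
  fixes e w d :: "nat \<Rightarrow> real"
  assumes "\<And>l. l \<le> m \<Longrightarrow> (\<Sum>i<l. e i) \<le> (\<Sum>i<l. w i)"
    and "\<And>i j. i < j \<Longrightarrow> j < m \<Longrightarrow> d j \<le> d i" and "\<And>i. i < m \<Longrightarrow> 0 \<le> d i"
  shows "(\<Sum>i<m. e i * d i) \<le> (\<Sum>i<m. w i * d i)"
  using assms
proof (induction m arbitrary: d)
  case 0
  then show ?case by simp
next
  case (Suc m)
  \<comment> \<open>Abel summation: lowering all weights by the last one keeps them decreasing and
    nonnegative and removes the term of index \<open>m\<close>. What is split off is
    \<open>d m\<close> times a full partial sum.\<close>
  have IH: "(\<Sum>i<m. e i * (d i - d m)) \<le> (\<Sum>i<m. w i * (d i - d m))"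
    by (rule Suc.IH) (use Suc.prems in auto)
  have "d m * (\<Sum>i<Suc m. e i) \<le> d m * (\<Sum>i<Suc m. w i)"
    by (rule mult_left_mono) (use Suc.prems(1)[of "Suc m"] Suc.prems(3)[of m] in auto)
  moreover have "(\<Sum>i<Suc m. f i * d i) = (\<Sum>i<m. f i * (d i - d m)) + d m * (\<Sum>i<Suc m. f i)"
    for f :: "nat \<Rightarrow> real"
    by (simp add: algebra_simps sum_subtractf sum_distrib_left)
  ultimately show ?case using IH by simp
qed

text \<open>The maximum of a set of \<open>m + 1\<close> naturals is at least \<open>m\<close>, so
  its weight is at most \<open>w m\<close>; remove it and induct.\<close>

lemma sum_le_sum_initial_segment:
  fixes w :: "nat \<Rightarrow> real"
  assumes "A \<subseteq> {..<p}" and "\<And>i j. i \<le> j \<Longrightarrow> j < p \<Longrightarrow> w j \<le> w i"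
  shows "(\<Sum>i\<in>A. w i) \<le> (\<Sum>i<card A. w i)"
  using assms(1)
proof (induction "card A" arbitrary: A)
  case 0
  then show ?case using finite_subset[of A "{..<p}"] by simp
next
  case (Suc m)
  have fin: "finite A" using Suc.prems finite_subset by blast
  then have ne: "A \<noteq> {}" using Suc.hyps(2) by auto
  define x where "x = Max A"
  have x: "x \<in> A" using fin ne by (simp add: x_def)
  have "A \<subseteq> {..x}" using fin by (auto simp: x_def)
  then have "card A \<le> Suc x" using card_mono[of "{..x}" A] by simp
  then have "w x \<le> w m" using assms(2)[of m x] Suc.hyps(2) Suc.prems x by auto
  moreover have "(\<Sum>i\<in>A - {x}. w i) \<le> (\<Sum>i<card (A - {x}). w i)"
    by (rule Suc.hyps(1)) (use Suc fin x in auto)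
  moreover have "card (A - {x}) = m" using Suc.hyps(2) x fin by simp
  ultimately show ?case using Suc.hyps(2)[symmetric] sum.remove[OF fin x, of w] by simp
qed

lemma ex_decreasing_enumeration:
  fixes v :: "'a \<Rightarrow> real"
  assumes "finite A"
  obtains f where "bij_betw f {..<card A} A" "\<And>i j. i < j \<Longrightarrow> j < card A \<Longrightarrow> v (f j) \<le> v (f i)"
proof -
  obtain xs where xs: "set xs = A" "distinct xs" using assms finite_distinct_list by blast
  define ys where "ys = sort_key (\<lambda>x. - v x) xs"
  have ys: "set ys = A" "distinct ys" "length ys = card A"
    using xs by (auto simp: ys_def distinct_card)
  have "sorted (map (\<lambda>x. - v x) ys)" by (simp add: ys_def)
  then have "v (ys ! j) \<le> v (ys ! i)" if "i < j" "j < card A" for i j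
    using that ys(3) sorted_nth_mono[of "map (\<lambda>x. - v x) ys" i j] by simp
  then show ?thesis using that[of "(!) ys"] bij_betw_nth[OF ys(2)] ys by auto
qed

lemma slope_pen_altdef: "slope_pen p lam b = (\<Sum>i<p. lam (Suc i) * (sorted_abs p b ! i))"
  unfolding slope_pen_def
  by (rule sum.reindex_bij_witness[of _ Suc "\<lambda>i. i - 1"]) auto

text \<open>Ties leave the decreasing enumeration undetermined, but the sorted list depends only on
  the multiset of absolute values, so every such enumeration gives the penalty.\<close>

lemma slope_pen_eq:
  assumes f: "bij_betw f {..<p} {..<p}" and mono: "\<And>i j. i < j \<Longrightarrow> j < p \<Longrightarrow> \<bar>b (f j)\<bar> \<le> \<bar>b (f i)\<bar>"
  shows "slope_pen p lam b = (\<Sum>i<p. lam (Suc i) * \<bar>b (f i)\<bar>)"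
proof -
  define ys where "ys = map (\<lambda>i. \<bar>b (f i)\<bar>) [0..<p]"
  have "sorted (rev ys)"
    using mono by (auto simp: sorted_wrt_iff_nth_less ys_def rev_nth)
  have "image_mset f (mset_set {..<p}) = mset_set {..<p}"
    using f image_mset_mset_set[of f "{..<p}"] by (simp add: bij_betw_def)
  then have "image_mset (\<lambda>j. \<bar>b j\<bar>) (image_mset f (mset_set {..<p})) = image_mset (\<lambda>j. \<bar>b j\<bar>) (mset_set {..<p})"
    by simp
  then have "mset (rev ys) = mset (map (\<lambda>j. \<bar>b j\<bar>) [0..<p])"
    by (simp add: ys_def multiset.map_comp comp_def lessThan_atLeast0)
  then have "sorted_abs p b = ys"
    using properties_for_sort[of "rev ys" "map (\<lambda>j. \<bar>b j\<bar>) [0..<p]"] \<open>sorted (rev ys)\<close>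
    by (simp add: sorted_abs_def)
  then show ?thesis by (simp add: slope_pen_altdef ys_def)
qed

section \<open>Norm properties for positive decreasing weights\<close>

locale slope_weights =
  fixes p :: nat and lam :: "nat \<Rightarrow> real"
  assumes lam_pos: "\<And>i. 1 \<le> i \<Longrightarrow> i \<le> p \<Longrightarrow> 0 < lam i"
    and lam_mono: "\<And>i j. 1 \<le> i \<Longrightarrow> i \<le> j \<Longrightarrow> j \<le> p \<Longrightarrow> lam j \<le> lam i"
begin

text \<open>The rearrangement inequality. It turns the penalty into a maximum over permutations,
  from which convexity and all lower bounds are drawn.\<close>

lemma slope_pen_ge:
  assumes g: "bij_betw g {..<p} {..<p}"
  shows "(\<Sum>i<p. lam (Suc i) * \<bar>b (g i)\<bar>) \<le> slope_pen p lam b"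
proof -
  obtain f where f: "bij_betw f {..<p} {..<p}" "\<And>i j. i < j \<Longrightarrow> j < p \<Longrightarrow> \<bar>b (f j)\<bar> \<le> \<bar>b (f i)\<bar>"
    using ex_decreasing_enumeration[of "{..<p}" "\<lambda>j. \<bar>b j\<bar>"] unfolding card_lessThan by blast
  \<comment> \<open>Reindexing by \<open>h\<close> moves the permutation from the values to the
    weights: the values become decreasing, and the permuted weights have partial sums at most those
    of the sorted ones.\<close>
  define h where "h = the_inv_into {..<p} g \<circ> f"
  have h: "bij_betw h {..<p} {..<p}"
    unfolding h_def using f(1) bij_betw_the_inv_into[OF g] by (rule bij_betw_trans)
  have gh: "g (h i) = f i" if "i < p" for i
    using f_the_inv_into_f_bij_betw[OF g] f(1) that by (auto simp: h_def bij_betw_def)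
  have "(\<Sum>i<p. lam (Suc i) * \<bar>b (g i)\<bar>) = (\<Sum>i<p. lam (Suc (h i)) * \<bar>b (g (h i))\<bar>)"
    by (rule sum.reindex_bij_betw[OF h, symmetric])
  also have "\<dots> = (\<Sum>i<p. lam (Suc (h i)) * \<bar>b (f i)\<bar>)"
    using gh by simp
  also have "\<dots> \<le> (\<Sum>i<p. lam (Suc i) * \<bar>b (f i)\<bar>)"
  proof (rule sum_mult_le_of_partial_sums)
    fix l assume l: "l \<le> p"
    have inj: "inj_on h {..<l}" using h l by (auto simp: bij_betw_def intro: inj_on_subset)
    have "(\<Sum>i<l. lam (Suc (h i))) = (\<Sum>i\<in>h ` {..<l}. lam (Suc i))"
      using sum.reindex[OF inj, of "\<lambda>i. lam (Suc i)"] by simp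
    also have "\<dots> \<le> (\<Sum>i<card (h ` {..<l}). lam (Suc i))"
      by (rule sum_le_sum_initial_segment[where p = p])
        (use h l in \<open>auto simp: bij_betw_def intro: lam_mono\<close>)
    finally show "(\<Sum>i<l. lam (Suc (h i))) \<le> (\<Sum>i<l. lam (Suc i))"
      by (simp add: card_image[OF inj])
  qed (use f(2) in auto)
  also have "\<dots> = slope_pen p lam b" using slope_pen_eq[where f = f and b = b and p = p, OF f] by simp
  finally show ?thesis .
qed

text \<open>The converse half of the maximum over permutations: an upper bound for the penalty needs
  to be proved for a single weighted l1 norm only.\<close>

lemma slope_pen_attained:
  obtains f where "bij_betw f {..<p} {..<p}" "slope_pen p lam b = (\<Sum>i<p. lam (Suc i) * \<bar>b (f i)\<bar>)"
proof -
  obtain f where f: "bij_betw f {..<p} {..<p}" "\<And>i j. i < j \<Longrightarrow> j < p \<Longrightarrow> \<bar>b (f j)\<bar> \<le> \<bar>b (f i)\<bar>"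
    using ex_decreasing_enumeration[of "{..<p}" "\<lambda>j. \<bar>b j\<bar>"] unfolding card_lessThan by blast
  show ?thesis
    by (rule that[of f, OF f(1) slope_pen_eq[where f = f and b = b and p = p, OF f]])
qed

lemma slope_pen_triangle: "slope_pen p lam (\<lambda>j. a j + b j) \<le> slope_pen p lam a + slope_pen p lam b"
proof -
  obtain f where f: "bij_betw f {..<p} {..<p}"
    "slope_pen p lam (\<lambda>j. a j + b j) = (\<Sum>i<p. lam (Suc i) * \<bar>a (f i) + b (f i)\<bar>)"
    by (rule slope_pen_attained)
  have "(\<Sum>i<p. lam (Suc i) * \<bar>a (f i) + b (f i)\<bar>) \<le>
    (\<Sum>i<p. lam (Suc i) * \<bar>a (f i)\<bar> + lam (Suc i) * \<bar>b (f i)\<bar>)"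
  proof (rule sum_mono)
    fix i assume "i \<in> {..<p}"
    then have "lam (Suc i) * \<bar>a (f i) + b (f i)\<bar> \<le> lam (Suc i) * (\<bar>a (f i)\<bar> + \<bar>b (f i)\<bar>)"
      using lam_pos[of "Suc i"] by (intro mult_left_mono) auto
    then show "lam (Suc i) * \<bar>a (f i) + b (f i)\<bar> \<le> lam (Suc i) * \<bar>a (f i)\<bar> + lam (Suc i) * \<bar>b (f i)\<bar>"
      by (simp add: distrib_left)
  qed
  also have "\<dots> \<le> slope_pen p lam a + slope_pen p lam b"
    using slope_pen_ge[OF f(1), of a] slope_pen_ge[OF f(1), of b] by (simp add: sum.distrib)
  finally show ?thesis using f(2) by simp
qed

lemma slope_pen_scale: "slope_pen p lam (\<lambda>j. c * b j) = \<bar>c\<bar> * slope_pen p lam b"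
proof -
  obtain f where f: "bij_betw f {..<p} {..<p}" "\<And>i j. i < j \<Longrightarrow> j < p \<Longrightarrow> \<bar>b (f j)\<bar> \<le> \<bar>b (f i)\<bar>"
    using ex_decreasing_enumeration[of "{..<p}" "\<lambda>j. \<bar>b j\<bar>"] unfolding card_lessThan by blast
  have "slope_pen p lam (\<lambda>j. c * b j) = (\<Sum>i<p. lam (Suc i) * \<bar>c * b (f i)\<bar>)"
    using f by (intro slope_pen_eq) (auto simp: abs_mult intro: mult_left_mono)
  then show ?thesis
    by (simp add: slope_pen_eq[where f = f and b = b and p = p, OF f] abs_mult sum_distrib_left mult_ac)
qed

text \<open>Cauchy-Schwarz for the maximizing permutation. The indices of \<open>T\<close> receive
  distinct ranks, so the squares of their weights sum to at most the first \<open>card T\<close>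
  squares.\<close>

lemma slope_pen_le_l2:
  assumes T: "T \<subseteq> {..<p}" and supp: "\<And>j. j \<notin> T \<Longrightarrow> u j = 0"
  shows "slope_pen p lam u \<le> sqrt (\<Sum>i<card T. (lam (Suc i))\<^sup>2) * sqrt (\<Sum>j\<in>T. (u j)\<^sup>2)"
proof -
  obtain f where f: "bij_betw f {..<p} {..<p}" "slope_pen p lam u = (\<Sum>i<p. lam (Suc i) * \<bar>u (f i)\<bar>)"
    by (rule slope_pen_attained)
  define g where "g = the_inv_into {..<p} f"
  have g: "bij_betw g {..<p} {..<p}" unfolding g_def by (rule bij_betw_the_inv_into[OF f(1)])
  have fg: "f (g j) = j" if "j < p" for j
    using f_the_inv_into_f_bij_betw[OF f(1)] that by (auto simp: g_def)
  have "slope_pen p lam u = (\<Sum>j<p. lam (Suc (g j)) * \<bar>u (f (g j))\<bar>)"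
    unfolding f(2) by (rule sum.reindex_bij_betw[OF g, symmetric])
  also have "\<dots> = (\<Sum>j<p. lam (Suc (g j)) * \<bar>u j\<bar>)" using fg by simp
  also have "\<dots> = (\<Sum>j\<in>T. lam (Suc (g j)) * \<bar>u j\<bar>)"
    by (rule sum.mono_neutral_right) (use T supp in auto)
  also have "\<dots> \<le> sqrt (\<Sum>j\<in>T. (lam (Suc (g j)))\<^sup>2) * sqrt (\<Sum>j\<in>T. (\<bar>u j\<bar>)\<^sup>2)"
  proof (rule order_trans[OF sum_mono])
    show "lam (Suc (g j)) * \<bar>u j\<bar> \<le> \<bar>lam (Suc (g j))\<bar> * \<bar>\<bar>u j\<bar>\<bar>" for j
      by (simp add: mult_right_mono)
  qed (use L2_set_mult_ineq[of "\<lambda>j. lam (Suc (g j))" "\<lambda>j. \<bar>u j\<bar>" T] in \<open>simp add: L2_set_def\<close>)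
  also have "(\<Sum>j\<in>T. (lam (Suc (g j)))\<^sup>2) \<le> (\<Sum>i<card T. (lam (Suc i))\<^sup>2)"
  proof -
    have inj: "inj_on g T" using g T by (auto simp: bij_betw_def intro: inj_on_subset)
    have "(\<Sum>j\<in>T. (lam (Suc (g j)))\<^sup>2) = (\<Sum>i\<in>g ` T. (lam (Suc i))\<^sup>2)"
      using sum.reindex[OF inj, of "\<lambda>i. (lam (Suc i))\<^sup>2"] by simp
    also have "\<dots> \<le> (\<Sum>i<card (g ` T). (lam (Suc i))\<^sup>2)"
    proof (rule sum_le_sum_initial_segment[where p = p])
      show "g ` T \<subseteq> {..<p}" using g T by (auto simp: bij_betw_def)
      show "(lam (Suc j))\<^sup>2 \<le> (lam (Suc i))\<^sup>2" if "i \<le> j" "j < p" for i j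
        using that lam_pos[of "Suc j"] lam_mono[of "Suc i" "Suc j"] by (intro power_mono) auto
    qed
    finally show ?thesis by (simp add: card_image[OF inj])
  qed
  finally show ?thesis by (simp add: mult_right_mono sum_nonneg)
qed

lemma slope_pen_single:
  assumes "j < p"
  shows "slope_pen p lam (\<lambda>i. if i = j then s else 0) \<le> lam 1 * \<bar>s\<bar>"
  using slope_pen_le_l2[of "{j}" "\<lambda>i. if i = j then s else 0"] assms lam_pos[of 1] by simp

text \<open>The permutation listing \<open>T\<close> first and its complement second, each in
  decreasing order, gives a lower bound for the penalty of \<open>b\<close>. For the restriction of
  \<open>b\<close> to \<open>T\<close> the same permutation is decreasing, since only zeros follow,
  and so gives the exact value. The entries outside are left with the weights of ranks after
  \<open>card T\<close>.\<close>

lemma slope_pen_outside: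
  assumes T: "T \<subseteq> {..<p}"
  obtains h where "bij_betw h {..<p - card T} ({..<p} - T)"
    "\<And>i j. i < j \<Longrightarrow> j < p - card T \<Longrightarrow> \<bar>b (h j)\<bar> \<le> \<bar>b (h i)\<bar>"
    "slope_pen p lam (\<lambda>j. if j \<in> T then b j else 0) + (\<Sum>i<p - card T. lam (Suc (card T + i)) * \<bar>b (h i)\<bar>)
      \<le> slope_pen p lam b"
proof -
  have finT: "finite T" using T finite_subset by blast
  define K where "K = card T"
  have Kp: "K \<le> p" using card_mono[OF _ T] by (simp add: K_def)
  have cc: "card ({..<p} - T) = p - K" using T finT by (simp add: card_Diff_subset K_def)
  obtain f where f: "bij_betw f {..<K} T" "\<And>i j. i < j \<Longrightarrow> j < K \<Longrightarrow> \<bar>b (f j)\<bar> \<le> \<bar>b (f i)\<bar>"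
    using ex_decreasing_enumeration[OF finT, of "\<lambda>j. \<bar>b j\<bar>"] unfolding K_def by blast
  obtain h where h: "bij_betw h {..<p - K} ({..<p} - T)"
    "\<And>i j. i < j \<Longrightarrow> j < p - K \<Longrightarrow> \<bar>b (h j)\<bar> \<le> \<bar>b (h i)\<bar>"
    using ex_decreasing_enumeration[of "{..<p} - T" "\<lambda>j. \<bar>b j\<bar>"] unfolding cc by blast
  define F where "F i = (if i < K then f i else h (i - K))" for i
  have fT: "f i \<in> T" if "i < K" for i using f(1) that by (auto simp: bij_betw_def)
  have hT: "h i \<in> {..<p} - T" if "i < p - K" for i using h(1) that by (auto simp: bij_betw_def)
  have sh: "bij_betw (\<lambda>i. i - K) {K..<p} {..<p - K}"
    by (rule bij_betw_byWitness[where f' = "\<lambda>i. i + K"]) auto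
  have "bij_betw F ({..<K} \<union> {K..<p}) (T \<union> ({..<p} - T))"
  proof (rule bij_betw_combine)
    show "bij_betw F {..<K} T" using f(1) bij_betw_cong[of "{..<K}" F f T] by (simp add: F_def)
    have "bij_betw (h \<circ> (\<lambda>i. i - K)) {K..<p} ({..<p} - T)" using sh h(1) by (rule bij_betw_trans)
    then show "bij_betw F {K..<p} ({..<p} - T)"
      using bij_betw_cong[of "{K..<p}" F "h \<circ> (\<lambda>i. i - K)" "{..<p} - T"] by (simp add: F_def)
  qed auto
  moreover have "{..<K} \<union> {K..<p} = {..<p}" "T \<union> ({..<p} - T) = {..<p}" using Kp T by auto
  ultimately have F: "bij_betw F {..<p} {..<p}" by simp
  have split: "(\<Sum>i<p. g i) = (\<Sum>i<K. g i) + (\<Sum>i<p - K. g (K + i))" for g :: "nat \<Rightarrow> real"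
  proof -
    have "(\<Sum>i<p. g i) = (\<Sum>i<K. g i) + (\<Sum>i=K..<p. g i)"
      using Kp by (simp add: lessThan_atLeast0 sum.atLeastLessThan_concat)
    also have "(\<Sum>i=K..<p. g i) = (\<Sum>i<p - K. g (K + i))"
      using sum.shift_bounds_nat_ivl[of g 0 K "p - K"] Kp by (simp add: lessThan_atLeast0 add.commute)
    finally show ?thesis .
  qed
  have "slope_pen p lam (\<lambda>j. if j \<in> T then b j else 0)
      = (\<Sum>i<p. lam (Suc i) * \<bar>if F i \<in> T then b (F i) else 0\<bar>)"
  proof (rule slope_pen_eq[OF F])
    fix i j assume ij: "i < j" "j < p"
    show "\<bar>if F j \<in> T then b (F j) else 0\<bar> \<le> \<bar>if F i \<in> T then b (F i) else 0\<bar>"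
      using ij f(2)[of i j] fT[of i] hT[of "j - K"] by (auto simp: F_def)
  qed
  also have "\<dots> = (\<Sum>i<K. lam (Suc i) * \<bar>b (f i)\<bar>)"
    using fT hT by (simp add: split F_def)
  finally have 1: "slope_pen p lam (\<lambda>j. if j \<in> T then b j else 0) = (\<Sum>i<K. lam (Suc i) * \<bar>b (f i)\<bar>)" .
  have "(\<Sum>i<p. lam (Suc i) * \<bar>b (F i)\<bar>)
      = (\<Sum>i<K. lam (Suc i) * \<bar>b (f i)\<bar>) + (\<Sum>i<p - K. lam (Suc (K + i)) * \<bar>b (h i)\<bar>)"
    by (simp add: split F_def)
  then show ?thesis using that[OF h[unfolded K_def]] slope_pen_ge[OF F, of b] 1
    by (simp add: K_def)
qed

end

section \<open>The SLOPE objective as a quadratic form\<close>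

definition gram :: "nat \<Rightarrow> (nat \<Rightarrow> nat \<Rightarrow> real) \<Rightarrow> nat \<Rightarrow> nat \<Rightarrow> real" where
  "gram n X i j = (\<Sum>l<n. X l i * X l j)"

definition xcorr :: "nat \<Rightarrow> (nat \<Rightarrow> nat \<Rightarrow> real) \<Rightarrow> (nat \<Rightarrow> real) \<Rightarrow> nat \<Rightarrow> real" where
  "xcorr n X e j = (\<Sum>l<n. X l j * e l)"

locale slope_quadratic = slope_weights +
  fixes b0 w :: "nat \<Rightarrow> real" and G :: "nat \<Rightarrow> nat \<Rightarrow> real"
  assumes sym: "G i j = G j i"
    and psd: "0 \<le> (\<Sum>i<p. \<Sum>j<p. v i * v j * G i j)"
begin

definition qf :: "(nat \<Rightarrow> real) \<Rightarrow> real" where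
  "qf v = (\<Sum>i<p. \<Sum>j<p. v i * v j * G i j)"

definition Q :: "(nat \<Rightarrow> real) \<Rightarrow> real" where
  "Q v = qf v / 2 - (\<Sum>j<p. w j * v j) + slope_pen p lam (\<lambda>j. b0 j + v j)"

lemma qf_nonneg: "0 \<le> qf v"
  unfolding qf_def by (rule psd)

lemma qf_add: "qf (\<lambda>j. u j + d j) = qf u + 2 * (\<Sum>j<p. d j * (\<Sum>i<p. G j i * u i)) + qf d"
proof -
  have "qf (\<lambda>j. u j + d j) = qf u + (\<Sum>i<p. \<Sum>j<p. u i * d j * G i j) + (\<Sum>i<p. \<Sum>j<p. d i * u j * G i j) + qf d"
    by (simp add: qf_def algebra_simps sum.distrib)
  moreover have "(\<Sum>i<p. \<Sum>j<p. u i * d j * G i j) = (\<Sum>j<p. d j * (\<Sum>i<p. G j i * u i))"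
    by (subst sum.swap) (simp add: sum_distrib_left sym[of _ _] mult_ac)
  moreover have "(\<Sum>i<p. \<Sum>j<p. d i * u j * G i j) = (\<Sum>j<p. d j * (\<Sum>i<p. G j i * u i))"
    by (simp add: sum_distrib_left mult_ac)
  ultimately show ?thesis by simp
qed

lemma qf_scale: "qf (\<lambda>j. c * v j) = c\<^sup>2 * qf v"
  by (simp add: qf_def sum_distrib_left power2_eq_square mult_ac)

text \<open>Deleting the outer part \<open>d\<close> saves at least the weighted sum
  \<open>?W\<close> in the penalty and costs at most \<open>1 - \<kappa>\<close> times
  \<open>?W\<close> in the linear term, while the quadratic term \<open>qf d\<close> has the right
  sign. The surplus \<open>\<kappa> * ?W\<close> is nonnegative, and it can vanish only if
  \<open>v\<close> vanishes outside \<open>T\<close>.\<close>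

lemma Q_restrict:
  assumes T: "T \<subseteq> {..<p}" and b0: "\<And>j. j \<notin> T \<Longrightarrow> b0 j = 0" and kap: "0 < \<kappa>"
    and dual: "\<And>M. M \<subseteq> {..<p} - T \<Longrightarrow>
      (\<Sum>j\<in>M. \<bar>w j - (\<Sum>i\<in>T. G j i * v i)\<bar>) \<le> (1 - \<kappa>) * (\<Sum>l<card M. lam (Suc (card T + l)))"
  shows "Q (\<lambda>j. if j \<in> T then v j else 0) \<le> Q v"
    and "Q v \<le> Q (\<lambda>j. if j \<in> T then v j else 0) \<Longrightarrow> j \<in> {..<p} - T \<Longrightarrow> v j = 0"
proof -
  define K where "K = card T"
  define u where "u j = (if j \<in> T then v j else 0)" for j
  define d where "d j = (if j \<in> T then 0 else v j)" for j
  define g where "g j = w j - (\<Sum>i\<in>T. G j i * v i)" for j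
  have v: "v = (\<lambda>j. u j + d j)" by (auto simp: u_def d_def)
  obtain h where h: "bij_betw h {..<p - K} ({..<p} - T)"
    "\<And>i j. i < j \<Longrightarrow> j < p - K \<Longrightarrow> \<bar>b0 (h j) + v (h j)\<bar> \<le> \<bar>b0 (h i) + v (h i)\<bar>"
    "slope_pen p lam (\<lambda>j. if j \<in> T then b0 j + v j else 0)
       + (\<Sum>i<p - K. lam (Suc (K + i)) * \<bar>b0 (h i) + v (h i)\<bar>) \<le> slope_pen p lam (\<lambda>j. b0 j + v j)"
    using slope_pen_outside[OF T, of "\<lambda>j. b0 j + v j"] unfolding K_def by blast
  let ?W = "\<Sum>i<p - K. lam (Suc (K + i)) * \<bar>v (h i)\<bar>"
  have hT: "h i \<in> {..<p} - T" if "i < p - K" for i using h(1) that by (auto simp: bij_betw_def)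
  have b0h: "b0 (h i) = 0" if "i < p - K" for i using b0 hT[OF that] by auto
  have Gu: "(\<Sum>i<p. G j i * u i) = (\<Sum>i\<in>T. G j i * v i)" for j
    using T by (auto simp: u_def intro!: sum.mono_neutral_cong_right)
  have "(\<Sum>j<p. (w j - (\<Sum>i<p. G j i * u i)) * d j) = (\<Sum>j\<in>{..<p} - T. g j * v j)"
    unfolding Gu by (rule sum.mono_neutral_cong_right) (auto simp: d_def g_def)
  also have "\<dots> = (\<Sum>i<p - K. g (h i) * v (h i))"
    by (rule sum.reindex_bij_betw[OF h(1), symmetric])
  also have "\<dots> \<le> (\<Sum>i<p - K. \<bar>g (h i)\<bar> * \<bar>v (h i)\<bar>)"
    by (intro sum_mono) (simp flip: abs_mult)
  also have "\<dots> \<le> (\<Sum>i<p - K. (1 - \<kappa>) * lam (Suc (K + i)) * \<bar>v (h i)\<bar>)"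
  proof (rule sum_mult_le_of_partial_sums)
    \<comment> \<open>The bound for arbitrary subsets \<open>M\<close> is used for the
      \<open>l\<close> outer indices with largest entries; these sets are not known in advance,
      since they depend on \<open>v\<close>.\<close>
    fix l assume l: "l \<le> p - K"
    have inj: "inj_on h {..<l}" using h(1) l by (auto simp: bij_betw_def intro: inj_on_subset)
    have "(\<Sum>i<l. \<bar>g (h i)\<bar>) = (\<Sum>j\<in>h ` {..<l}. \<bar>g j\<bar>)"
      using sum.reindex[OF inj, of "\<lambda>j. \<bar>g j\<bar>"] by simp
    also have "\<dots> \<le> (1 - \<kappa>) * (\<Sum>i<card (h ` {..<l}). lam (Suc (K + i)))"
      unfolding g_def K_def by (rule dual) (use hT l in \<open>auto simp: K_def\<close>)
    finally show "(\<Sum>i<l. \<bar>g (h i)\<bar>) \<le> (\<Sum>i<l. (1 - \<kappa>) * lam (Suc (K + i)))"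
      by (simp add: card_image[OF inj] sum_distrib_left)
  next
    show "\<bar>v (h j)\<bar> \<le> \<bar>v (h i)\<bar>" if "i < j" "j < p - K" for i j
      using h(2)[OF that] b0h[of i] b0h[of j] that by simp
  qed auto
  finally have lin: "(\<Sum>j<p. (w j - (\<Sum>i<p. G j i * u i)) * d j)
    \<le> (1 - \<kappa>) * ?W"
    by (simp add: sum_distrib_left mult_ac)
  have ub: "(\<lambda>j. if j \<in> T then b0 j + v j else 0) = (\<lambda>j. b0 j + u j)"
    using b0 by (auto simp: u_def)
  have pen: "slope_pen p lam (\<lambda>j. b0 j + u j) + ?W
    \<le> slope_pen p lam (\<lambda>j. b0 j + v j)"
    using h(3) b0h unfolding ub by simp
  have "qf v = qf u + 2 * (\<Sum>j<p. d j * (\<Sum>i<p. G j i * u i)) + qf d"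
    using qf_add[of u d] v by simp
  moreover have "(\<Sum>j<p. w j * v j) = (\<Sum>j<p. w j * u j) + (\<Sum>j<p. w j * d j)"
    unfolding v by (simp add: algebra_simps sum.distrib)
  moreover have "(\<Sum>j<p. (w j - (\<Sum>i<p. G j i * u i)) * d j)
     = (\<Sum>j<p. w j * d j) - (\<Sum>j<p. d j * (\<Sum>i<p. G j i * u i))"
    by (simp add: algebra_simps sum_subtractf)
  ultimately have "Q v - Q u \<ge> - ((1 - \<kappa>) * ?W)
     + slope_pen p lam (\<lambda>j. b0 j + v j) - slope_pen p lam (\<lambda>j. b0 j + u j)"
    using lin qf_nonneg[of d] unfolding Q_def by linarith
  then have main: "Q u + \<kappa> * ?W \<le> Q v"
    using pen by (simp add: algebra_simps)
  have pos: "0 \<le> lam (Suc (K + i)) * \<bar>v (h i)\<bar>" if "i < p - K" for i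
  proof -
    have "0 < lam (Suc (K + i))" by (rule lam_pos) (use that in auto)
    then show ?thesis by simp
  qed
  have "0 \<le> \<kappa> * ?W"
    using kap by (intro mult_nonneg_nonneg sum_nonneg pos) auto
  then show "Q (\<lambda>j. if j \<in> T then v j else 0) \<le> Q v"
    using main by (simp add: u_def[abs_def])
  assume "Q v \<le> Q (\<lambda>j. if j \<in> T then v j else 0)" and j: "j \<in> {..<p} - T"
  then have "\<kappa> * ?W \<le> 0"
    using main by (simp add: u_def[abs_def])
  then have "?W \<le> 0"
    using kap by (simp add: mult_le_0_iff)
  then have "?W = 0"
    using sum_nonneg[of "{..<p - K}" "\<lambda>i. lam (Suc (K + i)) * \<bar>v (h i)\<bar>"] pos by force
  then have z: "lam (Suc (K + i)) * \<bar>v (h i)\<bar> = 0" if "i < p - K" for i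
    using that pos by (subst (asm) sum_nonneg_eq_0_iff) auto
  obtain i where i: "i < p - K" "j = h i" using h(1) j by (auto simp: bij_betw_def)
  have "0 < lam (Suc (K + i))" by (rule lam_pos) (use i in auto)
  then show "v j = 0" using z[of i] i by auto
qed

text \<open>Convexity is stated on segments starting at 0, where \<open>t\<^sup>2 \<le> t\<close>
  settles the quadratic part.\<close>

lemma Q_segment:
  assumes "0 \<le> t" "t \<le> 1"
  shows "Q (\<lambda>j. t * v j) \<le> (1 - t) * Q (\<lambda>_. 0) + t * Q v"
proof -
  have "slope_pen p lam (\<lambda>j. b0 j + t * v j) = slope_pen p lam (\<lambda>j. (1 - t) * b0 j + t * (b0 j + v j))"
    by (simp add: algebra_simps)
  also have "\<dots> \<le> slope_pen p lam (\<lambda>j. (1 - t) * b0 j) + slope_pen p lam (\<lambda>j. t * (b0 j + v j))"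
    by (rule slope_pen_triangle)
  also have "\<dots> = (1 - t) * slope_pen p lam b0 + t * slope_pen p lam (\<lambda>j. b0 j + v j)"
    using assms by (simp only: slope_pen_scale)
  finally have 1: "slope_pen p lam (\<lambda>j. b0 j + t * v j) \<le> \<dots>" .
  have "t\<^sup>2 \<le> t" using assms by (simp add: power2_eq_square mult_left_le)
  then have 2: "qf (\<lambda>j. t * v j) \<le> t * qf v"
    unfolding qf_scale by (rule mult_right_mono) (rule qf_nonneg)
  have 3: "(\<Sum>j<p. w j * (t * v j)) = t * (\<Sum>j<p. w j * v j)"
    by (simp add: sum_distrib_left mult_ac)
  have 4: "qf (\<lambda>_. 0) = 0" by (simp add: qf_def)
  show ?thesis using 1 2 unfolding Q_def 3 4 by (simp add: algebra_simps)
qed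

text \<open>The quadratic part is at least \<open>r\<^sup>2 / 4\<close>, while the linear term and
  the decrease of the penalty are each at most a norm times \<open>r\<close>; the assumption
  \<open>noise\<close> makes their total smaller than \<open>r / 4 * r\<close>.\<close>

lemma Q_gt_on_sphere:
  assumes T: "T \<subseteq> {..<p}" and u: "\<And>j. j \<notin> T \<Longrightarrow> u j = 0"
    and norm_u: "(\<Sum>j\<in>T. (u j)\<^sup>2) = r\<^sup>2" and r: "0 < r"
    and rsc: "(\<Sum>j\<in>T. (u j)\<^sup>2) / 2 \<le> qf u"
    and noise: "sqrt (\<Sum>j\<in>T. (w j)\<^sup>2) + sqrt (\<Sum>i<card T. (lam (Suc i))\<^sup>2) < r / 4"
  shows "Q (\<lambda>_. 0) < Q u"
proof -
  have su: "sqrt (\<Sum>j\<in>T. (u j)\<^sup>2) = r" using r norm_u by simp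
  have "(\<Sum>j<p. w j * u j) = (\<Sum>j\<in>T. w j * u j)"
    by (rule sum.mono_neutral_right) (use T u in auto)
  also have "\<dots> \<le> (\<Sum>j\<in>T. \<bar>w j\<bar> * \<bar>u j\<bar>)"
    by (intro sum_mono) (simp flip: abs_mult)
  also have "\<dots> \<le> sqrt (\<Sum>j\<in>T. (w j)\<^sup>2) * r"
    using L2_set_mult_ineq[of w u T] su by (simp add: L2_set_def)
  finally have 1: "(\<Sum>j<p. w j * u j) \<le> sqrt (\<Sum>j\<in>T. (w j)\<^sup>2) * r" .
  have "slope_pen p lam b0 \<le> slope_pen p lam (\<lambda>j. b0 j + u j) + slope_pen p lam (\<lambda>j. (-1) * u j)"
    using slope_pen_triangle[of "\<lambda>j. b0 j + u j" "\<lambda>j. (-1) * u j"] by simp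
  also have "slope_pen p lam (\<lambda>j. (-1) * u j) = slope_pen p lam u"
    by (simp only: slope_pen_scale)
  also have "slope_pen p lam u \<le> sqrt (\<Sum>i<card T. (lam (Suc i))\<^sup>2) * r"
    using slope_pen_le_l2[OF T, of u] u su by simp
  finally have 2: "slope_pen p lam b0 \<le> slope_pen p lam (\<lambda>j. b0 j + u j) + \<dots>" by simp
  have "(sqrt (\<Sum>j\<in>T. (w j)\<^sup>2) + sqrt (\<Sum>i<card T. (lam (Suc i))\<^sup>2)) * r < r / 4 * r"
    by (rule mult_strict_right_mono[OF noise r])
  then have "(sqrt (\<Sum>j\<in>T. (w j)\<^sup>2) + sqrt (\<Sum>i<card T. (lam (Suc i))\<^sup>2)) * r < qf u / 2"
    using rsc norm_u by (simp add: power2_eq_square)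
  then show ?thesis using 1 2 unfolding Q_def by (simp add: qf_def distrib_right)
qed

text \<open>The dual bound holds only for vectors of norm at most \<open>r\<close> on
  \<open>T\<close>, so it cannot be applied to \<open>v\<close> before \<open>v\<close> is
  localized. A rescaled copy of \<open>v\<close> on the sphere is used instead.\<close>

lemma minimizer_supported:
  assumes T: "T \<subseteq> {..<p}" and b0: "\<And>j. j \<notin> T \<Longrightarrow> b0 j = 0" and kap: "0 < \<kappa>" and r: "0 < r"
    and rsc: "\<And>u. (\<And>j. j \<notin> T \<Longrightarrow> u j = 0) \<Longrightarrow> (\<Sum>j\<in>T. (u j)\<^sup>2) / 2 \<le> qf u"
    and dual: "\<And>M u. M \<subseteq> {..<p} - T \<Longrightarrow> (\<Sum>j\<in>T. (u j)\<^sup>2) \<le> r\<^sup>2 \<Longrightarrow>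
      (\<Sum>j\<in>M. \<bar>w j - (\<Sum>i\<in>T. G j i * u i)\<bar>) \<le> (1 - \<kappa>) * (\<Sum>l<card M. lam (Suc (card T + l)))"
    and noise: "sqrt (\<Sum>j\<in>T. (w j)\<^sup>2) + sqrt (\<Sum>i<card T. (lam (Suc i))\<^sup>2) < r / 4"
    and v: "\<And>j. p \<le> j \<Longrightarrow> v j = 0"
    and min: "\<And>u. (\<And>j. p \<le> j \<Longrightarrow> u j = 0) \<Longrightarrow> Q v \<le> Q u"
  shows "(\<Sum>j\<in>T. (v j)\<^sup>2) \<le> r\<^sup>2" and "j \<notin> T \<Longrightarrow> v j = 0"
proof -
  define N where "N = sqrt (\<Sum>j\<in>T. (v j)\<^sup>2)"
  have N2: "N\<^sup>2 = (\<Sum>j\<in>T. (v j)\<^sup>2)" by (simp add: N_def sum_nonneg)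
  show le: "(\<Sum>j\<in>T. (v j)\<^sup>2) \<le> r\<^sup>2"
  proof (rule ccontr)
    assume "\<not> ?thesis"
    then have "r\<^sup>2 < N\<^sup>2" using N2 by simp
    moreover have "0 \<le> N" by (simp add: N_def sum_nonneg)
    ultimately have rN: "r < N" by (rule power_less_imp_less_base)
    \<comment> \<open>With this \<open>t\<close> the part of \<open>t * v\<close> in
      \<open>T\<close> has norm exactly \<open>r\<close>. The chain Q 0 < Q u \<le> Q (t v) \<le> (1
      - t) Q 0 + t Q v \<le> Q 0 is then contradictory.\<close>
    define t where "t = r / N"
    have t: "0 \<le> t" "t \<le> 1" using rN r by (auto simp: t_def)
    define u where "u j = (if j \<in> T then t * v j else 0)" for j
    have "(\<Sum>j\<in>T. (t * v j)\<^sup>2) = t\<^sup>2 * N\<^sup>2"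
      unfolding N2 by (simp add: sum_distrib_left power_mult_distrib)
    also have "\<dots> = r\<^sup>2" using rN r by (simp add: t_def power_divide)
    finally have nt: "(\<Sum>j\<in>T. (t * v j)\<^sup>2) = r\<^sup>2" .
    have "Q (\<lambda>_. 0) < Q u"
    proof (rule Q_gt_on_sphere[OF T _ _ r rsc noise])
      show "(\<Sum>j\<in>T. (u j)\<^sup>2) = r\<^sup>2" using nt by (simp add: u_def)
    qed (auto simp: u_def)
    also have "Q u \<le> Q (\<lambda>j. t * v j)"
      unfolding u_def[abs_def] by (rule Q_restrict(1)[OF T b0 kap dual]) (use nt in auto)
    also have "\<dots> \<le> (1 - t) * Q (\<lambda>_. 0) + t * Q v"
      by (rule Q_segment[OF t])
    also have "\<dots> \<le> (1 - t) * Q (\<lambda>_. 0) + t * Q (\<lambda>_. 0)"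
      using min[of "\<lambda>_. 0"] t by (intro add_left_mono mult_left_mono) auto
    finally show False by (simp add: algebra_simps)
  qed
  assume "j \<notin> T"
  show "v j = 0"
  proof (cases "p \<le> j")
    case False
    show ?thesis
      by (rule Q_restrict(2)[OF T b0 kap dual[OF _ le] min]) (use T \<open>j \<notin> T\<close> False in auto)
  qed (rule v)
qed

text \<open>Moving one coordinate by \<open>s\<close> changes the penalty by at most
  \<open>lam 1 * \<bar>s\<bar>\<close>, whatever its rank. A larger gradient would make a small move
  in its direction profitable.\<close>

lemma minimizer_gradient:
  assumes min: "\<And>u. (\<And>j. p \<le> j \<Longrightarrow> u j = 0) \<Longrightarrow> Q v \<le> Q u"
    and v: "\<And>j. p \<le> j \<Longrightarrow> v j = 0" and j: "j < p"
  shows "\<bar>w j - (\<Sum>i<p. G j i * v i)\<bar> \<le> lam 1"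
proof (rule ccontr)
  assume asm: "\<not> ?thesis"
  define g where "g = w j - (\<Sum>i<p. G j i * v i)"
  define \<epsilon> where "\<epsilon> = \<bar>g\<bar> - lam 1"
  have eps: "0 < \<epsilon>" using asm by (simp add: \<epsilon>_def g_def)
  have qfe: "qf (\<lambda>i. if i = j then s else 0) = s\<^sup>2 * G j j" for s
  proof -
    have "qf (\<lambda>i. if i = j then s else 0) = (\<Sum>i<p. if i = j then s * s * G j j else 0)"
      unfolding qf_def using j by (intro sum.cong) (auto simp: if_distrib[of "\<lambda>x. x * _"] if_distrib[of "\<lambda>x. _ * x"] cong: if_cong)
    then show ?thesis using j by (simp add: power2_eq_square)
  qed
  have Gjj: "0 \<le> G j j" using qfe[of 1] qf_nonneg[of "\<lambda>i. if i = j then 1 else 0"] by simp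
  \<comment> \<open>The step is so short that the quadratic cost per unit length,
    \<open>t * G j j / 2\<close>, stays below the excess \<open>\<epsilon>\<close>; the summand 1
    covers a vanishing diagonal entry.\<close>
  define t where "t = \<epsilon> / (G j j + 1)"
  define s where "s = sgn g * t"
  have t: "0 < t" using eps Gjj by (simp add: t_def)
  have g0: "g \<noteq> 0" using eps lam_pos[of 1] j by (auto simp: \<epsilon>_def)
  define e where "e i = (if i = j then s else 0)" for i
  have "Q v \<le> Q (\<lambda>i. v i + e i)" using v j by (intro min) (auto simp: e_def)
  also have "Q (\<lambda>i. v i + e i) \<le> Q v - s * g + s\<^sup>2 * G j j / 2 + lam 1 * \<bar>s\<bar>"
  proof -
    have s1: "(\<Sum>i<p. e i * f i) = s * f j" for f :: "nat \<Rightarrow> real"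
      using j by (simp add: e_def if_distrib[of "\<lambda>x. x * _"] cong: if_cong)
    have "(\<lambda>i. b0 i + (v i + e i)) = (\<lambda>i. (b0 i + v i) + e i)" by (simp add: add.assoc)
    then have "slope_pen p lam (\<lambda>i. b0 i + (v i + e i)) \<le> slope_pen p lam (\<lambda>i. b0 i + v i) + lam 1 * \<bar>s\<bar>"
      using slope_pen_triangle[of "\<lambda>i. b0 i + v i" e] slope_pen_single[OF j, of s]
      by (simp add: e_def[abs_def])
    moreover have "(\<Sum>i<p. w i * (v i + e i)) = (\<Sum>i<p. w i * v i) + s * w j"
      using s1[of w] by (simp add: distrib_left sum.distrib mult.commute)
    moreover have "qf (\<lambda>i. v i + e i) = qf v + 2 * (s * (\<Sum>i<p. G j i * v i)) + s\<^sup>2 * G j j"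
      using qf_add[of v e] s1[of "\<lambda>j. \<Sum>i<p. G j i * v i"] qfe[of s] by (simp add: e_def[abs_def])
    ultimately show ?thesis unfolding Q_def g_def right_diff_distrib by linarith
  qed
  finally have "s * g \<le> s\<^sup>2 * G j j / 2 + lam 1 * \<bar>s\<bar>" by simp
  moreover have "s * g = t * \<bar>g\<bar>" by (simp add: s_def sgn_if)
  moreover have "\<bar>s\<bar> = t" "s\<^sup>2 = t\<^sup>2" using t g0 by (auto simp: s_def abs_mult power_mult_distrib sgn_if)
  ultimately have "t * \<bar>g\<bar> \<le> t\<^sup>2 * G j j / 2 + lam 1 * t" by simp
  then have "t * \<epsilon> \<le> t * (t * G j j / 2)"
    by (simp add: \<epsilon>_def algebra_simps power2_eq_square)
  then have "\<epsilon> \<le> t * G j j / 2" using t by simp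
  also have "\<dots> = \<epsilon> * (G j j / (2 * (G j j + 1)))" by (simp add: t_def)
  also have "\<dots> < \<epsilon> * 1" using Gjj eps by (intro mult_strict_left_mono) (auto simp: field_simps)
  finally show False by simp
qed

end

lemma slope_obj_expand:
  assumes Y: "\<And>i. i < n \<Longrightarrow> Y i = (\<Sum>j<p. X i j * b0 j) + e i"
  shows "slope_obj n p X Y lam (\<lambda>j. b0 j + v j) = (\<Sum>i<n. (e i)\<^sup>2) / 2
    + ((\<Sum>i<p. \<Sum>j<p. v i * v j * gram n X i j) / 2 - (\<Sum>j<p. xcorr n X e j * v j)
      + slope_pen p lam (\<lambda>j. b0 j + v j))"
proof -
  have "(\<Sum>i<n. (Y i - (\<Sum>j<p. X i j * (b0 j + v j)))\<^sup>2) = (\<Sum>i<n. (e i - (\<Sum>j<p. X i j * v j))\<^sup>2)"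
    by (intro sum.cong) (auto simp: Y distrib_left sum.distrib)
  also have "\<dots> = (\<Sum>i<n. (e i)\<^sup>2) - 2 * (\<Sum>i<n. e i * (\<Sum>j<p. X i j * v j)) + (\<Sum>i<n. (\<Sum>j<p. X i j * v j)\<^sup>2)"
    by (simp add: power2_diff sum.distrib sum_subtractf sum_distrib_left mult_ac)
  also have "(\<Sum>i<n. e i * (\<Sum>j<p. X i j * v j)) = (\<Sum>j<p. xcorr n X e j * v j)"
    unfolding xcorr_def sum_distrib_left sum_distrib_right
    by (subst sum.swap) (simp add: mult_ac)
  also have "(\<Sum>i<n. (\<Sum>j<p. X i j * v j)\<^sup>2) = (\<Sum>i<p. \<Sum>j<p. v i * v j * gram n X i j)"
  proof -
    have "(\<Sum>i<n. (\<Sum>j<p. X i j * v j)\<^sup>2) = (\<Sum>l<n. \<Sum>i<p. \<Sum>j<p. v i * v j * (X l i * X l j))"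
      by (simp add: power2_eq_square sum_product mult_ac)
    also have "\<dots> = (\<Sum>i<p. \<Sum>l<n. \<Sum>j<p. v i * v j * (X l i * X l j))" by (rule sum.swap)
    also have "\<dots> = (\<Sum>i<p. \<Sum>j<p. \<Sum>l<n. v i * v j * (X l i * X l j))"
      by (intro sum.cong refl sum.swap)
    finally show ?thesis by (simp add: gram_def sum_distrib_left)
  qed
  finally show ?thesis by (simp add: slope_obj_def)
qed

lemma gram_psd: "0 \<le> (\<Sum>i<p. \<Sum>j<p. v i * v j * gram n X i j)"
proof -
  have "(\<Sum>i<p. \<Sum>j<p. v i * v j * gram n X i j) = (\<Sum>i<p. \<Sum>j<p. \<Sum>l<n. (X l i * v i) * (X l j * v j))"
    by (simp add: gram_def sum_distrib_left mult_ac)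
  also have "\<dots> = (\<Sum>i<p. \<Sum>l<n. \<Sum>j<p. (X l i * v i) * (X l j * v j))"
    by (intro sum.cong refl sum.swap)
  also have "\<dots> = (\<Sum>l<n. \<Sum>i<p. \<Sum>j<p. (X l i * v i) * (X l j * v j))" by (rule sum.swap)
  also have "\<dots> = (\<Sum>l<n. (\<Sum>i<p. X l i * v i)\<^sup>2)"
    by (simp add: power2_eq_square sum_product)
  finally show ?thesis by (simp add: sum_nonneg)
qed

section \<open>Gaussian tails and quantiles\<close>

lemma sets_N01 [simp, measurable_cong]: "sets N01 = sets borel"
  by (simp add: N01_def)

lemma space_N01 [simp]: "space N01 = UNIV"
  by (simp add: N01_def)

lemma real_distribution_N01: "real_distribution N01"
proof -
  interpret prob_space N01 unfolding N01_def by (rule prob_space_normal_density) simp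
  show ?thesis by standard auto
qed

interpretation N01: real_distribution N01
  by (rule real_distribution_N01)

lemma nn_integral_N01:
  assumes [measurable]: "f \<in> borel_measurable borel"
  shows "(\<integral>\<^sup>+x. f x \<partial>N01) = (\<integral>\<^sup>+x. ennreal (std_normal_density x) * f x \<partial>lborel)"
  unfolding N01_def by (rule nn_integral_density) auto

lemma nn_integral_normal_density: "0 < s \<Longrightarrow> (\<integral>\<^sup>+x. ennreal (normal_density m s x) \<partial>lborel) = 1"
  by (subst nn_integral_eq_integral) auto

lemma nn_integral_N01_exp_square:
  assumes "s < 1 / 2"
  shows "(\<integral>\<^sup>+x. ennreal (exp (s * x\<^sup>2)) \<partial>N01) = ennreal (1 / sqrt (1 - 2 * s))"
proof -
  \<comment> \<open>The tilted density is \<open>t\<close> times the centred normal density of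
    standard deviation \<open>t\<close>.\<close>
  define t where "t = 1 / sqrt (1 - 2 * s)"
  have t: "0 < t" "t\<^sup>2 = 1 / (1 - 2 * s)" using assms by (auto simp: t_def power_divide)
  have "std_normal_density x * exp (s * x\<^sup>2) = t * normal_density 0 t x" for x
  proof -
    have "sqrt (2 * pi * t\<^sup>2) = sqrt (2 * pi) * t" using t(1) by (simp add: real_sqrt_mult)
    moreover have "- x\<^sup>2 / 2 + s * x\<^sup>2 = - x\<^sup>2 / (2 * t\<^sup>2)"
      using assms unfolding t(2) by (simp add: field_simps)
    ultimately show ?thesis
      using t(1) by (simp add: std_normal_density_def normal_density_def flip: exp_add)
  qed
  then have "(\<integral>\<^sup>+x. ennreal (exp (s * x\<^sup>2)) \<partial>N01) = (\<integral>\<^sup>+x. ennreal t * ennreal (normal_density 0 t x) \<partial>lborel)"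
    using t(1) by (subst nn_integral_N01) (auto simp flip: ennreal_mult)
  also have "\<dots> = ennreal t"
    using t(1) by (simp add: nn_integral_cmult nn_integral_normal_density)
  finally show ?thesis by (simp add: t_def)
qed

lemma nn_integral_N01_exp: "(\<integral>\<^sup>+x. ennreal (exp (s * x)) \<partial>N01) = ennreal (exp (s\<^sup>2 / 2))"
proof -
  have "std_normal_density x * exp (s * x) = exp (s\<^sup>2 / 2) * normal_density s 1 x" for x
  proof -
    have "- x\<^sup>2 / 2 + s * x = s\<^sup>2 / 2 + - (x - s)\<^sup>2 / 2" by (simp add: power2_eq_square field_simps)
    then show ?thesis by (simp add: std_normal_density_def normal_density_def flip: exp_add)
  qed
  then have "(\<integral>\<^sup>+x. ennreal (exp (s * x)) \<partial>N01) = (\<integral>\<^sup>+x. ennreal (exp (s\<^sup>2 / 2)) * ennreal (normal_density s 1 x) \<partial>lborel)"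
    by (subst nn_integral_N01) (auto simp flip: ennreal_mult)
  then show ?thesis by (simp add: nn_integral_cmult nn_integral_normal_density)
qed

lemma N01_uminus: "A \<in> sets borel \<Longrightarrow> measure N01 (uminus -` A) = measure N01 A"
proof -
  assume A [measurable]: "A \<in> sets borel"
  have [measurable]: "uminus -` A \<in> sets borel"
    using measurable_sets[OF _ A, of uminus borel] by simp
  have "emeasure N01 (uminus -` A) = (\<integral>\<^sup>+x. ennreal (std_normal_density x) * indicator A (- x) \<partial>lborel)"
    unfolding N01_def by (subst emeasure_density) (auto intro!: nn_integral_cong simp: indicator_def)
  also have "\<dots> = (\<integral>\<^sup>+x. ennreal (std_normal_density x) * indicator A x \<partial>lborel)"
    by (subst (2) nn_integral_real_affine[where c = "-1" and t = 0]) (auto simp: normal_density_def)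
  also have "\<dots> = emeasure N01 A"
    unfolding N01_def by (subst emeasure_density) auto
  finally show ?thesis by (simp add: measure_def)
qed

lemma Phi_eq_cdf: "Phi = cdf N01"
  by (auto simp: Phi_def cdf_def)

lemma N01_singleton: "measure N01 {x} = 0"
proof -
  have "AE y in lborel. y \<noteq> x" by (rule AE_lborel_singleton)
  then have "emeasure N01 {x} = 0"
    unfolding N01_def by (subst emeasure_density) (auto simp: nn_integral_0_iff_AE indicator_def elim!: eventually_mono)
  then show ?thesis by (simp add: measure_def)
qed

lemma isCont_Phi: "isCont Phi x"
  unfolding Phi_eq_cdf by (simp add: N01.isCont_cdf N01_singleton)

lemma Phi_compl: "measure N01 {x<..} = 1 - Phi x"
  using N01.prob_compl[of "{..x}"] by (simp add: Phi_def Compl_eq_Diff_UNIV[symmetric])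

lemma Phi_uminus: "Phi (- x) = 1 - Phi x"
proof -
  have "measure N01 {..<-x} = measure N01 {x<..}"
    using N01_uminus[of "{x<..}"] by (simp add: vimage_def lessThan_def minus_less_iff less_minus_iff)
  moreover have "Phi (-x) = measure N01 {..<-x} + measure N01 {-x}"
    unfolding Phi_def by (subst N01.finite_measure_Union[symmetric]) (auto intro!: arg_cong[where f = "measure N01"])
  ultimately show ?thesis by (simp add: Phi_compl N01_singleton)
qed

lemma N01_two_sided_tail:
  assumes "0 \<le> x"
  shows "measure N01 {y. x < \<bar>y\<bar>} = 2 * (1 - Phi x)"
proof -
  have "{y. x < \<bar>y\<bar>} = {x<..} \<union> {..<-x}" using assms by auto
  then have "measure N01 {y. x < \<bar>y\<bar>} = measure N01 {x<..} + measure N01 {..<-x}"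
    using assms by (subst N01.finite_measure_Union[symmetric]) auto
  moreover have "measure N01 {..<-x} = measure N01 {x<..}"
    using N01_uminus[of "{x<..}"] by (simp add: vimage_def lessThan_def minus_less_iff less_minus_iff)
  ultimately show ?thesis by (simp add: Phi_compl)
qed

lemma Phi_tail_upper:
  assumes "0 \<le> x"
  shows "1 - Phi x \<le> exp (- x\<^sup>2 / 2)"
proof -
  \<comment> \<open>Chernoff bound with the optimal exponent \<open>x\<close>: the indicator is at
    most \<open>exp (x * y - x\<^sup>2)\<close>, whose integral is
    \<open>exp (- x\<^sup>2 / 2)\<close>.\<close>
  have "emeasure N01 {x<..} \<le> (\<integral>\<^sup>+y. ennreal (exp (- x\<^sup>2)) * ennreal (exp (x * y)) \<partial>N01)"
  proof (subst nn_integral_indicator[symmetric], simp, rule nn_integral_mono)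
    fix y :: real
    show "indicator {x<..} y \<le> ennreal (exp (- x\<^sup>2)) * ennreal (exp (x * y))"
    proof (cases "x < y")
      case True
      then have "0 \<le> - x\<^sup>2 + x * y" using assms by (simp add: power2_eq_square mult_left_mono)
      then show ?thesis using True by (simp flip: ennreal_mult exp_add)
    qed simp
  qed
  also have "\<dots> = ennreal (exp (- x\<^sup>2)) * ennreal (exp (x\<^sup>2 / 2))"
    by (simp add: nn_integral_cmult nn_integral_N01_exp)
  also have "\<dots> = ennreal (exp (- x\<^sup>2 / 2))"
    by (simp flip: ennreal_mult exp_add)
  finally have "measure N01 {x<..} \<le> exp (- x\<^sup>2 / 2)"
    by (simp add: N01.emeasure_eq_measure)
  then show ?thesis by (simp add: Phi_compl)
qed

lemma Phi_diff_lower: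
  assumes "x < y" and c: "\<And>t. x < t \<Longrightarrow> t \<le> y \<Longrightarrow> c \<le> std_normal_density t" and "0 \<le> c"
  shows "c * (y - x) \<le> Phi y - Phi x"
proof -
  have "ennreal (c * (y - x)) = (\<integral>\<^sup>+t. ennreal c * indicator {x<..y} t \<partial>lborel)"
    using assms by (simp add: nn_integral_cmult_indicator ennreal_mult)
  also have "\<dots> \<le> (\<integral>\<^sup>+t. ennreal (std_normal_density t) * indicator {x<..y} t \<partial>lborel)"
    by (intro nn_integral_mono) (auto simp: indicator_def intro!: c ennreal_leI)
  also have "\<dots> = emeasure N01 {x<..y}"
    unfolding N01_def by (subst emeasure_density) auto
  finally have "c * (y - x) \<le> measure N01 {x<..y}"
    by (simp add: N01.emeasure_eq_measure)
  then show ?thesis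
    using N01.cdf_diff_eq[OF assms(1)] by (simp add: Phi_eq_cdf)
qed

lemma Phi_strict_mono: "strict_mono Phi"
proof (rule strict_monoI)
  fix x y :: real assume xy: "x < y"
  define c where "c = std_normal_density (max \<bar>x\<bar> \<bar>y\<bar>)"
  have "c \<le> std_normal_density t" if "x < t" "t \<le> y" for t
  proof -
    have "\<bar>t\<bar> \<le> max \<bar>x\<bar> \<bar>y\<bar>" using that by auto
    then have "t\<^sup>2 \<le> (max \<bar>x\<bar> \<bar>y\<bar>)\<^sup>2" using power_mono[of "\<bar>t\<bar>" _ 2] by simp
    then show ?thesis by (simp add: c_def std_normal_density_def divide_right_mono)
  qed
  moreover have "0 < c" by (simp add: c_def normal_density_pos)
  ultimately have "c * (y - x) \<le> Phi y - Phi x" by (intro Phi_diff_lower xy) auto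
  moreover have "0 < c * (y - x)" using xy \<open>0 < c\<close> by simp
  ultimately show "Phi x < Phi y" by simp
qed

text \<open>The tail contains an interval of length 1 on which the density is at least its value at
  \<open>x + 1\<close>. The loss is only exponential in \<open>x\<close>, hence negligible when
  tails at \<open>x\<close> and at \<open>a * x\<close> are compared.\<close>

lemma Phi_tail_lower:
  assumes "0 \<le> x"
  shows "exp (- (x + 1)\<^sup>2 / 2) / sqrt (2 * pi) \<le> 1 - Phi x"
proof -
  have "exp (- (x + 1)\<^sup>2 / 2) / sqrt (2 * pi) * ((x + 1) - x) \<le> Phi (x + 1) - Phi x"
  proof (rule Phi_diff_lower)
    fix t assume "x < t" "t \<le> x + 1"
    then have "t\<^sup>2 \<le> (x + 1)\<^sup>2" using assms by (intro power_mono) auto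
    then show "exp (- (x + 1)\<^sup>2 / 2) / sqrt (2 * pi) \<le> std_normal_density t"
      by (simp add: std_normal_density_def divide_right_mono)
  qed auto
  moreover have "Phi (x + 1) \<le> 1" by (simp add: Phi_def)
  ultimately show ?thesis by simp
qed

text \<open>The definite description denotes: existence is the intermediate value theorem,
  uniqueness is strict monotonicity.\<close>

lemma Phi_Phi_inv:
  assumes "0 < u" "u < 1"
  shows "Phi (Phi_inv u) = u"
proof -
  have "eventually (\<lambda>x. Phi x < u) at_bot"
    using order_tendstoD(2)[OF N01.cdf_lim_at_bot assms(1)] by (simp add: Phi_eq_cdf)
  then obtain a where a: "Phi a < u" by (meson eventually_at_bot_linorder order_refl)
  have "eventually (\<lambda>x. Phi x > u) at_top"
    using order_tendstoD(1)[OF N01.cdf_lim_at_top_prob assms(2)] by (simp add: Phi_eq_cdf)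
  then obtain b where b: "u < Phi b" by (meson eventually_at_top_linorder order_refl)
  have "a \<le> b" using a b strict_mono_less[OF Phi_strict_mono, of b a] by force
  then obtain x where "Phi x = u"
    using IVT[of Phi a u b] a b isCont_Phi by auto
  moreover have "\<exists>!x. Phi x = u"
    using calculation strict_mono_eq[OF Phi_strict_mono] by metis
  ultimately show ?thesis unfolding Phi_inv_def by (rule_tac theI'[of "\<lambda>x. Phi x = u"])
qed

lemma Phi_0: "Phi 0 = 1 / 2"
  using Phi_uminus[of 0] by simp

lemma Phi_inv_mono:
  assumes "0 < u" "u \<le> v" "v < 1"
  shows "Phi_inv u \<le> Phi_inv v"
  using assms Phi_Phi_inv[of u] Phi_Phi_inv[of v] strict_mono_less_eq[OF Phi_strict_mono, of "Phi_inv u" "Phi_inv v"] by simp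

lemma Phi_inv_pos:
  assumes "1 / 2 < u" "u < 1"
  shows "0 < Phi_inv u"
  using assms Phi_Phi_inv[of u] strict_mono_less[OF Phi_strict_mono, of 0 "Phi_inv u"] by (simp add: Phi_0)

text \<open>For \<open>a > 1\<close> the quadratic term of the exponent outweighs the linear loss in
  the lower tail bound. This limit is the source of the vanishing false discovery rate.\<close>

lemma Phi_tail_ratio:
  assumes "1 < a"
  shows "((\<lambda>x. (1 - Phi (a * x)) / (1 - Phi x)) \<longlongrightarrow> 0) at_top"
proof (rule tendsto_sandwich)
  show "\<forall>\<^sub>F x in at_top. (1 - Phi (a * x)) / (1 - Phi x)
    \<le> exp (- (a * x)\<^sup>2 / 2) / (exp (- (x + 1)\<^sup>2 / 2) / sqrt (2 * pi))"
    using eventually_ge_at_top[of 0]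
  proof eventually_elim
    case (elim x)
    show ?case
      by (rule frac_le) (use elim assms Phi_tail_upper[of "a * x"] Phi_tail_lower[of x] in auto)
  qed
  show "\<forall>\<^sub>F x in at_top. 0 \<le> (1 - Phi (a * x)) / (1 - Phi x)"
    by (simp add: Phi_def)
  define c where "c = (a\<^sup>2 - 1) / 2"
  have "0 < c" using assms by (simp add: c_def)
  then have "((\<lambda>x. sqrt (2 * pi) * exp (x + 1 / 2 - c * x\<^sup>2)) \<longlongrightarrow> 0) at_top"
    by real_asymp
  moreover have "x + 1 / 2 - c * x\<^sup>2 = (x + 1)\<^sup>2 / 2 - (a * x)\<^sup>2 / 2" for x
    by (simp add: c_def power2_eq_square field_simps)
  moreover have "exp (- (a * x)\<^sup>2 / 2) / (exp (- (x + 1)\<^sup>2 / 2) / sqrt (2 * pi))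
     = sqrt (2 * pi) * exp ((x + 1)\<^sup>2 / 2 - (a * x)\<^sup>2 / 2)" for x
  proof -
    have "exp (- A / 2) / (exp (- B / 2) / S) = S * exp (B / 2 - A / 2)" for A B S :: real
    proof -
      have "exp (- A / 2) = inverse (exp (A / 2))" "exp (- B / 2) = inverse (exp (B / 2))"
        by (simp_all flip: exp_minus)
      then show ?thesis unfolding exp_diff[of "B / 2" "A / 2"] by (simp add: field_simps)
    qed
    then show ?thesis by blast
  qed
  ultimately show "((\<lambda>x. exp (- (a * x)\<^sup>2 / 2) / (exp (- (x + 1)\<^sup>2 / 2) / sqrt (2 * pi))) \<longlongrightarrow> 0) at_top"
    by simp
qed simp

text \<open>The SLOPE weight without its factor \<open>\<sigma> * (1 + \<delta>)\<close>. For
  \<open>1 \<le> m \<le> p\<close> the level is two-sided: among \<open>p\<close> standard normals,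
  \<open>q * m\<close> are expected to exceed it in absolute value.\<close>

definition zq :: "real \<Rightarrow> nat \<Rightarrow> nat \<Rightarrow> real" where
  "zq q p m = Phi_inv (1 - q * real m / (2 * real p))"

context
  fixes q :: real and p :: nat
  assumes q: "0 < q" "q < 1"
begin

lemma zq_arg:
  assumes "1 \<le> m" "m \<le> p"
  shows "0 < q * real m / (2 * real p)" "q * real m / (2 * real p) \<le> q / 2" "q * real m / (2 * real p) < 1 / 2"
proof -
  show "0 < q * real m / (2 * real p)" using q assms by simp
  show le: "q * real m / (2 * real p) \<le> q / 2" using q assms by (simp add: field_simps)
  show "q * real m / (2 * real p) < 1 / 2" using le q by linarith
qed

lemma Phi_zq: "1 \<le> m \<Longrightarrow> m \<le> p \<Longrightarrow> 1 - Phi (zq q p m) = q * real m / (2 * real p)"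
  unfolding zq_def using zq_arg[of m] by (subst Phi_Phi_inv) auto

lemma zq_pos: "1 \<le> m \<Longrightarrow> m \<le> p \<Longrightarrow> 0 < zq q p m"
  unfolding zq_def using zq_arg[of m] by (intro Phi_inv_pos) auto

lemma zq_antimono:
  assumes "1 \<le> l" "l \<le> m" "m \<le> p"
  shows "zq q p m \<le> zq q p l"
proof -
  have "q * real l / (2 * real p) \<le> q * real m / (2 * real p)"
    using assms q by (intro divide_right_mono mult_left_mono) auto
  then show ?thesis
    unfolding zq_def using zq_arg[of l] zq_arg[of m] assms by (intro Phi_inv_mono) auto
qed

lemma zq_upper:
  assumes "1 \<le> m" "m \<le> p"
  shows "(zq q p m)\<^sup>2 \<le> 2 * (ln (2 * real p / real m) + ln (1 / q))"
proof -
  have "q * real m / (2 * real p) \<le> exp (- (zq q p m)\<^sup>2 / 2)"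
    using Phi_tail_upper[of "zq q p m"] Phi_zq[of m] zq_pos[of m] assms by simp
  then have "ln (q * real m / (2 * real p)) \<le> ln (exp (- (zq q p m)\<^sup>2 / 2))"
    using zq_arg(1)[of m] assms by (intro ln_mono) auto
  moreover have "ln (q * real m / (2 * real p)) = - (ln (2 * real p / real m) + ln (1 / q))"
    using assms q by (simp add: ln_div ln_mult)
  ultimately show ?thesis by simp
qed

end

text \<open>The constant is uniform in \<open>p\<close> and \<open>m\<close>. When p / m is large
  the lower tail bound applies; when it is bounded, the quantile is at least the one at rank
  \<open>p\<close>, which depends on \<open>q\<close> alone.\<close>

lemma zq_lower:
  assumes q: "0 < q" "q < 1"
  obtains c where "0 < c" "\<And>p m. 1 \<le> m \<Longrightarrow> m \<le> p \<Longrightarrow> c * sqrt (ln (2 * real p / real m)) \<le> zq q p m"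
proof -
  \<comment> \<open>\<open>D\<close> collects the normalizing constant of the density and the 1 lost
    in (z + 1)^2 / 2 \<le> z^2 + 1; beyond \<open>2 * D\<close> it costs at most half of the
    logarithm.\<close>
  define D where "D = 1 + ln (sqrt (2 * pi))"
  have "1 \<le> sqrt (2 * pi)" using pi_gt3 by simp
  then have D: "1 \<le> D" by (simp add: D_def)
  define z0 where "z0 = Phi_inv (1 - q / 2)"
  have z0: "0 < z0" unfolding z0_def using q by (intro Phi_inv_pos) auto
  define c where "c = sqrt (min (1 / 2) (z0\<^sup>2 / (2 * D)))"
  have c: "0 < c" "c\<^sup>2 = min (1 / 2) (z0\<^sup>2 / (2 * D))" using z0 D by (auto simp: c_def)
  have "c * sqrt (ln (2 * real p / real m)) \<le> zq q p m" if m: "1 \<le> m" "m \<le> p" for p m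
  proof -
    define z where "z = zq q p m"
    define y where "y = ln (2 * real p / real m)"
    have z: "0 < z" unfolding z_def using zq_pos[OF q m] .
    have y0: "0 \<le> y" using m by (simp add: y_def field_simps)
    have "c\<^sup>2 * y \<le> z\<^sup>2"
    proof (cases "2 * D \<le> y")
      case True
      have "exp (- (z + 1)\<^sup>2 / 2) / sqrt (2 * pi) \<le> q * real m / (2 * real p)"
        using Phi_tail_lower[of z] Phi_zq[OF q m] z by (simp add: z_def)
      also have "\<dots> \<le> real m / (2 * real p)" using q by (simp add: divide_right_mono mult_left_le_one_le)
      finally have "ln (exp (- (z + 1)\<^sup>2 / 2) / sqrt (2 * pi)) \<le> ln (real m / (2 * real p))"
        using m by (subst ln_le_cancel_iff) auto
      then have "- (z + 1)\<^sup>2 / 2 - ln (sqrt (2 * pi)) \<le> - y"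
        using m by (simp add: ln_div y_def)
      moreover have "(z + 1)\<^sup>2 / 2 \<le> z\<^sup>2 + 1"
        using zero_le_power2[of "z - 1"] by (simp add: power2_eq_square field_simps)
      ultimately have "y - D \<le> z\<^sup>2" by (simp add: D_def)
      then have "1 / 2 * y \<le> z\<^sup>2" using True by simp
      moreover have "c\<^sup>2 * y \<le> 1 / 2 * y" using y0 unfolding c(2) by (intro mult_right_mono) auto
      ultimately show ?thesis by simp
    next
      case False
      have "c\<^sup>2 * y \<le> z0\<^sup>2 / (2 * D) * y" using y0 unfolding c(2) by (intro mult_right_mono) auto
      also have "\<dots> \<le> z0\<^sup>2 / (2 * D) * (2 * D)" using False D by (intro mult_left_mono) auto
      also have "\<dots> = z0\<^sup>2" using D by simp
      also have "\<dots> \<le> z\<^sup>2"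
      proof (rule power_mono)
        have "z0 = zq q p p" using m by (simp add: z0_def zq_def)
        then show "z0 \<le> z" unfolding z_def using zq_antimono[OF q, of m p p] m by simp
      qed (use z0 in simp)
      finally show ?thesis .
    qed
    then have "sqrt (c\<^sup>2 * y) \<le> z" using z by (intro real_le_lsqrt) auto
    then show ?thesis using c(1) by (simp add: real_sqrt_mult z_def y_def)
  qed
  then show ?thesis using that c(1) by blast
qed

section \<open>Concentration for i.i.d. standard normal coordinates\<close>

text \<open>Markov's inequality with a free test function, the common form behind the first-moment
  and exponential bounds below.\<close>

lemma (in prob_space) prob_le_nn_integral:
  assumes [measurable]: "A \<in> sets M" and ge: "\<And>\<omega>. \<omega> \<in> A \<Longrightarrow> 1 \<le> f \<omega>"
    and le: "(\<integral>\<^sup>+\<omega>. f \<omega> \<partial>M) \<le> ennreal C" and "0 \<le> C"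
  shows "prob A \<le> C"
proof -
  have "emeasure M A = (\<integral>\<^sup>+\<omega>. indicator A \<omega> \<partial>M)" by simp
  also have "\<dots> \<le> (\<integral>\<^sup>+\<omega>. f \<omega> \<partial>M)"
    by (intro nn_integral_mono) (auto simp: indicator_def ge)
  also note le
  finally show ?thesis using \<open>0 \<le> C\<close> by (simp add: emeasure_eq_measure)
qed

abbreviation N01s :: "'i set \<Rightarrow> ('i \<Rightarrow> real) measure" where
  "N01s I \<equiv> PiM I (\<lambda>_. N01)"

interpretation N01_PiM: product_sigma_finite "\<lambda>_. N01"
  by standard

lemma prob_space_PiM_N01: "prob_space (N01s I)"
  by (rule prob_space_PiM) (rule N01.prob_space_axioms)

lemma nn_integral_PiM_N01_prod:
  assumes "finite I" "f \<in> borel_measurable borel"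
  shows "(\<integral>\<^sup>+\<omega>. (\<Prod>i\<in>I. f (\<omega> i)) \<partial>N01s I) = (\<integral>\<^sup>+x. f x \<partial>N01) ^ card I"
  using N01_PiM.product_nn_integral_prod[of I "\<lambda>_. f"] assms by simp

lemma nn_integral_PiM_N01_prod_subset:
  assumes I: "finite I" "A \<subseteq> I" and [measurable]: "f \<in> borel_measurable borel"
  shows "(\<integral>\<^sup>+\<omega>. (\<Prod>i\<in>A. f (\<omega> i)) \<partial>N01s I) = (\<integral>\<^sup>+x. f x \<partial>N01) ^ card A"
proof -
  have "(\<Prod>i\<in>A. f (\<omega> i)) = (\<Prod>i\<in>I. (if i \<in> A then f (\<omega> i) else 1))" for \<omega> :: "'a \<Rightarrow> real"
    using I by (auto intro!: prod.mono_neutral_cong_left)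
  then have "(\<integral>\<^sup>+\<omega>. (\<Prod>i\<in>A. f (\<omega> i)) \<partial>N01s I)
    = (\<integral>\<^sup>+\<omega>. (\<Prod>i\<in>I. (if i \<in> A then f (\<omega> i) else 1)) \<partial>N01s I)" by simp
  also have "\<dots> = (\<Prod>i\<in>I. (\<integral>\<^sup>+x. (if i \<in> A then f x else 1) \<partial>N01))"
    using I by (intro N01_PiM.product_nn_integral_prod[where f = "\<lambda>i x. if i \<in> A then f x else 1"]) auto
  also have "\<dots> = (\<Prod>i\<in>A. (\<integral>\<^sup>+x. f x \<partial>N01))"
    using I N01.emeasure_space_1 by (intro prod.mono_neutral_cong_right) (auto)
  finally show ?thesis by simp
qed

lemma nn_integral_PiM_exp_sum_squares:
  assumes "finite I" "A \<subseteq> I" "s < 1 / 2"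
  shows "(\<integral>\<^sup>+\<omega>. ennreal (exp (s * (\<Sum>i\<in>A. (\<omega> i)\<^sup>2))) \<partial>N01s I) = ennreal ((1 - 2 * s) powr (- real (card A) / 2))"
proof -
  have "finite A" using assms finite_subset by blast
  then have "ennreal (exp (s * (\<Sum>i\<in>A. (\<omega> i)\<^sup>2))) = (\<Prod>i\<in>A. ennreal (exp (s * (\<omega> i)\<^sup>2)))" for \<omega> :: "'a \<Rightarrow> real"
    by (simp add: sum_distrib_left exp_sum prod_ennreal)
  then have "(\<integral>\<^sup>+\<omega>. ennreal (exp (s * (\<Sum>i\<in>A. (\<omega> i)\<^sup>2))) \<partial>N01s I) = ennreal (1 / sqrt (1 - 2 * s)) ^ card A"
    using nn_integral_PiM_N01_prod_subset[OF assms(1,2), of "\<lambda>x. ennreal (exp (s * x\<^sup>2))"]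
      nn_integral_N01_exp_square[OF assms(3)] by simp
  also have "\<dots> = ennreal ((1 / sqrt (1 - 2 * s)) ^ card A)"
    using assms by (simp add: ennreal_power)
  also have "1 / sqrt (1 - 2 * s) = (1 - 2 * s) powr (- 1 / 2)"
    using assms by (simp add: powr_half_sqrt[symmetric] powr_minus_divide)
  finally show ?thesis using assms by (simp add: powr_powr flip: powr_realpow)
qed

text \<open>Chernoff bound for a chi-square variable; the sign \<open>e\<close> treats the upper and
  the lower tail together.\<close>

lemma sum_squares_tail:
  assumes I: "finite I" and A: "A \<subseteq> I" and \<tau>: "0 < \<tau>" "\<tau> \<le> 1" and e: "\<bar>e\<bar> = 1"
  shows "measure (N01s I) {\<omega> \<in> space (N01s I). \<tau> * real (card A) < e * ((\<Sum>i\<in>A. (\<omega> i)\<^sup>2) - real (card A))}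
    \<le> exp (- (\<tau>\<^sup>2 / 16 * real (card A)))"
proof -
  interpret prob_space "N01s I" by (rule prob_space_PiM_N01)
  have [measurable]: "(\<lambda>\<omega>. \<Sum>i\<in>A. (\<omega> i)\<^sup>2) \<in> borel_measurable (N01s I)"
    by measurable (use A in auto)
  define n where "n = real (card A)"
  \<comment> \<open>Minimizes 4 t^2 - t \<tau>, the exponent per coordinate that remains once
    \<open>ln (1 - 2 * s)\<close> is replaced by its linear part up to an error of 8 t^2.\<close>
  define t where "t = \<tau> / 8"
  define s where "s = t * e"
  have t: "0 < t" "t \<le> 1 / 8" using \<tau> by (auto simp: t_def)
  then have s: "\<bar>s\<bar> = t" "s\<^sup>2 = t\<^sup>2" "s < 1 / 2"
    using e abs_le_D1[of s t] by (auto simp: s_def abs_mult power_mult_distrib power2_eq_square[of e] abs_if split: if_splits)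
  let ?f = "\<lambda>\<omega>. ennreal (exp (- (t * \<tau> * n + s * n))) * ennreal (exp (s * (\<Sum>i\<in>A. (\<omega> i)\<^sup>2)))"
  show ?thesis
  proof (rule prob_le_nn_integral)
    show "1 \<le> ?f \<omega>"
      if "\<omega> \<in> {\<omega> \<in> space (N01s I). \<tau> * real (card A) < e * ((\<Sum>i\<in>A. (\<omega> i)\<^sup>2) - real (card A))}" for \<omega>
    proof -
      have "t * (\<tau> * n) \<le> t * (e * ((\<Sum>i\<in>A. (\<omega> i)\<^sup>2) - n))"
        using that t by (intro mult_left_mono) (auto simp: n_def)
      then show ?thesis by (simp add: s_def algebra_simps flip: ennreal_mult exp_add)
    qed
    have "(\<integral>\<^sup>+\<omega>. ?f \<omega> \<partial>N01s I) = ennreal (exp (- (t * \<tau> * n + s * n))) * ennreal ((1 - 2 * s) powr (- n / 2))"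
      using nn_integral_PiM_exp_sum_squares[OF I A s(3)] by (subst nn_integral_cmult) (auto simp: n_def)
    also have "\<dots> = ennreal (exp (- (t * \<tau> * n + s * n)) * exp (- n / 2 * ln (1 - 2 * s)))"
      using s by (simp add: powr_def ennreal_mult)
    also have "\<dots> \<le> ennreal (exp (- (\<tau>\<^sup>2 / 16 * real (card A))))"
    proof (rule ennreal_leI)
      have "\<bar>ln (1 + - 2 * s) - - 2 * s\<bar> \<le> 2 * (- 2 * s)\<^sup>2"
        by (rule abs_ln_one_plus_x_minus_x_bound) (use s t in \<open>auto simp: abs_mult\<close>)
      then have "- (2 * s) - 8 * t\<^sup>2 \<le> ln (1 - 2 * s)"
        by (simp add: power_mult_distrib s(2))
      then have "n / 2 * (- (2 * s) - 8 * t\<^sup>2) \<le> n / 2 * ln (1 - 2 * s)"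
        by (intro mult_left_mono) (auto simp: n_def)
      then have "- (t * \<tau> * n + s * n) + - n / 2 * ln (1 - 2 * s) \<le> - (t * \<tau> * n + s * n) - n / 2 * (- (2 * s) - 8 * t\<^sup>2)"
        by simp
      also have "\<dots> = - (\<tau>\<^sup>2 / 16 * n)"
        by (simp add: t_def power2_eq_square field_simps)
      finally show "exp (- (t * \<tau> * n + s * n)) * exp (- n / 2 * ln (1 - 2 * s)) \<le> exp (- (\<tau>\<^sup>2 / 16 * real (card A)))"
        by (simp add: n_def flip: exp_add)
    qed
    finally show "(\<integral>\<^sup>+\<omega>. ?f \<omega> \<partial>N01s I) \<le> ennreal (exp (- (\<tau>\<^sup>2 / 16 * real (card A))))" .
  qed (use I in auto)
qed

lemma component_tail:
  assumes "finite I" "i \<in> I" "0 \<le> t"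
  shows "measure (N01s I) {\<omega> \<in> space (N01s I). t < \<bar>\<omega> i\<bar>} = 2 * (1 - Phi t)"
proof -
  have "measure (distr (N01s I) N01 (\<lambda>\<omega>. \<omega> i)) {y. t < \<bar>y\<bar>} =
    measure (N01s I) ((\<lambda>\<omega>. \<omega> i) -` {y. t < \<bar>y\<bar>} \<inter> space (N01s I))"
    using assms by (intro measure_distr) auto
  also have "distr (N01s I) N01 (\<lambda>\<omega>. \<omega> i) = N01"
    using assms by (intro distr_PiM_component N01.prob_space_axioms)
  finally show ?thesis
    using N01_two_sided_tail[OF assms(3)] by (simp add: vimage_def Int_def conj_commute)
qed

lemma max_tail:
  assumes I: "finite I" and "0 \<le> t"
  shows "measure (N01s I) {\<omega> \<in> space (N01s I). \<exists>i\<in>I. t < \<bar>\<omega> i\<bar>}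
    \<le> real (card I) * (2 * (1 - Phi t))"
proof -
  interpret prob_space "N01s I" by (rule prob_space_PiM_N01)
  have "prob {\<omega> \<in> space (N01s I). \<exists>i\<in>I. t < \<bar>\<omega> i\<bar>}
     = prob (\<Union>i\<in>I. {\<omega> \<in> space (N01s I). t < \<bar>\<omega> i\<bar>})"
    by (intro arg_cong[where f = prob]) auto
  also have "\<dots> \<le> (\<Sum>i\<in>I. prob {\<omega> \<in> space (N01s I). t < \<bar>\<omega> i\<bar>})"
    using I by (intro finite_measure_subadditive_finite) auto
  also have "\<dots> = (\<Sum>i\<in>I. 2 * (1 - Phi t))"
    using assms by (intro sum.cong component_tail) auto
  finally show ?thesis by simp
qed

lemma exceedance_count_eq:
  assumes "finite I"
  shows "real (card {i\<in>I. t < \<bar>\<omega> i\<bar>}) = (\<Sum>i\<in>I. indicator {y. t < \<bar>y\<bar>} (\<omega> i :: real))"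
  using sum.inter_filter[OF assms, of "\<lambda>_. 1 :: real" "\<lambda>i. t < \<bar>\<omega> i\<bar>"]
  by (simp add: indicator_def of_bool_def)

lemma measurable_exceedance_count [measurable]:
  assumes "finite I"
  shows "(\<lambda>\<omega>. real (card {i\<in>I. t < \<bar>\<omega> i\<bar>})) \<in> borel_measurable (N01s I)"
  unfolding exceedance_count_eq[OF assms] by measurable

text \<open>A first moment is enough at the single rank where the expected count is small compared
  with \<open>x\<close>.\<close>

lemma exceedance_count_markov:
  assumes I: "finite I" and t: "0 \<le> t" and x: "0 < x"
  shows "measure (N01s I) {\<omega> \<in> space (N01s I). x < real (card {i\<in>I. t < \<bar>\<omega> i\<bar>})}
    \<le> real (card I) * (2 * (1 - Phi t)) / x"
proof -
  interpret prob_space "N01s I" by (rule prob_space_PiM_N01)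
  let ?E = "{\<omega> \<in> space (N01s I). x < real (card {i\<in>I. t < \<bar>\<omega> i\<bar>})}"
  let ?X = "\<integral>\<^sup>+\<omega>. ennreal (1 / x) * ennreal (\<Sum>i\<in>I. indicator {y. t < \<bar>y\<bar>} (\<omega> i)) \<partial>N01s I"
  have nn: "0 \<le> 1 - Phi t" by (simp add: Phi_def)
  show ?thesis
  proof (rule prob_le_nn_integral)
    show "?E \<in> events"
      using measurable_exceedance_count[OF I] by measurable
    show "1 \<le> ennreal (1 / x) * ennreal (\<Sum>i\<in>I. indicator {y. t < \<bar>y\<bar>} (\<omega> i))"
      if "\<omega> \<in> ?E" for \<omega>
      using that x by (simp add: exceedance_count_eq[OF I] sum_nonneg field_simps flip: ennreal_mult)
    have "?X
      = ennreal (1 / x) * (\<integral>\<^sup>+\<omega>. ennreal (\<Sum>i\<in>I. indicator {y. t < \<bar>y\<bar>} (\<omega> i)) \<partial>N01s I)"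
      by (rule nn_integral_cmult) measurable
    also have "(\<integral>\<^sup>+\<omega>. ennreal (\<Sum>i\<in>I. indicator {y. t < \<bar>y\<bar>} (\<omega> i)) \<partial>N01s I)
      = (\<integral>\<^sup>+\<omega>. (\<Sum>i\<in>I. ennreal (indicator {y. t < \<bar>y\<bar>} (\<omega> i))) \<partial>N01s I)"
      by (intro nn_integral_cong) (simp add: sum_ennreal)
    also have "\<dots> = (\<Sum>i\<in>I. \<integral>\<^sup>+\<omega>. ennreal (indicator {y. t < \<bar>y\<bar>} (\<omega> i)) \<partial>N01s I)"
      by (rule nn_integral_sum) measurable
    also have "(\<Sum>i\<in>I. \<integral>\<^sup>+\<omega>. ennreal (indicator {y. t < \<bar>y\<bar>} (\<omega> i)) \<partial>N01s I) = (\<Sum>i\<in>I. ennreal (2 * (1 - Phi t)))"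
    proof (rule sum.cong[OF refl])
      fix i assume i: "i \<in> I"
      have "(\<integral>\<^sup>+\<omega>. ennreal (indicator {y. t < \<bar>y\<bar>} (\<omega> i)) \<partial>N01s I)
        = (\<integral>\<^sup>+\<omega>. indicator {\<omega> \<in> space (N01s I). t < \<bar>\<omega> i\<bar>} \<omega> \<partial>N01s I)"
        by (intro nn_integral_cong) (auto simp: indicator_def)
      also have "\<dots> = emeasure (N01s I) {\<omega> \<in> space (N01s I). t < \<bar>\<omega> i\<bar>}"
        using i by (intro nn_integral_indicator) measurable
      finally show "(\<integral>\<^sup>+\<omega>. ennreal (indicator {y. t < \<bar>y\<bar>} (\<omega> i)) \<partial>N01s I) = ennreal (2 * (1 - Phi t))"
        using component_tail[OF I i t] by (simp add: emeasure_eq_measure)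
    qed
    also have "ennreal (1 / x) * \<dots> = ennreal (1 / x) * ennreal (real (card I) * (2 * (1 - Phi t)))"
      using nn by (subst sum_ennreal) auto
    also have "\<dots> = ennreal (1 / x * (real (card I) * (2 * (1 - Phi t))))"
      using nn x by (intro ennreal_mult[symmetric]) auto
    finally show "?X
      \<le> ennreal (real (card I) * (2 * (1 - Phi t)) / x)"
      by simp
    show "0 \<le> real (card I) * (2 * (1 - Phi t)) / x" using nn x by simp
  qed
qed

text \<open>Here \<open>m\<close> is a rank, not the number of coordinates. The exponent is linear
  in \<open>m\<close> with a coefficient depending only on \<open>\<theta>\<close>, \<open>q\<close>
  and \<open>q'\<close>, so the bounds can be summed geometrically over all ranks.\<close>

lemma exceedance_count_chernoff:
  assumes I: "finite I" and t: "0 \<le> t" and mean: "real (card I) * (2 * (1 - Phi t)) \<le> q * m"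
    and \<theta>: "0 < \<theta>"
  shows "measure (N01s I) {\<omega> \<in> space (N01s I). q' * m < real (card {i\<in>I. t < \<bar>\<omega> i\<bar>})}
    \<le> exp (- ((\<theta> * q' - q * (exp \<theta> - 1)) * m))"
proof -
  interpret prob_space "N01s I" by (rule prob_space_PiM_N01)
  define \<pi> where "\<pi> = 2 * (1 - Phi t)"
  have nn: "0 \<le> \<pi>" by (simp add: Phi_def \<pi>_def)
  let ?f = "\<lambda>y :: real. ennreal (exp (\<theta> * indicator {y. t < \<bar>y\<bar>} y))"
  let ?E = "{\<omega> \<in> space (N01s I). q' * m < real (card {i\<in>I. t < \<bar>\<omega> i\<bar>})}"
  let ?Y = "\<integral>\<^sup>+\<omega>. ennreal (exp (- (\<theta> * (q' * m)))) * (\<Prod>i\<in>I. ?f (\<omega> i)) \<partial>N01s I"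
  let ?I = "\<integral>\<^sup>+y. ?f y \<partial>N01"
  show ?thesis
  proof (rule prob_le_nn_integral)
    show "?E \<in> events"
      using measurable_exceedance_count[OF I] by measurable
    show "1 \<le> ennreal (exp (- (\<theta> * (q' * m)))) * (\<Prod>i\<in>I. ?f (\<omega> i))"
      if "\<omega> \<in> ?E" for \<omega>
    proof -
      have "(\<Prod>i\<in>I. ?f (\<omega> i)) = ennreal (\<Prod>i\<in>I. exp (\<theta> * indicator {y. t < \<bar>y\<bar>} (\<omega> i)))"
        by (rule prod_ennreal) simp
      also have "\<dots> = ennreal (exp (\<theta> * real (card {i\<in>I. t < \<bar>\<omega> i\<bar>})))"
        by (simp only: exceedance_count_eq[OF I] exp_sum[OF I] sum_distrib_left)
      finally have "(\<Prod>i\<in>I. ?f (\<omega> i)) = \<dots>" .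
      moreover have "\<theta> * (q' * m) \<le> \<theta> * real (card {i\<in>I. t < \<bar>\<omega> i\<bar>})"
        using that \<theta> by (intro mult_left_mono) auto
      ultimately show ?thesis by (simp flip: ennreal_mult exp_add)
    qed
    have e: "ennreal (exp \<theta>) = 1 + ennreal (exp \<theta> - 1)"
      using \<theta> ennreal_plus[of 1 "exp \<theta> - 1"] by simp
    have "?I = (\<integral>\<^sup>+y. 1 + ennreal (exp \<theta> - 1) * indicator {y. t < \<bar>y\<bar>} y \<partial>N01)"
      by (intro nn_integral_cong) (auto simp: indicator_def e)
    also have "\<dots> = 1 + ennreal (exp \<theta> - 1) * emeasure N01 {y. t < \<bar>y\<bar>}"
      using N01.emeasure_space_1 by (subst nn_integral_add) (auto simp: nn_integral_cmult_indicator)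
    also have "\<dots> = ennreal (1 + (exp \<theta> - 1) * \<pi>)"
      using \<theta> nn N01_two_sided_tail[OF t]
      by (simp add: N01.emeasure_eq_measure \<pi>_def ennreal_plus ennreal_mult flip: ennreal_1)
    \<comment> \<open>The Bernoulli moment generating function is dominated by the Poisson one,
      after which only the mean count matters.\<close>
    also have "\<dots> \<le> ennreal (exp ((exp \<theta> - 1) * \<pi>))"
      by (intro ennreal_leI exp_ge_add_one_self)
    finally have "?I ^ card I \<le> ennreal (exp ((exp \<theta> - 1) * \<pi>)) ^ card I"
      by (rule power_mono) simp
    also have "\<dots> = ennreal (exp ((exp \<theta> - 1) * (real (card I) * \<pi>)))"
      by (simp add: ennreal_power exp_of_nat_mult[symmetric] mult_ac)
    also have "\<dots> \<le> ennreal (exp ((exp \<theta> - 1) * (q * m)))"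
      using mean \<theta> by (intro ennreal_leI iffD2[OF exp_le_cancel_iff] mult_left_mono) (auto simp: \<pi>_def)
    finally have le: "?I ^ card I \<le> \<dots>" .
    have "?Y
      = ennreal (exp (- (\<theta> * (q' * m)))) * ?I ^ card I"
      using nn_integral_PiM_N01_prod[OF I, of ?f] by (subst nn_integral_cmult) auto
    also have "\<dots> \<le> ennreal (exp (- (\<theta> * (q' * m)))) * ennreal (exp ((exp \<theta> - 1) * (q * m)))"
      using le by (intro mult_left_mono) auto
    also have "\<dots> = ennreal (exp (- ((\<theta> * q' - q * (exp \<theta> - 1)) * m)))"
      by (simp add: algebra_simps flip: ennreal_mult exp_add)
    finally show "?Y
      \<le> ennreal (exp (- ((\<theta> * q' - q * (exp \<theta> - 1)) * m)))" .
  qed simp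
qed

section \<open>Entropy of the subsets of a given size\<close>

lemma ln_ratio_ge_ln2:
  assumes "1 \<le> m" "m \<le> p"
  shows "ln 2 \<le> ln (2 * real p / real m)"
  using assms by (intro ln_mono) (auto simp: field_simps)

text \<open>Split off \<open>m * ln 2\<close>, which dominates \<open>ln m\<close>; the rest is at
  least \<open>ln (p / m)\<close>. Exponents of this form therefore always yield powers of 1 / p,
  even for singletons.\<close>

lemma mult_ln_ratio_ge:
  assumes "1 \<le> m" "m \<le> p"
  shows "ln (real p) \<le> real m * ln (2 * real p / real m)"
proof -
  have "ln (real m) \<le> ln (2 ^ m)"
    using assms by (intro ln_mono) (auto simp: less_imp_le of_nat_less_two_power)
  then have "ln (real m) \<le> real m * ln 2" by (simp add: ln_realpow)
  moreover have "1 * ln (real p / real m) \<le> real m * ln (real p / real m)"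
    using assms by (intro mult_right_mono ln_ge_zero) (auto simp: field_simps)
  moreover have "ln (2 * real p / real m) = ln 2 + ln (real p / real m)"
    using assms by (simp add: ln_mult ln_div)
  ultimately show ?thesis using assms by (simp add: ln_div algebra_simps)
qed

text \<open>The quotient by \<open>fact m\<close> is one term of the exponential series at
  \<open>m\<close>; this is the only form of Stirling's formula in use.\<close>

lemma power_self_le_exp_fact: "real m ^ m \<le> exp (real m) * fact m"
proof -
  have "(\<Sum>n\<in>{m}. real m ^ n /\<^sub>R fact n) \<le> (\<Sum>n. real m ^ n /\<^sub>R fact n)"
  proof (rule sum_le_suminf)
    show "summable (\<lambda>n. real m ^ n /\<^sub>R fact n)" by (rule summable_exp_generic)
  qed auto
  then show ?thesis by (simp add: exp_def field_simps)
qed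

text \<open>The usual bound (e p / m)^m. Since e < 4 and p / m \<ge> 1, its base is at most (2 p /
  m)^2, whence the factor 2 in the exponent.\<close>

lemma binomial_le_exp:
  assumes "1 \<le> m" "m \<le> p" "N \<le> p"
  shows "real (N choose m) \<le> exp (2 * (real m * ln (2 * real p / real m)))"
proof -
  define y where "y = ln (2 * real p / real m)"
  have y: "exp y = 2 * real p / real m" using assms by (simp add: y_def)
  have "real ((N choose m) * fact m) \<le> real (N ^ m)"
    by (intro of_nat_mono) (metis binomial_fact_pow)
  also have "\<dots> \<le> real p ^ m" using assms by (simp add: power_mono)
  finally have "real (N choose m) * fact m \<le> real p ^ m" by simp
  moreover have "real p ^ m \<le> exp (2 * (real m * y)) * fact m"
  proof -
    have "exp 1 * real p / real m \<le> exp (2 * y)"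
    proof -
      have "exp 1 \<le> (3 :: real)" by (rule exp_le)
      then have "exp 1 * real p / real m \<le> 4 * real p / real m"
        using assms by (intro divide_right_mono mult_right_mono) auto
      also have "\<dots> \<le> (2 * real p / real m) * (2 * real p / real m)"
        using assms by (simp add: field_simps)
      also have "\<dots> = exp (2 * y)" by (simp add: y[symmetric] flip: exp_add)
      finally show ?thesis .
    qed
    then have "(exp 1 * real p / real m) ^ m \<le> exp (2 * y) ^ m"
      by (intro power_mono) auto
    then have "exp (real m) * real p ^ m / real m ^ m \<le> exp (2 * (real m * y))"
      by (simp add: power_divide power_mult_distrib mult_ac flip: exp_of_nat_mult)
    then have "exp (real m) * real p ^ m \<le> exp (2 * (real m * y)) * real m ^ m"
      using assms by (simp add: field_simps)
    also have "\<dots> \<le> exp (2 * (real m * y)) * (exp (real m) * fact m)"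
      by (intro mult_left_mono power_self_le_exp_fact) auto
    finally show ?thesis by simp
  qed
  ultimately have "real (N choose m) * fact m \<le> exp (2 * (real m * y)) * fact m" by linarith
  then show ?thesis by (simp add: y_def)
qed

text \<open>
  With exponential moments at \<open>1 / 4\<close> the constant 28 gives the exponent 7; one unit pays for the
  factor \<open>sqrt 2\<close> per coordinate and two for the number of subsets of a given size.
\<close>

lemma subset_sum_squares_tail:
  assumes I: "finite I" and p: "card I \<le> p" "1 \<le> p"
  shows "measure (N01s I) {\<omega> \<in> space (N01s I). \<exists>A\<subseteq>I. A \<noteq> {} \<and>
      28 * (real (card A) * ln (2 * real p / real (card A))) < (\<Sum>i\<in>A. (\<omega> i)\<^sup>2)}
    \<le> 1 / real p ^ 3"
proof -
  let ?P = "N01s I"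
  interpret prob_space ?P by (rule prob_space_PiM_N01)
  define y where "y m = real m * ln (2 * real p / real m)" for m
  define E where "E A = {\<omega> \<in> space ?P. 28 * y (card A) < (\<Sum>i\<in>A. (\<omega> i)\<^sup>2)}" for A
  have meas: "E A \<in> events" if "A \<subseteq> I" for A
    unfolding E_def by measurable (use that in auto)
  have single: "prob (E A) \<le> exp (- (6 * y m))" if A: "A \<subseteq> I" and m: "card A = m" "1 \<le> m" for A m
  proof (rule prob_le_nn_integral[OF meas[OF A]])
    have mp: "m \<le> p" using card_mono[OF I A] m p by simp
    have [measurable]: "(\<lambda>\<omega>. \<Sum>i\<in>A. (\<omega> i)\<^sup>2) \<in> borel_measurable ?P"
      by measurable (use A in auto)
    show "1 \<le> ennreal (exp (- (7 * y m))) * ennreal (exp (1 / 4 * (\<Sum>i\<in>A. (\<omega> i)\<^sup>2)))"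
      if "\<omega> \<in> E A" for \<omega>
      using that m by (simp add: E_def flip: ennreal_mult exp_add)
    have "(\<integral>\<^sup>+\<omega>. ennreal (exp (- (7 * y m))) * ennreal (exp (1 / 4 * (\<Sum>i\<in>A. (\<omega> i)\<^sup>2))) \<partial>?P)
      = ennreal (exp (- (7 * y m))) * ennreal ((1 - 2 * (1 / 4)) powr (- real m / 2))"
      using nn_integral_PiM_exp_sum_squares[OF I A, of "1 / 4"] m A
      by (subst nn_integral_cmult) auto
    also have "\<dots> = ennreal (exp (- (7 * y m)) * exp (real m / 2 * ln 2))"
      by (simp add: powr_def ennreal_mult ln_div)
    also have "\<dots> \<le> ennreal (exp (- (6 * y m)))"
    proof (rule ennreal_leI)
      have "real m / 2 * ln 2 \<le> real m * ln 2" by simp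
      also have "\<dots> \<le> y m"
        unfolding y_def by (intro mult_left_mono ln_ratio_ge_ln2) (use m mp in auto)
      finally show "exp (- (7 * y m)) * exp (real m / 2 * ln 2) \<le> exp (- (6 * y m))"
        by (simp flip: exp_add)
    qed
    finally show "(\<integral>\<^sup>+\<omega>. ennreal (exp (- (7 * y m))) * ennreal (exp (1 / 4 * (\<Sum>i\<in>A. (\<omega> i)\<^sup>2))) \<partial>?P)
      \<le> ennreal (exp (- (6 * y m)))" .
  qed simp
  define S where "S m = {A. A \<subseteq> I \<and> card A = m}" for m
  have finS: "finite (S m)" for m unfolding S_def using I by simp
  have level: "prob (\<Union>A\<in>S m. E A) \<le> 1 / real p ^ 4" if m: "m \<in> {1..p}" for m
  proof -
    have "prob (\<Union>A\<in>S m. E A) \<le> (\<Sum>A\<in>S m. prob (E A))"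
      by (intro finite_measure_subadditive_finite finS) (auto simp: S_def meas)
    also have "\<dots> \<le> (\<Sum>A\<in>S m. exp (- (6 * y m)))"
      by (intro sum_mono single) (use m in \<open>auto simp: S_def\<close>)
    also have "\<dots> = real (card I choose m) * exp (- (6 * y m))"
      using n_subsets[OF I, of m] by (simp add: S_def)
    also have "\<dots> \<le> exp (2 * y m) * exp (- (6 * y m))"
      unfolding y_def by (intro mult_right_mono binomial_le_exp) (use m p in auto)
    \<comment> \<open>The remaining exponent 4 gives p^-4 for every size \<open>m\<close>; the union
      over the sizes costs one power of \<open>p\<close>.\<close>
    also have "\<dots> \<le> exp (- (4 * ln (real p)))"
      using mult_ln_ratio_ge[of m p] m by (simp add: y_def flip: exp_add)
    also have "\<dots> = 1 / real p ^ 4"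
      using p exp_of_nat_mult[of 4 "ln (real p)"] by (simp add: exp_minus field_simps)
    finally show ?thesis .
  qed
  have "{\<omega> \<in> space ?P. \<exists>A\<subseteq>I. A \<noteq> {} \<and> 28 * (real (card A) * ln (2 * real p / real (card A))) < (\<Sum>i\<in>A. (\<omega> i)\<^sup>2)}
    = (\<Union>m\<in>{1..p}. \<Union>A\<in>S m. E A)"
  proof -
    have "1 \<le> card A \<and> card A \<le> p" if "A \<subseteq> I" "A \<noteq> {}" for A
      using that card_mono[OF I that(1)] finite_subset[OF that(1) I] p by (auto simp: Suc_le_eq card_gt_0_iff)
    then have mem: "A \<subseteq> I \<and> A \<noteq> {} \<longleftrightarrow> (\<exists>m\<in>{1..p}. A \<in> S m)" for A
      by (cases "A = {}") (auto simp: S_def)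
    have "(\<Union>m\<in>{1..p}. \<Union>A\<in>S m. E A) = {\<omega>. \<exists>A. (\<exists>m\<in>{1..p}. A \<in> S m) \<and> \<omega> \<in> E A}"
      by blast
    then show ?thesis
      unfolding mem[symmetric] by (simp add: E_def y_def) blast
  qed
  also have "prob \<dots> \<le> (\<Sum>m\<in>{1..p}. prob (\<Union>A\<in>S m. E A))"
  proof (rule finite_measure_subadditive_finite)
    have "(\<Union>A\<in>S m. E A) \<in> events" for m
      by (intro sets.finite_UN finS meas) (simp add: S_def)
    then show "(\<lambda>m. \<Union>A\<in>S m. E A) ` {1..p} \<subseteq> events" by blast
  qed simp
  also have "\<dots> \<le> (\<Sum>m\<in>{1..p}. 1 / real p ^ 4)"
    by (intro sum_mono level)
  also have "\<dots> = 1 / real p ^ 3"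
    using p by (simp add: power_def field_simps eval_nat_numeral)
  finally show ?thesis .
qed

section \<open>Projections of the columns on a fixed column\<close>

lemma indep_vars_PiM_N01:
  assumes "finite R"
  shows "prob_space.indep_vars (N01s R) (\<lambda>_. N01) (\<lambda>i \<omega>. \<omega> i) R"
proof -
  interpret prob_space "N01s R" by (rule prob_space_PiM_N01)
  show ?thesis
  \<comment> \<open>The characterization of independence by product distributions is stated for
    nonempty index sets.\<close>
  proof (cases "R = {}")
    case True
    show ?thesis unfolding indep_vars_def2 indep_sets_def using True by simp
  next
    case False
    have "distr (N01s R) (N01s R) (\<lambda>x. \<lambda>i\<in>R. x i) = distr (N01s R) (N01s R) (\<lambda>x. x)"
      by (rule distr_cong) (auto simp: space_PiM)
    also have "\<dots> = N01s R" by simp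
    also have "\<dots> = (\<Pi>\<^sub>M i\<in>R. distr (N01s R) N01 (\<lambda>\<omega>. \<omega> i))"
      by (intro PiM_cong refl distr_PiM_component[symmetric] N01.prob_space_axioms)
    finally show ?thesis
      by (subst indep_vars_iff_distr_eq_PiM'[OF False]) auto
  qed
qed

text \<open>\<open>f j\<close> is the factorization of \<open>g j\<close> through its block of
  coordinates; disjoint blocks make the functions independent.\<close>

lemma indep_vars_blocks:
  assumes R: "finite R" and K: "\<And>j. j \<in> A \<Longrightarrow> K j \<subseteq> R" "disjoint_family_on K A"
    and f: "\<And>j. j \<in> A \<Longrightarrow> f j \<in> borel_measurable (N01s (K j))"
    and ext: "\<And>j \<omega>. j \<in> A \<Longrightarrow> f j (restrict \<omega> (K j)) = g j \<omega>"
  shows "prob_space.indep_vars (N01s R) (\<lambda>_. borel) g A"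
proof -
  interpret prob_space "N01s R" by (rule prob_space_PiM_N01)
  have "indep_vars (\<lambda>j. N01s (K j)) (\<lambda>j \<omega>. restrict (\<lambda>i. \<omega> i) (K j)) A"
    by (rule indep_vars_restrict[OF indep_vars_PiM_N01[OF R] K])
  then have "indep_vars (\<lambda>_. borel) (\<lambda>j \<omega>. f j (restrict (\<lambda>i. \<omega> i) (K j))) A"
    by (rule indep_vars_compose2) (rule f)
  then show ?thesis using ext by (subst indep_vars_cong[OF refl _ refl]) auto
qed

lemma distr_linear_combination:
  fixes w :: "nat \<Rightarrow> real"
  assumes R: "finite R" and \<kappa>: "\<And>l. l < n \<Longrightarrow> \<kappa> l \<in> R" "inj_on \<kappa> {..<n}" and w: "(\<Sum>l<n. (w l)\<^sup>2) = 1"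
  shows "distr (N01s R) borel (\<lambda>\<omega>. \<Sum>l<n. w l * \<omega> (\<kappa> l)) = N01"
proof -
  interpret prob_space "N01s R" by (rule prob_space_PiM_N01)
  \<comment> \<open>Zero coefficients are dropped, since a normal density needs a positive standard
    deviation; the unit norm keeps \<open>L\<close> nonempty.\<close>
  define L where "L = {l. l < n \<and> w l \<noteq> 0}"
  have L: "finite L" "L \<subseteq> {..<n}" by (auto simp: L_def)
  have sumL: "(\<Sum>l<n. g l) = (\<Sum>l\<in>L. g l)" if "\<And>l. w l = 0 \<Longrightarrow> g l = 0" for g :: "nat \<Rightarrow> real"
    using that by (intro sum.mono_neutral_right) (auto simp: L_def)
  have Lne: "L \<noteq> {}" using w sumL[of "\<lambda>l. (w l)\<^sup>2"] by auto
  have ind: "indep_vars (\<lambda>_. borel) (\<lambda>l \<omega>. w l * \<omega> (\<kappa> l)) L"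
  proof (rule indep_vars_blocks[OF R, where K = "\<lambda>l. {\<kappa> l}" and f = "\<lambda>l \<omega>. w l * \<omega> (\<kappa> l)"])
    show "disjoint_family_on (\<lambda>l. {\<kappa> l}) L"
      using \<kappa>(2) L(2) by (auto simp: disjoint_family_on_def inj_on_def)
  qed (use \<kappa> L in auto)
  have comp: "distributed (N01s R) lborel (\<lambda>\<omega>. w l * \<omega> (\<kappa> l)) (normal_density 0 \<bar>w l\<bar>)" if "l \<in> L" for l
  proof -
    have l: "\<kappa> l \<in> R" "w l \<noteq> 0" using that \<kappa> by (auto simp: L_def)
    have "distr (N01s R) lborel (\<lambda>\<omega>. \<omega> (\<kappa> l)) = distr (N01s R) N01 (\<lambda>\<omega>. \<omega> (\<kappa> l))"
      by (rule distr_cong) auto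
    also have "\<dots> = N01" using l by (intro distr_PiM_component N01.prob_space_axioms)
    finally have "distributed (N01s R) lborel (\<lambda>\<omega>. \<omega> (\<kappa> l)) std_normal_density"
      using l unfolding distributed_def by (auto simp: N01_def cong: measurable_cong_sets)
    from normal_density_affine[OF this _ l(2), of 0] show ?thesis by simp
  qed
  have "distributed (N01s R) lborel (\<lambda>\<omega>. \<Sum>l\<in>L. w l * \<omega> (\<kappa> l))
     (normal_density (\<Sum>l\<in>L. 0) (sqrt (\<Sum>l\<in>L. \<bar>w l\<bar>\<^sup>2)))"
    by (rule sum_indep_normal[OF L(1) Lne ind _ comp]) (auto simp: L_def)
  moreover have "(\<Sum>l\<in>L. \<bar>w l\<bar>\<^sup>2) = 1" using w sumL[of "\<lambda>l. (w l)\<^sup>2"] by simp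
  ultimately have "distr (N01s R) lborel (\<lambda>\<omega>. \<Sum>l\<in>L. w l * \<omega> (\<kappa> l)) = N01"
    by (simp add: distributed_def N01_def)
  moreover have "distr (N01s R) borel (\<lambda>\<omega>. \<Sum>l<n. w l * \<omega> (\<kappa> l))
     = distr (N01s R) lborel (\<lambda>\<omega>. \<Sum>l\<in>L. w l * \<omega> (\<kappa> l))"
    by (rule distr_cong) (auto intro!: sumL)
  ultimately show ?thesis by simp
qed

text \<open>Each combination reads its own block of variables, which gives independence, and a
  weight vector of unit norm preserves the standard normal law.\<close>

lemma distr_normalized_columns:
  fixes w :: "nat \<Rightarrow> real"
  assumes R: "finite R" and \<kappa>: "\<And>j l. j \<in> A \<Longrightarrow> l < n \<Longrightarrow> \<kappa> j l \<in> R"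
    and inj: "inj_on (\<lambda>(j, l). \<kappa> j l) (A \<times> {..<n})"
    and w: "(\<Sum>l<n. (w l)\<^sup>2) = 1" and A: "A \<noteq> {}"
  shows "distr (N01s R) (N01s A) (\<lambda>\<omega>. \<lambda>j\<in>A. \<Sum>l<n. w l * \<omega> (\<kappa> j l)) = N01s A"
proof -
  interpret prob_space "N01s R" by (rule prob_space_PiM_N01)
  define K where "K j = \<kappa> j ` {..<n}" for j
  have meas: "(\<lambda>\<omega>. \<Sum>l<n. w l * \<omega> (\<kappa> j l)) \<in> borel_measurable (N01s I)" if "K j \<subseteq> I" for j I
    using that by (intro borel_measurable_sum borel_measurable_times borel_measurable_const)
      (auto simp: K_def intro!: measurable_component_singleton)
  have KR: "K j \<subseteq> R" if "j \<in> A" for j using that \<kappa> by (auto simp: K_def)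
  have ind: "indep_vars (\<lambda>_. borel) (\<lambda>j \<omega>. \<Sum>l<n. w l * \<omega> (\<kappa> j l)) A"
  proof (rule indep_vars_blocks[OF R KR, where f = "\<lambda>j \<omega>. \<Sum>l<n. w l * \<omega> (\<kappa> j l)"])
    show "disjoint_family_on K A"
      using inj by (fastforce simp: disjoint_family_on_def inj_on_def K_def)
  qed (auto intro!: meas simp: K_def)
  have "distr (N01s R) (PiM A (\<lambda>_. borel)) (\<lambda>\<omega>. \<lambda>j\<in>A. \<Sum>l<n. w l * \<omega> (\<kappa> j l))
     = (\<Pi>\<^sub>M j\<in>A. distr (N01s R) borel (\<lambda>\<omega>. \<Sum>l<n. w l * \<omega> (\<kappa> j l)))"
    by (rule indep_vars_iff_distr_eq_PiM'[THEN iffD1, OF A _ ind]) (use KR in \<open>auto intro!: meas\<close>)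
  also have "\<dots> = N01s A"
  proof (rule PiM_cong[OF refl])
    fix j assume "j \<in> A"
    then show "distr (N01s R) borel (\<lambda>\<omega>. \<Sum>l<n. w l * \<omega> (\<kappa> j l)) = N01"
      using inj by (intro distr_linear_combination[OF R \<kappa> _ w]) (auto simp: inj_on_def)
  qed
  finally have "distr (N01s R) (PiM A (\<lambda>_. borel)) (\<lambda>\<omega>. \<lambda>j\<in>A. \<Sum>l<n. w l * \<omega> (\<kappa> j l)) = N01s A" .
  moreover have "distr (N01s R) (PiM A (\<lambda>_. borel)) (\<lambda>\<omega>. \<lambda>j\<in>A. \<Sum>l<n. w l * \<omega> (\<kappa> j l))
    = distr (N01s R) (N01s A) (\<lambda>\<omega>. \<lambda>j\<in>A. \<Sum>l<n. w l * \<omega> (\<kappa> j l))"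
    by (rule distr_cong[OF refl _ refl]) (intro sets_PiM_cong, auto)
  ultimately show ?thesis by simp
qed

text \<open>
  Column \<open>j < p\<close> is the unscaled \<open>j\<close>-th column of the design, column \<open>p\<close> is the noise vector.
\<close>

definition col :: "nat \<Rightarrow> nat \<Rightarrow> nat \<Rightarrow> (nat \<times> nat) + nat" where
  "col p j l = (if j < p then Inl (l, j) else Inr l)"

definition colnorm2 :: "nat \<Rightarrow> nat \<Rightarrow> (((nat \<times> nat) + nat) \<Rightarrow> real) \<Rightarrow> nat \<Rightarrow> real" where
  "colnorm2 n p \<omega> j = (\<Sum>l<n. (\<omega> (col p j l))\<^sup>2)"

text \<open>The inner product of column \<open>j\<close> with the unit vector along column
  \<open>c\<close>. On a vanishing column \<open>c\<close> the division makes it 0, so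
  distributional statements are restricted to
  \<open>colnorm2 n p \<omega> c \<noteq> 0\<close>.\<close>

definition proj :: "nat \<Rightarrow> nat \<Rightarrow> (((nat \<times> nat) + nat) \<Rightarrow> real) \<Rightarrow> nat \<Rightarrow> nat \<Rightarrow> real" where
  "proj n p \<omega> c j = (\<Sum>l<n. \<omega> (col p c l) / sqrt (colnorm2 n p \<omega> c) * \<omega> (col p j l))"

lemma finite_idx [simp]: "finite (idx n p)"
  by (simp add: idx_def)

lemma col_in_idx: "j \<le> p \<Longrightarrow> l < n \<Longrightarrow> col p j l \<in> idx n p"
  by (auto simp: col_def idx_def)

lemma col_inj: "j \<le> p \<Longrightarrow> j' \<le> p \<Longrightarrow> col p j l = col p j' l' \<longleftrightarrow> j = j' \<and> l = l'"
  by (auto simp: col_def)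

lemma prob_space_Omega: "prob_space (Omega n p)"
  unfolding Omega_def by (rule prob_space_PiM_N01)

lemma measurable_col: "j \<le> p \<Longrightarrow> l < n \<Longrightarrow> (\<lambda>\<omega>. \<omega> (col p j l)) \<in> borel_measurable (Omega n p)"
  unfolding Omega_def using measurable_component_singleton[OF col_in_idx, of j p l n "\<lambda>_. N01"]
  by (simp cong: measurable_cong_sets)

lemma measurable_colnorm2: "j \<le> p \<Longrightarrow> (\<lambda>\<omega>. colnorm2 n p \<omega> j) \<in> borel_measurable (Omega n p)"
  unfolding colnorm2_def by (intro borel_measurable_sum borel_measurable_power measurable_col) auto

lemma measurable_proj:
  "c \<le> p \<Longrightarrow> j \<le> p \<Longrightarrow> (\<lambda>\<omega>. proj n p \<omega> c j) \<in> borel_measurable (Omega n p)"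
  unfolding proj_def
proof (rule borel_measurable_sum)
  fix l assume cj: "c \<le> p" "j \<le> p" and "l \<in> {..<n}"
  then have [measurable]: "(\<lambda>\<omega>. \<omega> (col p c l)) \<in> borel_measurable (Omega n p)"
    "(\<lambda>\<omega>. \<omega> (col p j l)) \<in> borel_measurable (Omega n p)"
    "(\<lambda>\<omega>. colnorm2 n p \<omega> c) \<in> borel_measurable (Omega n p)"
    by (auto intro: measurable_col measurable_colnorm2)
  show "(\<lambda>\<omega>. \<omega> (col p c l) / sqrt (colnorm2 n p \<omega> c) * \<omega> (col p j l)) \<in> borel_measurable (Omega n p)"
    by measurable
qed

lemma measurable_proj_family:
  assumes "c \<le> p" "A \<subseteq> {..p}"
  shows "(\<lambda>\<omega>. \<lambda>j\<in>A. proj n p \<omega> c j) \<in> measurable (Omega n p) (N01s A)"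
  using assms by (intro measurable_restrict) (auto intro!: measurable_proj cong: measurable_cong_sets)

text \<open>Conditionally on column \<open>c\<close> the weights form a fixed unit vector, and the
  other columns are independent of it. Column \<open>p\<close> is allowed for \<open>c\<close>, so
  the noise correlations are covered as well.\<close>

lemma proj_family_prob_le:
  assumes c: "c \<le> p" and A: "A \<subseteq> {..p} - {c}" "A \<noteq> {}" and B: "B \<in> sets (N01s A)"
  shows "measure (Omega n p) {\<omega> \<in> space (Omega n p). colnorm2 n p \<omega> c \<noteq> 0 \<and> (\<lambda>j\<in>A. proj n p \<omega> c j) \<in> B}
    \<le> measure (N01s A) B"
proof -
  define C where "C = col p c ` {..<n}"
  define R where "R = idx n p - C"
  have CR: "C \<union> R = idx n p" "C \<inter> R = {}" "finite C" "finite R"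
    using col_in_idx[OF c] by (auto simp: C_def R_def)
  have colR: "col p j l \<in> R" if "j \<in> A" "l < n" for j l
    using that A col_in_idx[of j p l n] col_inj[of j p c] c by (auto simp: R_def C_def)
  have colC: "col p c l \<in> C" if "l < n" for l using that by (auto simp: C_def)
  have injA: "inj_on (\<lambda>(j, l). col p j l) (A \<times> {..<n})"
  proof -
    have "j \<le> p" if "j \<in> A" for j using A that by auto
    then show ?thesis by (auto simp: inj_on_def col_inj)
  qed
  let ?E = "{\<omega> \<in> space (Omega n p). colnorm2 n p \<omega> c \<noteq> 0 \<and> (\<lambda>j\<in>A. proj n p \<omega> c j) \<in> B}"
  have [measurable]: "(\<lambda>\<omega>. \<lambda>j\<in>A. proj n p \<omega> c j) \<in> measurable (Omega n p) (N01s A)"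
    using A by (intro measurable_proj_family c) auto
  have [measurable]: "(\<lambda>\<omega>. colnorm2 n p \<omega> c) \<in> borel_measurable (Omega n p)"
    by (rule measurable_colnorm2[OF c])
  have E: "?E \<in> sets (Omega n p)"
    using B by measurable
  interpret O: prob_space "Omega n p" by (rule prob_space_Omega)
  interpret PA: prob_space "N01s A" by (rule prob_space_PiM_N01)
  interpret PC: prob_space "N01s C" by (rule prob_space_PiM_N01)
  have E': "indicator ?E \<in> borel_measurable (N01s (C \<union> R))"
    using E by (auto simp: CR Omega_def)
  have "emeasure (Omega n p) ?E = (\<integral>\<^sup>+\<omega>. indicator ?E \<omega> \<partial>N01s (C \<union> R))"
    using E by (simp add: CR Omega_def)
  \<comment> \<open>Fubini with column \<open>c\<close> outside: the inner integral is bounded for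
    each fixed \<open>x\<close>, trivially when the norm of that column is 0.\<close>
  also have "\<dots> = (\<integral>\<^sup>+x. (\<integral>\<^sup>+y. indicator ?E (merge C R (x, y)) \<partial>N01s R) \<partial>N01s C)"
    by (rule N01_PiM.product_nn_integral_fold[OF CR(2,3,4) E'])
  also have "\<dots> \<le> (\<integral>\<^sup>+x. emeasure (N01s A) B \<partial>N01s C)"
  proof (rule nn_integral_mono)
    fix x :: "nat \<times> nat + nat \<Rightarrow> real"
    define N where "N = (\<Sum>l<n. (x (col p c l))\<^sup>2)"
    have norm: "colnorm2 n p (merge C R (x, y)) c = N" for y
      unfolding colnorm2_def N_def using colC CR(2) by (intro sum.cong) auto
    show "(\<integral>\<^sup>+y. indicator ?E (merge C R (x, y)) \<partial>N01s R) \<le> emeasure (N01s A) B"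
    proof (cases "N = 0")
      case True
      then have "indicator ?E (merge C R (x, y)) = (0 :: ennreal)" for y
        by (simp add: norm)
      then show ?thesis by simp
    next
      case False
      define w where "w l = x (col p c l) / sqrt N" for l
      have N0: "0 \<le> N" by (simp add: N_def sum_nonneg)
      have w: "(\<Sum>l<n. (w l)\<^sup>2) = 1"
        using False N0 by (simp add: w_def power_divide N_def flip: sum_divide_distrib)
      let ?V = "\<lambda>y. \<lambda>j\<in>A. \<Sum>l<n. w l * y (col p j l)"
      have pr: "(\<lambda>j\<in>A. proj n p (merge C R (x, y)) c j) = ?V y" for y
        unfolding proj_def norm w_def using colC colR CR(2) by (intro restrict_ext sum.cong) auto
      have mc: "(\<lambda>y. y (col p j l)) \<in> borel_measurable (N01s R)" if "j \<in> A" "l < n" for j l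
        using measurable_component_singleton[OF colR[OF that], of "\<lambda>_. N01"] by (simp cong: measurable_cong_sets)
      have V: "?V \<in> measurable (N01s R) (N01s A)"
        by (intro measurable_restrict) (auto intro!: borel_measurable_sum borel_measurable_times mc
            cong: measurable_cong_sets)
      have "(\<integral>\<^sup>+y. indicator ?E (merge C R (x, y)) \<partial>N01s R)
        \<le> (\<integral>\<^sup>+y. indicator (?V -` B \<inter> space (N01s R)) y \<partial>N01s R)"
        by (intro nn_integral_mono) (auto simp: indicator_def pr)
      also have "\<dots> = emeasure (distr (N01s R) (N01s A) ?V) B"
        using measurable_sets[OF V B] V B by (simp add: emeasure_distr)
      also have "distr (N01s R) (N01s A) ?V = N01s A"
        by (rule distr_normalized_columns[OF CR(4) colR injA w A(2)])
      finally show ?thesis .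
    qed
  qed
  also have "\<dots> = emeasure (N01s A) B"
    by (simp add: PC.emeasure_space_1)
  finally show ?thesis
    by (simp add: O.emeasure_eq_measure PA.emeasure_eq_measure)
qed

section \<open>Selection on the good event\<close>

text \<open>The hypothesis says that the \<open>l\<close>-th largest value is at most
  \<open>t l\<close>. An element not exceeding the threshold of the last rank is removed, and the
  counts of the rest can only drop.\<close>

lemma sum_le_of_exceedance_counts:
  fixes v :: "'a \<Rightarrow> real" and t :: "nat \<Rightarrow> real"
  assumes "finite M" and "\<And>l. 1 \<le> l \<Longrightarrow> l \<le> card M \<Longrightarrow> card {j\<in>M. t l < v j} < l"
  shows "(\<Sum>j\<in>M. v j) \<le> (\<Sum>l<card M. t (Suc l))"
  using assms
proof (induction "card M" arbitrary: M)
  case 0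
  then show ?case by simp
next
  case (Suc m)
  have "card {j\<in>M. t (Suc m) < v j} < card M"
    using Suc.prems(2)[of "Suc m"] Suc.hyps(2) by simp
  then have "{j\<in>M. t (Suc m) < v j} \<noteq> M" by force
  then obtain j where j: "j \<in> M" "v j \<le> t (Suc m)" by force
  have cM: "card (M - {j}) = m" using Suc.hyps(2) Suc.prems(1) j by simp
  have "(\<Sum>j\<in>M - {j}. v j) \<le> (\<Sum>l<card (M - {j}). t (Suc l))"
  proof (rule Suc.hyps(1))
    fix l assume l: "1 \<le> l" "l \<le> card (M - {j})"
    have "card {i\<in>M - {j}. t l < v i} \<le> card {i\<in>M. t l < v i}"
      using Suc.prems(1) by (intro card_mono) auto
    also have "\<dots> < l" using l cM Suc.hyps(2) by (intro Suc.prems(2)) auto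
    finally show "card {i\<in>M - {j}. t l < v i} < l" .
  qed (use cM Suc.prems(1) in auto)
  then show ?case
    using sum.remove[OF Suc.prems(1) j(1), of v] j(2) cM Suc.hyps(2)[symmetric] by simp
qed

lemma gram_col:
  assumes "i < p" "j < p"
  shows "gram n (Xmat n \<omega>) i j = (\<Sum>l<n. \<omega> (col p i l) * \<omega> (col p j l)) / real n"
  using assms by (simp add: gram_def Xmat_def col_def sum_divide_distrib)

lemma xcorr_col:
  assumes "j < p"
  shows "xcorr n (Xmat n \<omega>) (noise \<sigma> \<omega>) j = \<sigma> / sqrt (real n) * (\<Sum>l<n. \<omega> (col p p l) * \<omega> (col p j l))"
  using assms by (simp add: xcorr_def Xmat_def noise_def col_def sum_distrib_left mult_ac)

lemma sum_col_eq_proj: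
  assumes "colnorm2 n p \<omega> c > 0"
  shows "(\<Sum>l<n. \<omega> (col p c l) * \<omega> (col p j l)) = sqrt (colnorm2 n p \<omega> c) * proj n p \<omega> c j"
  using assms by (simp add: proj_def sum_distrib_left)

lemma sum_ln_Suc: "(\<Sum>i<K. ln (real (Suc i))) = ln (fact K)"
  by (induction K) (simp_all add: ln_mult del: of_nat_Suc)

text \<open>The index \<open>c\<close> includes \<open>p\<close>, so the same clauses control the
  rows of the Gram matrix and the noise correlations.\<close>

definition design_regular :: "nat \<Rightarrow> nat \<Rightarrow> real \<Rightarrow> ((nat \<times> nat) + nat \<Rightarrow> real) \<Rightarrow> bool" where
  "design_regular n p \<tau> \<omega> \<longleftrightarrow> (\<forall>c\<le>p. (1 - \<tau>) * real n \<le> colnorm2 n p \<omega> c \<and> colnorm2 n p \<omega> c \<le> (1 + \<tau>) * real n \<and>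
    (\<forall>A\<subseteq>{..p} - {c}. A \<noteq> {} \<longrightarrow>
      (\<Sum>j\<in>A. (proj n p \<omega> c j)\<^sup>2) \<le> 28 * (real (card A) * ln (2 * real p / real (card A)))))"

text \<open>The bound \<open>t\<close> on all correlations serves the detection of signals, the
  count at rank \<open>B\<close> limits the nulls added to \<open>T\<close>, and the counts beyond
  \<open>B\<close> give the partial sums outside \<open>T\<close>.\<close>

definition noise_regular :: "real \<Rightarrow> real \<Rightarrow> real \<Rightarrow> real \<Rightarrow> nat \<Rightarrow> nat \<Rightarrow> (nat \<Rightarrow> real) \<Rightarrow> bool" where
  "noise_regular a q t x B p U \<longleftrightarrow> (\<forall>j<p. \<bar>U j\<bar> \<le> t) \<and>
    real (card {j. j < p \<and> a * zq q p B < \<bar>U j\<bar>}) \<le> x \<and>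
    (\<forall>m\<in>{B<..p}. real (card {j. j < p \<and> a * zq q p m < \<bar>U j\<bar>}) \<le> (1 + q) / 2 * real m)"

text \<open>
  \<open>large\<close> and \<open>small\<close> hold for large \<open>n\<close>, \<open>design\<close> and \<open>noise\<close> with high probability. The rank \<open>L * k\<close>
  separates the two ways of counting large noise correlations: below it their number is \<open>o(k)\<close> by
  Markov's inequality, above it a Chernoff bound gives a proportion \<open>(1 + q) / 2 < 1\<close> of the rank.
\<close>

locale slope_event =
  fixes n p k L :: nat and \<sigma> \<delta> q \<epsilon> c0 :: real
    and \<omega> :: "(nat \<times> nat) + nat \<Rightarrow> real" and b0 :: "nat \<Rightarrow> real"
  fixes \<tau> \<kappa> a D r \<theta> y :: real and lam z U w :: "nat \<Rightarrow> real" and G :: "nat \<Rightarrow> nat \<Rightarrow> real" and S T :: "nat set"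
  defines "\<tau> \<equiv> \<delta> / (16 * (1 + \<delta>))" and "\<kappa> \<equiv> \<delta> / (4 * (1 + \<delta>))" and "a \<equiv> 1 + \<delta> / 4"
    and "D \<equiv> 2 * (1 + \<delta>) * sqrt (3 + 2 * ln (1 / q))"
    and "y \<equiv> ln (2 * real p / real k)" and "\<theta> \<equiv> real k * sqrt (ln (2 * real p) / real n)"
    and "r \<equiv> 4 * (9 + D) * \<sigma> * sqrt (real k * y)"
    and "lam \<equiv> slope_lambda \<sigma> \<delta> q p" and "z \<equiv> zq q p" and "U \<equiv> proj n p \<omega> p"
    and "w \<equiv> xcorr n (Xmat n \<omega>) (noise \<sigma> \<omega>)" and "G \<equiv> gram n (Xmat n \<omega>)"
    and "S \<equiv> {j. j < p \<and> b0 j \<noteq> 0}" and "T \<equiv> S \<union> {j. j < p \<and> b0 j = 0 \<and> a * z (L * k) < \<bar>U j\<bar>}"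
  assumes \<sigma>: "0 < \<sigma>" and \<delta>: "0 < \<delta>" and q: "0 < q" "q < 1" and \<epsilon>: "0 < \<epsilon>" "\<epsilon> \<le> 1"
    and b0: "b0 \<in> Rp p" and k: "k = sparsity p b0" "1 \<le> k"
    and signal: "\<And>j. j < p \<Longrightarrow> b0 j \<noteq> 0 \<Longrightarrow> \<bar>b0 j\<bar> \<ge> 2 * \<sigma> * (1 + \<delta>) * sqrt (2 * ln (real p))"
    and c0: "0 < c0" "\<And>m. 1 \<le> m \<Longrightarrow> m \<le> p \<Longrightarrow> c0 * sqrt (ln (2 * real p / real m)) \<le> zq q p m"
    and large: "1 \<le> n" "2 \<le> p" "8 * k \<le> p" "L * k \<le> p" "4 \<le> L * (1 - q)"
    and small: "\<theta> \<le> 1 / 64" "16 * (4 * (9 + D)) * \<theta> \<le> \<kappa> * (1 + \<delta>) * c0" "8 * (4 * (9 + D)) * \<theta> < \<delta> / 4"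
      "ln (2 / q) \<le> \<tau> * ln (real p)"
    and design: "design_regular n p \<tau> \<omega>"
    and noise: "noise_regular a q (a * sqrt (2 * ln (real p))) (\<epsilon> * real k) (L * k) p U"
begin

lemma E0: "c \<le> p \<Longrightarrow> (1 - \<tau>) * real n \<le> colnorm2 n p \<omega> c \<and> colnorm2 n p \<omega> c \<le> (1 + \<tau>) * real n"
  and E1: "c \<le> p \<Longrightarrow> A \<subseteq> {..p} - {c} \<Longrightarrow> A \<noteq> {} \<Longrightarrow>
    (\<Sum>j\<in>A. (proj n p \<omega> c j)\<^sup>2) \<le> 28 * (real (card A) * ln (2 * real p / real (card A)))"
  using design by (auto simp: design_regular_def)

lemma E2: "j < p \<Longrightarrow> \<bar>U j\<bar> \<le> a * sqrt (2 * ln (real p))"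
  and E3: "real (card {j. j < p \<and> a * z (L * k) < \<bar>U j\<bar>}) \<le> \<epsilon> * real k"
  and E4: "L * k < m \<Longrightarrow> m \<le> p \<Longrightarrow> real (card {j. j < p \<and> a * z m < \<bar>U j\<bar>}) \<le> (1 + q) / 2 * real m"
  using noise by (auto simp: noise_regular_def z_def)

section \<open>Error budget on the good event\<close>

lemma tau: "0 < \<tau>" "\<tau> \<le> 1 / 16" "\<tau> * (1 + \<delta>) = \<delta> / 16" "\<tau> \<le> \<delta> / 16"
  using \<delta> divide_left_mono[of 16 "16 * (1 + \<delta>)" \<delta>] by (auto simp: \<tau>_def field_simps)

lemma kappa: "0 < \<kappa>" "\<kappa> * (1 + \<delta>) = \<delta> / 4"
  using \<delta> by (auto simp: \<kappa>_def field_simps)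

text \<open>Norm fluctuation and inflated threshold together use half of the margin
  \<open>\<delta>\<close>; the other half equals
  \<open>2 * \<kappa> * (1 + \<delta>)\<close>.\<close>

lemma tau_a: "(1 + \<tau>) * a \<le> 1 + \<delta> / 2"
proof -
  have "\<tau> * \<delta> \<le> 1 / 16 * \<delta>" using tau \<delta> by (intro mult_right_mono) auto
  moreover have "(1 + \<tau>) * a = 1 + \<tau> + \<delta> / 4 + \<tau> * \<delta> / 4" by (simp add: a_def algebra_simps)
  ultimately show ?thesis using tau(4) \<delta> by linarith
qed

lemma D_nonneg: "0 \<le> D"
  using \<delta> q by (simp add: D_def)

lemma y_ge: "ln 16 \<le> y" "y \<le> ln (2 * real p)"
  unfolding y_def using large(2,3) k(2) by (auto intro!: ln_mono simp: field_simps)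

lemma y_pos: "1 \<le> y"
proof -
  have "exp 1 \<le> (16 :: real)" using exp_le by simp
  then have "ln (exp 1) \<le> ln (16 :: real)" by (subst ln_le_cancel_iff) auto
  then show ?thesis using y_ge by simp
qed

lemma theta_nonneg: "0 \<le> \<theta>"
  using large by (simp add: \<theta>_def)

lemma r_pos: "0 < r"
  unfolding r_def using \<sigma> D_nonneg y_pos k(2) by simp

lemma z_pos: "1 \<le> m \<Longrightarrow> m \<le> p \<Longrightarrow> 0 < z m"
  unfolding z_def by (rule zq_pos[OF q])

lemma z_antimono: "1 \<le> l \<Longrightarrow> l \<le> m \<Longrightarrow> m \<le> p \<Longrightarrow> z m \<le> z l"
  unfolding z_def by (rule zq_antimono[OF q])

lemma lam_eq: "lam m = \<sigma> * (1 + \<delta>) * z m"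
  by (simp add: lam_def slope_lambda_def z_def zq_def)

sublocale slope_quadratic p lam b0 w G
proof
  show "0 < lam i" if "1 \<le> i" "i \<le> p" for i using z_pos[OF that] \<sigma> \<delta> by (simp add: lam_eq)
  show "lam j \<le> lam i" if "1 \<le> i" "i \<le> j" "j \<le> p" for i j
    unfolding lam_eq using z_antimono[OF that] \<sigma> \<delta> by (intro mult_left_mono) auto
  show "G i j = G j i" for i j by (simp add: G_def gram_def mult.commute)
  show "0 \<le> (\<Sum>i<p. \<Sum>j<p. v i * v j * G i j)" for v unfolding G_def by (rule gram_psd)
qed

lemma colnorm2_pos: "c \<le> p \<Longrightarrow> 0 < colnorm2 n p \<omega> c"
proof -
  assume c: "c \<le> p"
  have "0 < (1 - \<tau>) * real n" using tau large by simp
  then show ?thesis using E0[OF c] by linarith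
qed

lemma G_proj:
  assumes "i < p" "j < p"
  shows "G i j = sqrt (colnorm2 n p \<omega> i) / real n * proj n p \<omega> i j"
  unfolding G_def using assms sum_col_eq_proj[OF colnorm2_pos[of i], of j] by (simp add: gram_col)

lemma G_diag:
  assumes "j < p"
  shows "1 - \<tau> \<le> G j j"
proof -
  have "G j j = colnorm2 n p \<omega> j / real n"
    unfolding G_def gram_col[OF assms assms] by (simp add: colnorm2_def power2_eq_square)
  moreover have "(1 - \<tau>) * real n / real n \<le> colnorm2 n p \<omega> j / real n"
    using E0[of j] assms by (intro divide_right_mono) auto
  ultimately show ?thesis using large by simp
qed

lemma w_proj:
  assumes "j < p"
  shows "\<bar>w j\<bar> = \<sigma> * sqrt (colnorm2 n p \<omega> p / real n) * \<bar>U j\<bar>"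
proof -
  have "w j = \<sigma> / sqrt (real n) * (sqrt (colnorm2 n p \<omega> p) * U j)"
    unfolding w_def U_def xcorr_col[OF assms] by (subst sum_col_eq_proj) (auto intro: colnorm2_pos)
  then show ?thesis using \<sigma> colnorm2_pos[of p] by (simp add: abs_mult real_sqrt_divide)
qed

lemma colnorm2_ratio:
  assumes "c \<le> p"
  shows "colnorm2 n p \<omega> c / real n \<le> 1 + \<tau>"
  using E0[OF assms] large by (simp add: field_simps)

lemma w_le:
  assumes "j < p"
  shows "\<bar>w j\<bar> \<le> \<sigma> * (1 + \<tau>) * \<bar>U j\<bar>"
proof -
  have "sqrt (colnorm2 n p \<omega> p / real n) \<le> sqrt (1 + \<tau>)"
    using colnorm2_ratio[of p] by simp
  also have "\<dots> \<le> 1 + \<tau>" using tau by (intro real_le_lsqrt) (auto simp: power2_eq_square field_simps)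
  finally show ?thesis unfolding w_proj[OF assms] using \<sigma> by (intro mult_right_mono mult_left_mono) auto
qed

lemma cross_gram_sum:
  assumes c: "c < p" and A: "A \<subseteq> {..<p} - {c}" "A \<noteq> {}"
  shows "(\<Sum>j\<in>A. (G c j)\<^sup>2) \<le> 30 * (real (card A) * ln (2 * real p / real (card A))) / real n"
proof -
  have finA: "finite A" using A finite_subset by blast
  have cA: "1 \<le> card A" "card A \<le> p"
    using A finA card_mono[of "{..<p}" A] by (auto simp: Suc_le_eq card_gt_0_iff)
  have "(\<Sum>j\<in>A. (G c j)\<^sup>2) = (\<Sum>j\<in>A. colnorm2 n p \<omega> c / real n / real n * (proj n p \<omega> c j)\<^sup>2)"
    using A c colnorm2_pos[of c] by (intro sum.cong) (auto simp: G_proj power_mult_distrib power_divide power2_eq_square[of "real n"])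
  also have "\<dots> = colnorm2 n p \<omega> c / real n / real n * (\<Sum>j\<in>A. (proj n p \<omega> c j)\<^sup>2)"
    by (simp add: sum_distrib_left)
  also have "\<dots> \<le> (1 + \<tau>) / real n * (28 * (real (card A) * ln (2 * real p / real (card A))))"
    using c A colnorm2_ratio[of c] tau by (intro mult_mono divide_right_mono E1 sum_nonneg) auto
  \<comment> \<open>\<open>\<tau> \<le> 1 / 16\<close> leaves a factor below 15 / 14, chosen because
    28 * 15 / 14 = 30.\<close>
  also have "\<dots> \<le> (15 / 14) / real n * (28 * (real (card A) * ln (2 * real p / real (card A))))"
    using tau cA ln_ratio_ge_ln2[OF cA] by (intro mult_right_mono divide_right_mono mult_nonneg_nonneg) auto
  finally show ?thesis by simp
qed

text \<open>For at most 2k indices the logarithm may be replaced by \<open>ln (2 * real p)\<close>;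
  the square is then at most \<open>60 * \<theta>\<^sup>2\<close>, below the square of
  \<open>8 * \<theta>\<close>.\<close>

lemma cross_gram_sum_crude:
  assumes c: "c < p" and A: "A \<subseteq> {..<p} - {c}" "card A \<le> 2 * k"
  shows "sqrt (\<Sum>j\<in>A. (G c j)\<^sup>2) * sqrt (real k) \<le> 8 * \<theta>"
proof (cases "A = {}")
  case False
  have finA: "finite A" using A finite_subset by blast
  have cA: "1 \<le> card A" using False finA by (auto simp: Suc_le_eq card_gt_0_iff)
  have "ln (2 * real p / real (card A)) \<le> ln (2 * real p)"
    using cA large by (intro ln_mono) (auto simp: field_simps)
  moreover have "0 \<le> ln (2 * real p)" using large by simp
  ultimately have "real (card A) * ln (2 * real p / real (card A)) \<le> (2 * real k) * ln (2 * real p)"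
    using A(2) by (intro order_trans[OF mult_left_mono mult_right_mono]) auto
  then have "(\<Sum>j\<in>A. (G c j)\<^sup>2) \<le> 30 * ((2 * real k) * ln (2 * real p)) / real n"
    using cross_gram_sum[OF c A(1) False] by (auto elim!: order_trans intro!: divide_right_mono)
  then have "(\<Sum>j\<in>A. (G c j)\<^sup>2) * real k \<le> 30 * ((2 * real k) * ln (2 * real p)) / real n * real k"
    by (rule mult_right_mono) simp
  also have "\<dots> = 60 * \<theta>\<^sup>2"
    using large by (simp add: \<theta>_def power_mult_distrib power2_eq_square[of "real k"])
  also have "\<dots> \<le> (8 * \<theta>)\<^sup>2" by (simp add: power_mult_distrib)
  finally have "sqrt ((\<Sum>j\<in>A. (G c j)\<^sup>2) * real k) \<le> 8 * \<theta>"
    using theta_nonneg by (intro real_le_lsqrt) auto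
  then show ?thesis by (simp add: real_sqrt_mult)
qed (use theta_nonneg in simp)

lemma T_sub: "T \<subseteq> {..<p}" and S_sub: "S \<subseteq> T" and b0_T: "j \<notin> T \<Longrightarrow> b0 j = 0"
  using b0 by (auto simp: T_def S_def Rp_def not_less[symmetric])

lemma finT: "finite T"
  using T_sub finite_subset by blast

lemma card_S: "card S = k"
  unfolding k(1) S_def sparsity_def by (intro arg_cong[where f = card]) auto

lemma card_T_minus_S: "real (card (T - S)) \<le> \<epsilon> * real k"
proof -
  have "card (T - S) \<le> card {j. j < p \<and> a * z (L * k) < \<bar>U j\<bar>}"
    by (rule card_mono) (auto simp: T_def)
  then show ?thesis using E3 by linarith
qed

lemma card_T: "k \<le> card T" "card T \<le> 2 * k"
proof -
  show "k \<le> card T" using card_mono[OF finT S_sub] card_S by simp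
  have "card T = k + card (T - S)"
    using card_S finT S_sub card_Diff_subset[of S T] finite_subset[OF S_sub finT] card_mono[OF finT S_sub] by simp
  moreover have "real (card (T - S)) \<le> real k"
    using card_T_minus_S \<epsilon> mult_right_mono[of \<epsilon> 1 "real k"] by simp
  ultimately show "card T \<le> 2 * k" by simp
qed

lemma card_T_le_p: "card T \<le> p"
  using card_mono[OF _ T_sub] by simp

text \<open>Cauchy-Schwarz along a row. The factor \<open>sqrt (real k)\<close> is kept on the left
  because it cancels the one in \<open>r\<close>.\<close>

lemma cross_error:
  assumes c: "c < p" and A: "A \<subseteq> T - {c}" and u: "(\<Sum>j\<in>T. (u j)\<^sup>2) \<le> s\<^sup>2" "0 \<le> s"
  shows "\<bar>\<Sum>i\<in>A. G c i * u i\<bar> * sqrt (real k) \<le> 8 * \<theta> * s"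
proof -
  have AT: "A \<subseteq> T" using A by auto
  have "\<bar>\<Sum>i\<in>A. G c i * u i\<bar> \<le> (\<Sum>i\<in>A. \<bar>G c i\<bar> * \<bar>u i\<bar>)"
    by (rule order_trans[OF sum_abs]) (simp add: abs_mult)
  also have "\<dots> \<le> sqrt (\<Sum>i\<in>A. (G c i)\<^sup>2) * sqrt (\<Sum>i\<in>A. (u i)\<^sup>2)"
    using L2_set_mult_ineq[of "G c" u A] by (simp add: L2_set_def)
  also have "\<dots> \<le> sqrt (\<Sum>i\<in>A. (G c i)\<^sup>2) * s"
  proof (intro mult_left_mono real_le_lsqrt)
    show "(\<Sum>i\<in>A. (u i)\<^sup>2) \<le> s\<^sup>2"
      using sum_mono2[OF finT AT, of "\<lambda>i. (u i)\<^sup>2"] u by auto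
  qed (use u in \<open>auto intro: sum_nonneg\<close>)
  finally have "\<bar>\<Sum>i\<in>A. G c i * u i\<bar> * sqrt (real k) \<le> sqrt (\<Sum>i\<in>A. (G c i)\<^sup>2) * s * sqrt (real k)"
    by (rule mult_right_mono) simp
  also have "\<dots> = sqrt (\<Sum>i\<in>A. (G c i)\<^sup>2) * sqrt (real k) * s" by simp
  also have "\<dots> \<le> 8 * \<theta> * s"
    using A T_sub card_mono[OF finT AT] card_T u
    by (intro mult_right_mono cross_gram_sum_crude[OF c]) auto
  finally show ?thesis .
qed

text \<open>The off-diagonal part is estimated row by row, without an operator norm bound: each row
  contributes \<open>8 * \<theta> * N / sqrt (real k)\<close>, and the l1 norm of \<open>u\<close>
  restores the factor \<open>sqrt (real k)\<close>.\<close>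

lemma restricted_strong_convexity:
  assumes "\<And>j. j \<notin> T \<Longrightarrow> u j = 0"
  shows "(\<Sum>j\<in>T. (u j)\<^sup>2) / 2 \<le> qf u"
proof -
  define N where "N = sqrt (\<Sum>j\<in>T. (u j)\<^sup>2)"
  have N: "0 \<le> N" "N\<^sup>2 = (\<Sum>j\<in>T. (u j)\<^sup>2)" by (auto simp: N_def sum_nonneg)
  have "qf u = (\<Sum>i\<in>T. \<Sum>j\<in>T. u i * u j * G i j)"
    unfolding qf_def using T_sub assms
    by (intro sum.mono_neutral_cong_right) (auto intro!: sum.mono_neutral_cong_right sum.neutral)
  also have "\<dots> = (\<Sum>i\<in>T. (u i)\<^sup>2 * G i i + u i * (\<Sum>j\<in>T - {i}. G i j * u j))"
  proof (rule sum.cong[OF refl])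
    fix i assume "i \<in> T"
    then show "(\<Sum>j\<in>T. u i * u j * G i j) = (u i)\<^sup>2 * G i i + u i * (\<Sum>j\<in>T - {i}. G i j * u j)"
      using finT by (subst sum.remove[of T i]) (auto simp: sum_distrib_left power2_eq_square mult_ac)
  qed
  also have "\<dots> \<ge> (\<Sum>i\<in>T. (u i)\<^sup>2 * (1 - \<tau>) - \<bar>u i\<bar> * (8 * \<theta> * N / sqrt (real k)))"
  proof (rule sum_mono)
    fix i assume i: "i \<in> T"
    have "\<bar>\<Sum>j\<in>T - {i}. G i j * u j\<bar> * sqrt (real k) \<le> 8 * \<theta> * N"
      using i T_sub N by (intro cross_error) auto
    then have "\<bar>\<Sum>j\<in>T - {i}. G i j * u j\<bar> \<le> 8 * \<theta> * N / sqrt (real k)"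
      using k(2) by (simp add: field_simps)
    then have "\<bar>u i * (\<Sum>j\<in>T - {i}. G i j * u j)\<bar> \<le> \<bar>u i\<bar> * (8 * \<theta> * N / sqrt (real k))"
      unfolding abs_mult by (rule mult_left_mono) simp
    moreover have "(u i)\<^sup>2 * (1 - \<tau>) \<le> (u i)\<^sup>2 * G i i"
      using i T_sub by (intro mult_left_mono G_diag) auto
    ultimately show "(u i)\<^sup>2 * (1 - \<tau>) - \<bar>u i\<bar> * (8 * \<theta> * N / sqrt (real k))
      \<le> (u i)\<^sup>2 * G i i + u i * (\<Sum>j\<in>T - {i}. G i j * u j)" by linarith
  qed
  finally have 1: "N\<^sup>2 * (1 - \<tau>) - (\<Sum>i\<in>T. \<bar>u i\<bar>) * (8 * \<theta> * N / sqrt (real k)) \<le> qf u"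
    by (simp only: sum_subtractf N(2) sum_distrib_right)
  have "(\<Sum>i\<in>T. \<bar>u i\<bar>) \<le> sqrt (real (card T)) * N"
    using L2_set_mult_ineq[of "\<lambda>_. 1" u T] by (simp add: L2_set_def N_def)
  also have "\<dots> \<le> (2 * sqrt (real k)) * N"
  proof (rule mult_right_mono[OF _ N(1)])
    have "real (card T) \<le> (2 * sqrt (real k))\<^sup>2" using card_T by (simp add: power_mult_distrib)
    then show "sqrt (real (card T)) \<le> 2 * sqrt (real k)" by (intro real_le_lsqrt) auto
  qed
  finally have "(\<Sum>i\<in>T. \<bar>u i\<bar>) * (8 * \<theta> * N / sqrt (real k)) \<le> (2 * sqrt (real k)) * N * (8 * \<theta> * N / sqrt (real k))"
    using N theta_nonneg by (intro mult_right_mono) auto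
  also have "\<dots> = 16 * \<theta> * N\<^sup>2" using k(2) by (simp add: power2_eq_square field_simps)
  finally have 2: "(\<Sum>i\<in>T. \<bar>u i\<bar>) * (8 * \<theta> * N / sqrt (real k)) \<le> 16 * \<theta> * N\<^sup>2" .
  have "N\<^sup>2 / 2 \<le> N\<^sup>2 * (1 - \<tau>) - 16 * \<theta> * N\<^sup>2"
  proof -
    \<comment> \<open>The diagonal loses at most 1 / 16, the off-diagonal part at most 16 /
      64.\<close>
    have "N\<^sup>2 * (1 / 2) \<le> N\<^sup>2 * (1 - \<tau> - 16 * \<theta>)"
      using tau small(1) by (intro mult_left_mono) auto
    then show ?thesis by (simp add: algebra_simps)
  qed
  then show ?thesis using 1 2 N(2) by linarith
qed

lemma noise_norm: "sqrt (\<Sum>j\<in>T. (w j)\<^sup>2) \<le> 8 * \<sigma> * sqrt (real k * y)"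
proof -
  have cT: "1 \<le> card T" using card_T k by simp
  have Tp: "T \<subseteq> {..p} - {p}" "T \<noteq> {}" using T_sub cT by auto
  have "(w j)\<^sup>2 = \<sigma>\<^sup>2 * (colnorm2 n p \<omega> p / real n) * (U j)\<^sup>2" if "j \<in> T" for j
  proof -
    have "\<bar>w j\<bar>\<^sup>2 = (\<sigma> * sqrt (colnorm2 n p \<omega> p / real n) * \<bar>U j\<bar>)\<^sup>2"
      using that T_sub by (subst w_proj) auto
    then show ?thesis using colnorm2_pos[of p] by (simp add: power_mult_distrib)
  qed
  then have "(\<Sum>j\<in>T. (w j)\<^sup>2) = \<sigma>\<^sup>2 * (colnorm2 n p \<omega> p / real n) * (\<Sum>j\<in>T. (U j)\<^sup>2)"
    by (simp add: sum_distrib_left)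
  \<comment> \<open>The product of the constants is 60, below the square of 8.\<close>
  also have "\<dots> \<le> \<sigma>\<^sup>2 * (15 / 14) * (28 * (2 * real k * y))"
  proof (intro mult_mono)
    show "colnorm2 n p \<omega> p / real n \<le> 15 / 14" using colnorm2_ratio[of p] tau by simp
    have "(\<Sum>j\<in>T. (U j)\<^sup>2) \<le> 28 * (real (card T) * ln (2 * real p / real (card T)))"
      unfolding U_def by (rule E1) (use Tp in auto)
    also have "real (card T) * ln (2 * real p / real (card T)) \<le> (2 * real k) * y"
      unfolding y_def using card_T card_T_le_p k(2) ln_ratio_ge_ln2[of "card T" p]
      by (intro mult_mono ln_mono divide_left_mono) auto
    finally show "(\<Sum>j\<in>T. (U j)\<^sup>2) \<le> 28 * (2 * real k * y)" by simp
  qed (use colnorm2_pos[of p] in \<open>auto intro: sum_nonneg\<close>)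
  also have "\<dots> \<le> (8 * \<sigma> * sqrt (real k * y))\<^sup>2"
    using y_pos by (simp add: power_mult_distrib mult_left_mono)
  finally show ?thesis using \<sigma> y_pos by (intro real_le_lsqrt) auto
qed

text \<open>Bounding every weight by \<open>lam 1\<close> would produce log p in place of log (p /
  k). Summing the logarithms of the ranks to \<open>ln (fact K)\<close> and applying the Stirling
  bound recovers the right order.\<close>

lemma lam_norm: "sqrt (\<Sum>i<card T. (lam (Suc i))\<^sup>2) \<le> D * \<sigma> * sqrt (real k * y)"
proof -
  define K where "K = card T"
  have K: "1 \<le> K" "k \<le> K" "K \<le> 2 * k" "K \<le> p" using card_T card_T_le_p k by (auto simp: K_def)
  have "(\<Sum>i<K. (lam (Suc i))\<^sup>2) \<le> (\<Sum>i<K. (\<sigma> * (1 + \<delta>))\<^sup>2 * (2 * (ln (2 * real p) - ln (real (Suc i)) + ln (1 / q))))"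
  proof (rule sum_mono)
    fix i assume "i \<in> {..<K}"
    then have i: "1 \<le> Suc i" "Suc i \<le> p" using K by auto
    have "(lam (Suc i))\<^sup>2 = (\<sigma> * (1 + \<delta>))\<^sup>2 * (zq q p (Suc i))\<^sup>2"
      by (simp add: lam_eq z_def power_mult_distrib)
    then show "(lam (Suc i))\<^sup>2 \<le> (\<sigma> * (1 + \<delta>))\<^sup>2 * (2 * (ln (2 * real p) - ln (real (Suc i)) + ln (1 / q)))"
      using zq_upper[OF q i] large mult_left_mono[of "(zq q p (Suc i))\<^sup>2" _ "(\<sigma> * (1 + \<delta>))\<^sup>2"]
      by (simp add: ln_div del: of_nat_Suc)
  qed
  also have "\<dots> = (\<sigma> * (1 + \<delta>))\<^sup>2 * (2 * (real K * ln (2 * real p) - ln (fact K) + real K * ln (1 / q)))"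
    by (simp only: sum_distrib_left[symmetric] sum.distrib sum_subtractf sum_ln_Suc) simp
  also have "\<dots> \<le> (\<sigma> * (1 + \<delta>))\<^sup>2 * (2 * (2 * real k * y * (3 + 2 * ln (1 / q))))"
  proof (intro mult_left_mono)
    have "ln (real K ^ K) \<le> ln (exp (real K) * fact K)"
      using K power_self_le_exp_fact[of K] by (intro ln_mono) auto
    then have "real K * ln (real K) \<le> real K + ln (fact K)"
      using K by (simp add: ln_realpow ln_mult)
    then have "real K * ln (2 * real p) - ln (fact K) + real K * ln (1 / q)
      \<le> real K * (ln (2 * real p / real K) + 1 + ln (1 / q))"
      using K large by (simp add: ln_div algebra_simps)
    also have "\<dots> \<le> (2 * real k) * (y + 1 + ln (1 / q))"
    proof (rule mult_mono)
      show "ln (2 * real p / real K) + 1 + ln (1 / q) \<le> y + 1 + ln (1 / q)"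
        unfolding y_def using K k by (auto intro!: ln_mono divide_left_mono)
    qed (use K q y_pos in auto)
    also have "\<dots> \<le> (2 * real k) * (y * (3 + 2 * ln (1 / q)))"
    proof (rule mult_left_mono)
      have "0 \<le> ln (1 / q)" using q by simp
      then have "1 * (1 + ln (1 / q)) \<le> y * (2 + 2 * ln (1 / q))"
        using y_pos by (intro mult_mono) auto
      then show "y + 1 + ln (1 / q) \<le> y * (3 + 2 * ln (1 / q))"
        by (simp add: algebra_simps)
    qed simp
    finally show "real K * ln (2 * real p) - ln (fact K) + real K * ln (1 / q) \<le> 2 * real k * y * (3 + 2 * ln (1 / q))"
      by (simp add: mult_ac)
  qed auto
  also have "\<dots> = (D * \<sigma> * sqrt (real k * y))\<^sup>2"
  proof -
    have "D\<^sup>2 = (2 * (1 + \<delta>))\<^sup>2 * (3 + 2 * ln (1 / q))"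
      unfolding D_def power_mult_distrib[of _ "sqrt _"] using q by simp
    also have "(2 * (1 + \<delta>))\<^sup>2 = 4 * (1 + \<delta>)\<^sup>2" by (simp only: power_mult_distrib) simp
    finally show ?thesis using y_pos by (simp add: power_mult_distrib mult_ac)
  qed
  finally show ?thesis unfolding K_def using D_nonneg \<sigma> y_pos by (intro real_le_lsqrt) auto
qed

text \<open>The constant 9 in \<open>r\<close> exceeds the 8 of the noise estimate in order to make
  the inequality strict.\<close>

lemma noise_bound: "sqrt (\<Sum>j\<in>T. (w j)\<^sup>2) + sqrt (\<Sum>i<card T. (lam (Suc i))\<^sup>2) < r / 4"
proof -
  have "0 < \<sigma> * sqrt (real k * y)" using \<sigma> k y_pos by simp
  moreover have "r / 4 = 9 * (\<sigma> * sqrt (real k * y)) + D * \<sigma> * sqrt (real k * y)"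
    by (simp add: r_def algebra_simps)
  ultimately show ?thesis using noise_norm lam_norm by linarith
qed

text \<open>Shifting the ranks by \<open>K = card T\<close> gives two cases. Up to rank
  \<open>L * k\<close> no index outside \<open>T\<close> exceeds the threshold, by the construction
  of \<open>T\<close>; beyond it the proportion below 1 absorbs the shift.\<close>

lemma noise_outside:
  assumes M: "M \<subseteq> {..<p} - T"
  shows "(\<Sum>j\<in>M. \<bar>w j\<bar>) \<le> (1 - 2 * \<kappa>) * (\<Sum>l<card M. lam (Suc (card T + l)))"
proof -
  define K where "K = card T"
  have finM: "finite M" using M finite_subset by blast
  have "card M \<le> card ({..<p} - T)" using M by (intro card_mono) auto
  then have Mp: "K + card M \<le> p"
    using card_Diff_subset[OF finT T_sub] card_T_le_p by (simp add: K_def)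
  have "(\<Sum>j\<in>M. \<bar>w j\<bar>) \<le> (\<Sum>l<card M. \<sigma> * (1 + \<tau>) * (a * z (K + Suc l)))"
  proof (rule sum_le_of_exceedance_counts[OF finM, where t = "\<lambda>l. \<sigma> * (1 + \<tau>) * (a * z (K + l))"])
    fix l assume l: "1 \<le> l" "l \<le> card M"
    have sub: "{j\<in>M. \<sigma> * (1 + \<tau>) * (a * z (K + l)) < \<bar>w j\<bar>} \<subseteq> {j\<in>M. a * z (K + l) < \<bar>U j\<bar>}"
    proof clarify
      fix j assume j: "j \<in> M" "\<sigma> * (1 + \<tau>) * (a * z (K + l)) < \<bar>w j\<bar>"
      then have "\<sigma> * (1 + \<tau>) * (a * z (K + l)) < \<sigma> * (1 + \<tau>) * \<bar>U j\<bar>"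
        using w_le[of j] M by auto
      then show "a * z (K + l) < \<bar>U j\<bar>" using \<sigma> tau by simp
    qed
    show "card {j\<in>M. \<sigma> * (1 + \<tau>) * (a * z (K + l)) < \<bar>w j\<bar>} < l"
    proof (cases "K + l \<le> L * k")
      case True
      have "{j\<in>M. a * z (K + l) < \<bar>U j\<bar>} = {}"
      proof (rule ccontr)
        assume "\<not> ?thesis"
        then obtain j where j: "j \<in> M" "a * z (K + l) < \<bar>U j\<bar>" by blast
        have "z (L * k) \<le> z (K + l)" using True l large by (intro z_antimono) auto
        then have "a * z (L * k) \<le> a * z (K + l)" using \<delta> by (intro mult_left_mono) (auto simp: a_def)
        then show False using j M by (auto simp: T_def S_def)
      qed
      then have "{j\<in>M. \<sigma> * (1 + \<tau>) * (a * z (K + l)) < \<bar>w j\<bar>} = {}" using sub by blast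
      then show ?thesis using l by (simp only: card.empty)
    next
      case False
      then have B: "L * k < K + l" "K + l \<le> p" using l Mp by auto
      have "card {j\<in>M. \<sigma> * (1 + \<tau>) * (a * z (K + l)) < \<bar>w j\<bar>} \<le> card {j. j < p \<and> a * z (K + l) < \<bar>U j\<bar>}"
        using sub M by (intro card_mono) auto
      then have "real (card {j\<in>M. \<sigma> * (1 + \<tau>) * (a * z (K + l)) < \<bar>w j\<bar>}) \<le> (1 + q) / 2 * real (K + l)"
        using E4[OF B] by linarith
      also have "\<dots> < real l"
      proof -
        \<comment> \<open>The claim amounts to 2 K < (1 - q) (K + l). As K \<le> 2k and the rank
          exceeds L k, this is what 4 \<le> L (1 - q) is for.\<close>
        have "4 * real k \<le> real L * (1 - q) * real k" using large(5) by (intro mult_right_mono) auto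
        also have "\<dots> = (1 - q) * real (L * k)" by simp
        also have "\<dots> < (1 - q) * real (K + l)" using B(1) q by (intro mult_strict_left_mono) (auto simp del: of_nat_add of_nat_mult)
        finally have "2 * real K < (1 - q) * real (K + l)" using card_T(2) by (simp add: K_def)
        then show ?thesis by (simp add: algebra_simps)
      qed
      finally show ?thesis by simp
    qed
  qed
  also have "\<dots> \<le> (\<Sum>l<card M. (1 - 2 * \<kappa>) * lam (Suc (K + l)))"
  proof (rule sum_mono)
    fix l assume "l \<in> {..<card M}"
    then have z: "0 < z (Suc (K + l))" using Mp by (intro z_pos) auto
    have "(1 + \<tau>) * a \<le> (1 - 2 * \<kappa>) * (1 + \<delta>)"
    proof -
      have "(1 - 2 * \<kappa>) * (1 + \<delta>) = 1 + \<delta> - 2 * (\<kappa> * (1 + \<delta>))" by (simp add: algebra_simps)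
      then show ?thesis using tau_a unfolding kappa(2) by linarith
    qed
    then have "\<sigma> * z (Suc (K + l)) * ((1 + \<tau>) * a) \<le> \<sigma> * z (Suc (K + l)) * ((1 - 2 * \<kappa>) * (1 + \<delta>))"
      using \<sigma> z by (intro mult_left_mono) auto
    then show "\<sigma> * (1 + \<tau>) * (a * z (K + Suc l)) \<le> (1 - 2 * \<kappa>) * lam (Suc (K + l))"
      by (simp add: lam_eq mult_ac)
  qed
  finally show ?thesis by (simp add: K_def sum_distrib_left)
qed

lemma lam_lower:
  assumes "1 \<le> m" "m \<le> p"
  shows "\<sigma> * ((1 + \<delta>) * c0 * sqrt (ln (2 * real p / real m))) \<le> lam m"
proof -
  have "\<sigma> * (1 + \<delta>) * (c0 * sqrt (ln (2 * real p / real m))) \<le> \<sigma> * (1 + \<delta>) * z m"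
    unfolding z_def using \<sigma> \<delta> c0(2)[OF assms] by (intro mult_left_mono) auto
  then show ?thesis by (simp add: lam_eq mult_ac)
qed

text \<open>For \<open>card M \<le> K\<close> the rows over \<open>T\<close> give a uniform bound of
  order \<open>sqrt y\<close>, comparable with the weights at these ranks. For larger
  \<open>M\<close> the weights may be much smaller, so the columns over \<open>M\<close> are summed
  instead, which replaces \<open>y\<close> by the logarithm at rank \<open>card M\<close>.\<close>

lemma cross_outside:
  assumes M: "M \<subseteq> {..<p} - T" and u: "(\<Sum>j\<in>T. (u j)\<^sup>2) \<le> r\<^sup>2"
  shows "(\<Sum>j\<in>M. \<bar>\<Sum>i\<in>T. G j i * u i\<bar>) \<le> \<kappa> * (\<Sum>l<card M. lam (Suc (card T + l)))"
proof -
  define K where "K = card T"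
  define m where "m = card M"
  define Cr where "Cr = 4 * (9 + D)"
  have Cr: "0 \<le> Cr" using D_nonneg by (simp add: Cr_def)
  have K: "1 \<le> K" "k \<le> K" "K \<le> 2 * k" using card_T k by (auto simp: K_def)
  have finM: "finite M" using M finite_subset by blast
  have "card M \<le> card ({..<p} - T)" using M by (intro card_mono) auto
  then have Mp: "K + m \<le> p"
    using card_Diff_subset[OF finT T_sub] card_T_le_p by (simp add: K_def m_def)
  let ?A = "\<Sum>j\<in>M. \<bar>\<Sum>i\<in>T. G j i * u i\<bar>"
  let ?c = "8 * (Cr * \<sigma> * \<theta>)"
  \<comment> \<open>Both cases reduce to comparing an average bound of order \<open>sqrt x\<close>
    with one weight \<open>lam N\<close> at a rank \<open>N \<ge> K + m\<close>; all weights in the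
    sum are at least that one.\<close>
  have suff: "?A \<le> \<kappa> * (\<Sum>l<card M. lam (Suc (card T + l)))"
    if le: "?A \<le> real m * (?c * sqrt x)" and x: "0 \<le> x"
      and N: "m = 0 \<or> K + m \<le> N \<and> N \<le> p \<and> x \<le> 4 * ln (2 * real p / real N)" for x N
  proof (cases "m = 0")
    case True
    then have "M = {}" using finM by (simp add: m_def)
    then show ?thesis by simp
  next
    case False
    then have N: "K + m \<le> N" "N \<le> p" "x \<le> 4 * ln (2 * real p / real N)" using N by auto
    define s where "s = sqrt (ln (2 * real p / real N))"
    have s: "sqrt x \<le> 2 * s" "0 \<le> s"
    proof -
      show "sqrt x \<le> 2 * s"
      proof (rule real_le_lsqrt)
        have "0 \<le> ln (2 * real p / real N)" using N(3) x by linarith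
        then show "x \<le> (2 * s)\<^sup>2" "0 \<le> 2 * s" using N(3) by (auto simp: s_def power_mult_distrib)
      qed
      show "0 \<le> s" using N(3) x by (simp add: s_def)
    qed
    have "?c * sqrt x \<le> ?c * (2 * s)"
      using s Cr \<sigma> theta_nonneg by (intro mult_left_mono) auto
    also have "\<dots> = \<sigma> * s * (16 * Cr * \<theta>)" by simp
    also have "\<dots> \<le> \<sigma> * s * (\<kappa> * (1 + \<delta>) * c0)"
      using small(2) s \<sigma> by (intro mult_left_mono) (auto simp: Cr_def)
    also have "\<dots> = \<kappa> * (\<sigma> * ((1 + \<delta>) * c0 * s))" by simp
    also have "\<dots> \<le> \<kappa> * lam N"
      unfolding s_def using N K kappa by (intro mult_left_mono lam_lower) auto
    finally have "real m * (?c * sqrt x) \<le> real m * (\<kappa> * lam N)"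
      by (rule mult_left_mono) simp
    also have "\<dots> = (\<Sum>l<m. \<kappa> * lam N)" by simp
    also have "\<dots> \<le> (\<Sum>l<m. \<kappa> * lam (Suc (K + l)))"
      using N kappa by (intro sum_mono mult_left_mono lam_mono) auto
    finally show ?thesis using le by (simp add: sum_distrib_left m_def K_def)
  qed
  have r_eq: "r = Cr * \<sigma> * sqrt (real k * y)" by (simp add: r_def Cr_def)
  show ?thesis
  proof (cases "m \<le> K")
    case True
    show ?thesis
    \<comment> \<open>Here K + m \<le> 4k, and passing from \<open>k\<close> to \<open>4 * k\<close>
      lowers the logarithm by ln 4, at most half of it because \<open>y \<ge> ln 16\<close>.\<close>
    proof (rule suff[where x = y and N = "4 * k"])
      have "\<bar>\<Sum>i\<in>T. G j i * u i\<bar> \<le> ?c * sqrt y" if "j \<in> M" for j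
      proof -
        have "\<bar>\<Sum>i\<in>T. G j i * u i\<bar> * sqrt (real k) \<le> 8 * \<theta> * r"
          using that M u r_pos by (intro cross_error) auto
        also have "\<dots> = (?c * sqrt y) * sqrt (real k)"
          by (simp add: r_eq real_sqrt_mult)
        finally show ?thesis using k(2) by simp
      qed
      then have "?A \<le> (\<Sum>j\<in>M. ?c * sqrt y)"
        by (rule sum_mono)
      then show "?A \<le> real m * (?c * sqrt y)"
        by (simp add: m_def)
      have "ln (2 * real p / real (4 * k)) = y - ln 4"
        unfolding y_def using k large ln_mult[of 2 "2 :: real"] by (simp add: ln_div ln_mult)
      moreover have "ln 16 = 2 * ln (4 :: real)" using ln_mult[of 4 "4 :: real"] by simp
      ultimately have "y \<le> 4 * ln (2 * real p / real (4 * k))" using y_ge(1) y_pos by simp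
      then show "m = 0 \<or> K + m \<le> 4 * k \<and> 4 * k \<le> p \<and> y \<le> 4 * ln (2 * real p / real (4 * k))"
        using True K large by auto
    qed (use y_pos in simp)
  next
    case False
    define x where "x = ln (2 * real p / real m)"
    have m: "1 \<le> m" "m \<le> p" using False Mp by auto
    have x0: "0 \<le> x" unfolding x_def using m by (intro ln_ge_zero) (auto simp: field_simps)
    show ?thesis
    proof (rule suff[where x = x and N = "K + m"])
      have col: "(\<Sum>j\<in>M. \<bar>G j i\<bar>) \<le> real m * sqrt (30 * x / real n)" if i: "i \<in> T" for i
      proof -
        have "(\<Sum>j\<in>M. \<bar>G j i\<bar>) = (\<Sum>j\<in>M. \<bar>1\<bar> * \<bar>G i j\<bar>)" using sym by simp
        also have "\<dots> \<le> sqrt (real m) * sqrt (\<Sum>j\<in>M. (G i j)\<^sup>2)"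
          using L2_set_mult_ineq[of "\<lambda>_. 1" "G i" M] by (simp add: L2_set_def m_def)
        also have "\<dots> \<le> sqrt (real m) * sqrt (real m * (30 * x / real n))"
        proof (intro mult_left_mono iffD2[OF real_sqrt_le_iff])
          show "(\<Sum>j\<in>M. (G i j)\<^sup>2) \<le> real m * (30 * x / real n)"
          proof -
            have "i < p" "M \<subseteq> {..<p} - {i}" "M \<noteq> {}" using i T_sub M m by (auto simp: m_def)
            from cross_gram_sum[OF this] show ?thesis by (simp add: m_def x_def mult_ac)
          qed
        qed simp
        also have "\<dots> = real m * sqrt (30 * x / real n)"
          unfolding real_sqrt_mult[of "real m"] mult.assoc[symmetric] by simp
        finally show ?thesis .
      qed
      have "?A \<le> (\<Sum>j\<in>M. \<Sum>i\<in>T. \<bar>G j i\<bar> * \<bar>u i\<bar>)"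
        by (intro sum_mono order_trans[OF sum_abs]) (simp add: abs_mult)
      also have "\<dots> = (\<Sum>i\<in>T. (\<Sum>j\<in>M. \<bar>G j i\<bar>) * \<bar>u i\<bar>)"
        by (subst sum.swap) (simp add: sum_distrib_right)
      also have "\<dots> \<le> (\<Sum>i\<in>T. real m * sqrt (30 * x / real n) * \<bar>u i\<bar>)"
        by (intro sum_mono mult_right_mono col) auto
      also have "\<dots> = real m * sqrt (30 * x / real n) * (\<Sum>i\<in>T. \<bar>u i\<bar>)"
        by (simp add: sum_distrib_left)
      also have "\<dots> \<le> real m * sqrt (30 * x / real n) * (sqrt (2 * real k) * r)"
      proof (rule mult_left_mono)
        have "(\<Sum>i\<in>T. \<bar>u i\<bar>) \<le> sqrt (real K) * sqrt (\<Sum>j\<in>T. (u j)\<^sup>2)"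
          using L2_set_mult_ineq[of "\<lambda>_. 1" u T] by (simp add: L2_set_def K_def)
        also have "\<dots> \<le> sqrt (2 * real k) * r"
          using K u r_pos by (intro mult_mono real_le_lsqrt) (auto intro: sum_nonneg)
        finally show "(\<Sum>i\<in>T. \<bar>u i\<bar>) \<le> sqrt (2 * real k) * r" .
      qed (use x0 in auto)
      also have "\<dots> \<le> real m * (?c * sqrt x)"
      proof -
        have "sqrt (30 * x / real n) * (sqrt (2 * real k) * r)
          = Cr * \<sigma> * sqrt x * sqrt (30 * 2 * (real k)\<^sup>2 * y / real n)"
          using real_sqrt_mult[of 30 2] by (simp add: r_eq real_sqrt_mult real_sqrt_divide power2_eq_square)
        also have "\<dots> \<le> Cr * \<sigma> * sqrt x * (8 * \<theta>)"
        proof (intro mult_left_mono real_le_lsqrt)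
          have "30 * 2 * (real k)\<^sup>2 * y / real n \<le> 64 * (real k)\<^sup>2 * ln (2 * real p) / real n"
            using y_ge y_pos by (intro divide_right_mono mult_mono) auto
          also have "\<dots> = (8 * \<theta>)\<^sup>2"
            using large by (simp add: \<theta>_def power_mult_distrib)
          finally show "30 * 2 * (real k)\<^sup>2 * y / real n \<le> (8 * \<theta>)\<^sup>2" .
        qed (use Cr \<sigma> x0 theta_nonneg in auto)
        finally have "real m * (sqrt (30 * x / real n) * (sqrt (2 * real k) * r)) \<le> real m * (Cr * \<sigma> * sqrt x * (8 * \<theta>))"
          by (rule mult_left_mono) simp
        then show ?thesis by (simp add: mult_ac)
      qed
      finally show "?A \<le> real m * (?c * sqrt x)" .
      \<comment> \<open>As \<open>m > K\<close>, doubling \<open>m\<close> passes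
        \<open>K + m\<close>; the factor 2 is absorbed by squaring a ratio that is at least
        2.\<close>
      have "2 * real p / real m \<le> (2 * real p / real (K + m)) ^ 2"
      proof -
        define R where "R = 2 * real p / real (K + m)"
        have R: "2 \<le> R" using Mp m by (simp add: R_def field_simps)
        have "2 * real p / real m \<le> 2 * R"
          using False m by (simp add: R_def field_simps)
        also have "\<dots> \<le> R * R" using R by (intro mult_right_mono) auto
        finally show ?thesis by (simp add: R_def power2_eq_square)
      qed
      then have "x \<le> ln ((2 * real p / real (K + m)) ^ 2)"
        unfolding x_def using m large by (intro ln_mono) auto
      also have "\<dots> = 2 * ln (2 * real p / real (K + m))"
        using m large by (subst ln_realpow) auto
      finally have "x \<le> 2 * ln (2 * real p / real (K + m))" .
      then show "m = 0 \<or> K + m \<le> K + m \<and> K + m \<le> p \<and> x \<le> 4 * ln (2 * real p / real (K + m))"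
        using x0 Mp by auto
    qed (rule x0)
  qed
qed

lemma dual_bound:
  assumes M: "M \<subseteq> {..<p} - T" and u: "(\<Sum>j\<in>T. (u j)\<^sup>2) \<le> r\<^sup>2"
  shows "(\<Sum>j\<in>M. \<bar>w j - (\<Sum>i\<in>T. G j i * u i)\<bar>) \<le> (1 - \<kappa>) * (\<Sum>l<card M. lam (Suc (card T + l)))"
proof -
  have "(\<Sum>j\<in>M. \<bar>w j - (\<Sum>i\<in>T. G j i * u i)\<bar>) \<le> (\<Sum>j\<in>M. \<bar>w j\<bar> + \<bar>\<Sum>i\<in>T. G j i * u i\<bar>)"
    by (intro sum_mono abs_triangle_ineq4)
  then show ?thesis
    using noise_outside[OF M] cross_outside[OF M u] by (simp add: sum.distrib algebra_simps)
qed

text \<open>False discoveries lie in \<open>T - S\<close>. A missed signal would leave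
  \<open>G j j * b0 j\<close> to be balanced by a gradient of at most \<open>lam 1\<close>, the
  noise and the cross terms; the factor 2 in the signal strength pays once for the threshold and
  once for the noise.\<close>

lemma selection_consistent:
  assumes bh: "bh \<in> Rp p"
    and min: "\<And>b. b \<in> Rp p \<Longrightarrow> slope_obj n p (Xmat n \<omega>) (Yvec n p \<sigma> b0 \<omega>) lam bh
      \<le> slope_obj n p (Xmat n \<omega>) (Yvec n p \<sigma> b0 \<omega>) lam b"
  shows "real (false_disc p b0 bh) \<le> \<epsilon> * real k" and "true_disc p b0 bh = k"
proof -
  define v where "v j = bh j - b0 j" for j
  have v0: "v j = 0" if "p \<le> j" for j using that bh b0 by (simp add: v_def Rp_def)
  have obj: "slope_obj n p (Xmat n \<omega>) (Yvec n p \<sigma> b0 \<omega>) lam (\<lambda>j. b0 j + u j)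
      = (\<Sum>i<n. (noise \<sigma> \<omega> i)\<^sup>2) / 2 + Q u" for u
    unfolding Q_def qf_def unfolding G_def w_def by (subst slope_obj_expand) (auto simp: Yvec_def)
  have Qmin: "Q v \<le> Q u" if "\<And>j. p \<le> j \<Longrightarrow> u j = 0" for u
  proof -
    have "(\<lambda>j. b0 j + u j) \<in> Rp p" using that b0 by (simp add: Rp_def)
    from min[OF this] have "slope_obj n p (Xmat n \<omega>) (Yvec n p \<sigma> b0 \<omega>) lam (\<lambda>j. b0 j + v j)
      \<le> slope_obj n p (Xmat n \<omega>) (Yvec n p \<sigma> b0 \<omega>) lam (\<lambda>j. b0 j + u j)"
      by (simp add: v_def)
    then show ?thesis by (simp add: obj)
  qed
  note supp = minimizer_supported[OF T_sub b0_T kappa(1) r_pos restricted_strong_convexity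
    dual_bound noise_bound v0 Qmin]
  have vT: "v j = 0" if "j \<notin> T" for j by (rule supp(2)) (use that in auto)
  have vr: "(\<Sum>j\<in>T. (v j)\<^sup>2) \<le> r\<^sup>2" by (rule supp(1)) auto
  have "{j \<in> {..<p}. b0 j = 0 \<and> bh j \<noteq> 0} \<subseteq> T - S"
  proof clarsimp
    fix j assume "j < p" "b0 j = 0" "bh j \<noteq> 0"
    then have "v j \<noteq> 0" "j \<notin> S" by (auto simp: v_def S_def)
    then show "j \<in> T \<and> j \<notin> S" using vT by blast
  qed
  then have "false_disc p b0 bh \<le> card (T - S)"
    unfolding false_disc_def using finT by (intro card_mono) auto
  then show "real (false_disc p b0 bh) \<le> \<epsilon> * real k" using card_T_minus_S by linarith
  have "bh j \<noteq> 0" if j: "j < p" "b0 j \<noteq> 0" for j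
  proof
    assume "bh j = 0"
    then have vj: "v j = - b0 j" by (simp add: v_def)
  let ?e = "\<bar>\<Sum>i\<in>T - {j}. G j i * v i\<bar>"
    define s where "s = sqrt (2 * ln (real p))"
    have s: "0 < s" using large by (simp add: s_def)
    have jT: "j \<in> T" using j by (auto simp: T_def S_def)
    have "(\<Sum>i<p. G j i * v i) = (\<Sum>i\<in>T. G j i * v i)"
      by (rule sum.mono_neutral_right) (use T_sub vT in auto)
    also have "\<dots> = - G j j * b0 j + (\<Sum>i\<in>T - {j}. G j i * v i)"
      using finT jT by (subst sum.remove[of T j]) (auto simp: vj)
    finally have "G j j * b0 j = (w j - (\<Sum>i<p. G j i * v i)) - w j + (\<Sum>i\<in>T - {j}. G j i * v i)" by simp
    then have "\<bar>G j j * b0 j\<bar> \<le> \<bar>w j - (\<Sum>i<p. G j i * v i)\<bar> + \<bar>w j\<bar> + ?e"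
      by linarith
    also have "\<bar>w j - (\<Sum>i<p. G j i * v i)\<bar> \<le> lam 1"
      by (rule minimizer_gradient[OF Qmin v0 j(1)])
    also have "lam 1 \<le> \<sigma> * (1 + \<delta>) * ((1 + \<tau>) * s)"
      unfolding lam_eq
    proof (intro mult_left_mono)
      have "(z 1)\<^sup>2 \<le> 2 * (ln (2 * real p / real 1) + ln (1 / q))"
        unfolding z_def using large by (intro zq_upper[OF q]) auto
      \<comment> \<open>The constant \<open>ln (2 / q)\<close> is the gap between the quantile
        estimate and \<open>2 * ln p\<close>; for large \<open>p\<close> it is a fraction
        \<open>\<tau>\<close> of the logarithm.\<close>
      also have "\<dots> = 2 * (ln (real p) + ln (2 / q))" using large q by (simp add: ln_mult ln_div)
      also have "\<dots> \<le> (1 + \<tau>) * s\<^sup>2"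
        using small(4) large by (simp add: s_def algebra_simps)
      also have "\<dots> \<le> ((1 + \<tau>) * s)\<^sup>2"
        using tau by (simp add: power_mult_distrib power2_eq_square[of "1 + \<tau>"] mult_right_mono)
      finally show "z 1 \<le> (1 + \<tau>) * s" by (rule power2_le_imp_le) (use tau s in simp)
    qed (use \<sigma> \<delta> in auto)
    also have "\<bar>w j\<bar> \<le> \<sigma> * (1 + \<delta> / 2) * s"
    proof -
      have "\<bar>w j\<bar> \<le> \<sigma> * (1 + \<tau>) * (a * s)"
        using w_le[OF j(1)] E2[OF j(1)] \<sigma> tau unfolding s_def
        by (auto elim!: order_trans intro!: mult_left_mono)
      also have "\<dots> = \<sigma> * s * ((1 + \<tau>) * a)" by simp
      also have "\<dots> \<le> \<sigma> * s * (1 + \<delta> / 2)"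
        using \<sigma> s by (intro mult_left_mono tau_a) auto
      finally show ?thesis by (simp add: mult_ac)
    qed
    also have "?e \<le> \<sigma> * (\<delta> / 4) * s"
    proof -
      have "?e * sqrt (real k) \<le> 8 * \<theta> * r"
        using vr r_pos by (intro cross_error[OF j(1)]) auto
      also have "\<dots> = (\<sigma> * (8 * (4 * (9 + D)) * \<theta>) * sqrt y) * sqrt (real k)"
        by (simp add: r_def real_sqrt_mult)
      finally have "?e \<le> \<sigma> * (8 * (4 * (9 + D)) * \<theta>) * sqrt y"
        using k(2) by simp
      also have "\<dots> \<le> \<sigma> * (\<delta> / 4) * s"
      proof (intro mult_mono)
        have "ln (2 * real p) \<le> 2 * ln (real p)"
          using large ln_mono[of 2 "real p"] by (simp add: ln_mult)
        then show "sqrt y \<le> s" using y_ge by (simp add: s_def)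
      qed (use small(3) \<sigma> \<delta> y_pos D_nonneg theta_nonneg in auto)
      finally show ?thesis .
    qed
    finally have up: "\<bar>G j j * b0 j\<bar> \<le> \<sigma> * (1 + \<delta>) * ((1 + \<tau>) * s) + \<sigma> * (1 + \<delta> / 2) * s + \<sigma> * (\<delta> / 4) * s"
      by simp
    have "(1 - \<tau>) * (2 * \<sigma> * (1 + \<delta>) * s) \<le> \<bar>G j j\<bar> * \<bar>b0 j\<bar>"
      using G_diag[OF j(1)] signal[OF j] tau \<sigma> \<delta> s by (intro mult_mono) (auto simp: s_def)
    then have "(1 - \<tau>) * (2 * \<sigma> * (1 + \<delta>) * s) \<le> \<sigma> * (1 + \<delta>) * ((1 + \<tau>) * s) + \<sigma> * (1 + \<delta> / 2) * s + \<sigma> * (\<delta> / 4) * s"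
      using up by (simp add: abs_mult)
    then have "\<sigma> * s * (2 * (1 + \<delta>) - 2 * (\<tau> * (1 + \<delta>))) \<le> \<sigma> * s * ((1 + \<delta>) + \<tau> * (1 + \<delta>) + (1 + \<delta> / 2) + \<delta> / 4)"
      by (simp add: algebra_simps)
    \<comment> \<open>Since \<open>\<tau> * (1 + \<delta>) = \<delta> / 16\<close>, the left side
      exceeds the right side by \<open>\<delta> / 16\<close>.\<close>
    then have "2 * (1 + \<delta>) - 2 * (\<tau> * (1 + \<delta>)) \<le> (1 + \<delta>) + \<tau> * (1 + \<delta>) + (1 + \<delta> / 2) + \<delta> / 4"
      using \<sigma> s by (subst (asm) mult_le_cancel_left_pos) auto
    then show False using \<delta> unfolding tau(3) by simp
  qed
  then have "{j \<in> {..<p}. b0 j \<noteq> 0 \<and> bh j \<noteq> 0} = {j \<in> {..<p}. b0 j \<noteq> 0}" by auto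
  then show "true_disc p b0 bh = k" by (simp add: true_disc_def k(1) sparsity_def)
qed

end

section \<open>Probability of the good event\<close>

lemma colnorm2_tail:
  assumes c: "c \<le> p" and \<tau>: "0 < \<tau>" "\<tau> \<le> 1"
  shows "measure (Omega n p) {\<omega> \<in> space (Omega n p). \<not> ((1 - \<tau>) * real n \<le> colnorm2 n p \<omega> c \<and> colnorm2 n p \<omega> c \<le> (1 + \<tau>) * real n)}
    \<le> 2 * exp (- (\<tau>\<^sup>2 / 16 * real n))"
proof -
  interpret prob_space "Omega n p" by (rule prob_space_Omega)
  define A where "A = col p c ` {..<n}"
  have A: "A \<subseteq> idx n p" using col_in_idx[OF c] by (auto simp: A_def)
  have inj: "inj_on (col p c) {..<n}" using col_inj[OF c c] by (auto simp: inj_on_def)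
  have cA: "card A = n" by (simp add: A_def card_image[OF inj])
  have eq: "(\<Sum>i\<in>A. (\<omega> i)\<^sup>2) = colnorm2 n p \<omega> c" for \<omega>
    unfolding A_def colnorm2_def using sum.reindex[OF inj, of "\<lambda>i. (\<omega> i)\<^sup>2"] by simp
  have [measurable]: "(\<lambda>\<omega>. colnorm2 n p \<omega> c) \<in> borel_measurable (Omega n p)"
    by (rule measurable_colnorm2[OF c])
  let ?E = "\<lambda>e. {\<omega> \<in> space (Omega n p). \<tau> * real n < e * (colnorm2 n p \<omega> c - real n)}"
  have "prob {\<omega> \<in> space (Omega n p). \<not> ((1 - \<tau>) * real n \<le> colnorm2 n p \<omega> c \<and> colnorm2 n p \<omega> c \<le> (1 + \<tau>) * real n)}
      = prob (?E 1 \<union> ?E (- 1))"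
    by (intro arg_cong[where f = prob]) (auto simp: algebra_simps)
  also have "\<dots> \<le> prob (?E 1) + prob (?E (- 1))" by (intro measure_Un_le) auto
  also have "\<dots> \<le> exp (- (\<tau>\<^sup>2 / 16 * real n)) + exp (- (\<tau>\<^sup>2 / 16 * real n))"
    using sum_squares_tail[OF finite_idx A \<tau>, of 1] sum_squares_tail[OF finite_idx A \<tau>, of "- 1"]
    unfolding eq cA Omega_def by (intro add_mono) auto
  finally show ?thesis by simp
qed

text \<open>Transfers an event about i.i.d. normals to the model. Exceptional sets are carried as
  explicit measurable events, so regularity predicates need not themselves be shown
  measurable.\<close>

lemma proj_event_prob:
  assumes c: "c \<le> p" and A: "A \<subseteq> {..p} - {c}" "A \<noteq> {}"
    and meas: "{u \<in> space (N01s A). P u} \<in> sets (N01s A)"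
    and le: "measure (N01s A) {u \<in> space (N01s A). P u} \<le> x"
  shows "\<exists>E\<in>sets (Omega n p). measure (Omega n p) E \<le> x \<and>
    (\<forall>\<omega>\<in>space (Omega n p) - E. colnorm2 n p \<omega> c \<noteq> 0 \<longrightarrow> \<not> P (\<lambda>j\<in>A. proj n p \<omega> c j))"
proof -
  let ?B = "{u \<in> space (N01s A). P u}"
  let ?E = "{\<omega> \<in> space (Omega n p). colnorm2 n p \<omega> c \<noteq> 0 \<and> (\<lambda>j\<in>A. proj n p \<omega> c j) \<in> ?B}"
  have pf [measurable]: "(\<lambda>\<omega>. \<lambda>j\<in>A. proj n p \<omega> c j) \<in> measurable (Omega n p) (N01s A)"
    using A by (intro measurable_proj_family c) auto
  have [measurable]: "(\<lambda>\<omega>. colnorm2 n p \<omega> c) \<in> borel_measurable (Omega n p)"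
    by (rule measurable_colnorm2[OF c])
  have [measurable]: "?B \<in> sets (N01s A)" by (rule meas)
  have 1: "?E \<in> sets (Omega n p)" by measurable
  have 2: "measure (Omega n p) ?E \<le> x"
    using proj_family_prob_le[OF c A meas, of n] le by linarith
  have 3: "\<forall>\<omega>\<in>space (Omega n p) - ?E. colnorm2 n p \<omega> c \<noteq> 0 \<longrightarrow> \<not> P (\<lambda>j\<in>A. proj n p \<omega> c j)"
    using measurable_space[OF pf] by blast
  show ?thesis by (rule bexI[of _ ?E], rule conjI[OF 2 3], rule 1)
qed

lemma (in prob_space) ex_union_bound:
  assumes "finite I" and "\<And>i. i \<in> I \<Longrightarrow> \<exists>E\<in>events. prob E \<le> x i \<and> (\<forall>\<omega>\<in>space M - E. P i \<omega>)"
  shows "\<exists>E\<in>events. prob E \<le> (\<Sum>i\<in>I. x i) \<and> (\<forall>\<omega>\<in>space M - E. \<forall>i\<in>I. P i \<omega>)"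
proof -
  obtain E where E: "\<And>i. i \<in> I \<Longrightarrow> E i \<in> events" "\<And>i. i \<in> I \<Longrightarrow> prob (E i) \<le> x i"
    "\<And>i \<omega>. i \<in> I \<Longrightarrow> \<omega> \<in> space M - E i \<Longrightarrow> P i \<omega>"
    using assms(2) by metis
  have "prob (\<Union>i\<in>I. E i) \<le> (\<Sum>i\<in>I. prob (E i))"
    using assms(1) E by (intro finite_measure_subadditive_finite) auto
  also have "\<dots> \<le> (\<Sum>i\<in>I. x i)" by (intro sum_mono E)
  finally show ?thesis using E assms(1) by (intro bexI[of _ "\<Union>i\<in>I. E i"]) auto
qed

lemma (in prob_space) ex_event_union:
  assumes "\<exists>E\<in>events. prob E \<le> x \<and> (\<forall>\<omega>\<in>space M - E. P \<omega>)"
    and "\<exists>E\<in>events. prob E \<le> x' \<and> (\<forall>\<omega>\<in>space M - E. Q \<omega>)"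
  shows "\<exists>E\<in>events. prob E \<le> x + x' \<and> (\<forall>\<omega>\<in>space M - E. P \<omega> \<and> Q \<omega>)"
proof -
  obtain E F where EF: "E \<in> events" "prob E \<le> x" "\<forall>\<omega>\<in>space M - E. P \<omega>"
    "F \<in> events" "prob F \<le> x'" "\<forall>\<omega>\<in>space M - F. Q \<omega>" using assms by blast
  then have "prob (E \<union> F) \<le> x + x'"
    using measure_Un_le[of E "M" F] by simp
  then show ?thesis using EF by (intro bexI[of _ "E \<union> F"]) auto
qed

lemma design_events:
  assumes n: "1 \<le> n" and p: "1 \<le> p" and \<tau>: "0 < \<tau>" "\<tau> < 1"
  shows "\<exists>E\<in>sets (Omega n p).
    measure (Omega n p) E \<le> (real p + 1) * (2 * exp (- (\<tau>\<^sup>2 / 16 * real n))) + (real p + 1) / real p ^ 3 \<and>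
    (\<forall>\<omega>\<in>space (Omega n p) - E. design_regular n p \<tau> \<omega>)"
proof -
  interpret prob_space "Omega n p" by (rule prob_space_Omega)
  let ?P = "\<lambda>c \<omega>. (1 - \<tau>) * real n \<le> colnorm2 n p \<omega> c \<and> colnorm2 n p \<omega> c \<le> (1 + \<tau>) * real n"
  let ?R = "\<lambda>c \<omega>. colnorm2 n p \<omega> c \<noteq> 0 \<longrightarrow> (\<forall>A\<subseteq>{..p} - {c}. A \<noteq> {} \<longrightarrow>
        (\<Sum>j\<in>A. (proj n p \<omega> c j)\<^sup>2) \<le> 28 * (real (card A) * ln (2 * real p / real (card A))))"
  have 1: "\<exists>E\<in>events. prob E \<le> 2 * exp (- (\<tau>\<^sup>2 / 16 * real n)) \<and> (\<forall>\<omega>\<in>space (Omega n p) - E. ?P c \<omega>)" if "c \<in> {..p}" for c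
  proof -
    have c: "c \<le> p" using that by simp
    have [measurable]: "(\<lambda>\<omega>. colnorm2 n p \<omega> c) \<in> borel_measurable (Omega n p)"
      by (rule measurable_colnorm2[OF c])
    let ?E = "{\<omega> \<in> space (Omega n p). \<not> ?P c \<omega>}"
    have "?E \<in> events" by measurable
    then show ?thesis using colnorm2_tail[OF c \<tau>(1) less_imp_le[OF \<tau>(2)], of n] by (intro bexI[of _ ?E]) auto
  qed
  have 2: "\<exists>E\<in>events. prob E \<le> 1 / real p ^ 3 \<and> (\<forall>\<omega>\<in>space (Omega n p) - E. ?R c \<omega>)" if "c \<in> {..p}" for c
  proof -
    have c: "c \<le> p" using that by simp
    define I where "I = {..p} - {c}"
    have I: "finite I" "card I \<le> p" "I \<subseteq> {..p} - {c}" using c by (auto simp: I_def)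
    have "card I = p" using c by (simp add: I_def)
    then have Ine: "I \<noteq> {}" using p by auto
    let ?P = "\<lambda>u :: nat \<Rightarrow> real. \<exists>A\<subseteq>I. A \<noteq> {} \<and> 28 * (real (card A) * ln (2 * real p / real (card A))) < (\<Sum>i\<in>A. (u i)\<^sup>2)"
    have "{u \<in> space (N01s I). ?P u}
      = (\<Union>A\<in>Pow I - {{}}. {u \<in> space (N01s I). 28 * (real (card A) * ln (2 * real p / real (card A))) < (\<Sum>i\<in>A. (u i)\<^sup>2)})"
      by auto
    also have "\<dots> \<in> sets (N01s I)"
    proof (intro sets.finite_UN)
      fix A assume A: "A \<in> Pow I - {{}}"
      have [measurable]: "(\<lambda>\<omega>. \<Sum>i\<in>A. (\<omega> i)\<^sup>2) \<in> borel_measurable (N01s I)"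
        by measurable (use A in auto)
      show "{u \<in> space (N01s I). 28 * (real (card A) * ln (2 * real p / real (card A))) < (\<Sum>i\<in>A. (u i)\<^sup>2)} \<in> sets (N01s I)"
        by measurable
    qed (use I in simp)
    finally have meas: "{u \<in> space (N01s I). ?P u} \<in> sets (N01s I)" .
    from proj_event_prob[where n = n, OF c I(3) Ine meas subset_sum_squares_tail[OF I(1,2) p]]
    obtain E where E: "E \<in> events" "prob E \<le> 1 / real p ^ 3"
      "\<forall>\<omega>\<in>space (Omega n p) - E. colnorm2 n p \<omega> c \<noteq> 0 \<longrightarrow> \<not> ?P (\<lambda>j\<in>I. proj n p \<omega> c j)"
      by (elim bexE conjE) blast
    have sq: "(\<Sum>i\<in>A. ((\<lambda>j\<in>I. proj n p \<omega> c j) i)\<^sup>2) = (\<Sum>i\<in>A. (proj n p \<omega> c i)\<^sup>2)" if "A \<subseteq> I" for A \<omega>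
      using that by (intro sum.cong) auto
    have "(\<Sum>i\<in>A. (proj n p \<omega> c i)\<^sup>2) \<le> 28 * (real (card A) * ln (2 * real p / real (card A)))"
      if "\<omega> \<in> space (Omega n p) - E" "colnorm2 n p \<omega> c \<noteq> 0" "A \<subseteq> I" "A \<noteq> {}" for \<omega> A
    proof (rule ccontr)
      assume "\<not> ?thesis"
      then have "?P (\<lambda>j\<in>I. proj n p \<omega> c j)" using that(3,4) sq[OF that(3)] by (intro exI[of _ A]) auto
      then show False using E(3) that(1,2) by blast
    qed
    then show ?thesis using E(1,2) unfolding I_def by blast
  qed
  have "\<exists>E\<in>events. prob E \<le> (\<Sum>c\<in>{..p}. 2 * exp (- (\<tau>\<^sup>2 / 16 * real n))) + (\<Sum>c\<in>{..p}. 1 / real p ^ 3) \<and>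
    (\<forall>\<omega>\<in>space (Omega n p) - E. (\<forall>c\<in>{..p}. ?P c \<omega>) \<and> (\<forall>c\<in>{..p}. ?R c \<omega>))"
    by (intro ex_event_union ex_union_bound 1 2) auto
  then obtain E where E: "E \<in> events" "prob E \<le> (\<Sum>c\<in>{..p}. 2 * exp (- (\<tau>\<^sup>2 / 16 * real n))) + (\<Sum>c\<in>{..p}. 1 / real p ^ 3)"
    "\<And>\<omega> c. \<omega> \<in> space (Omega n p) - E \<Longrightarrow> c \<le> p \<Longrightarrow> ?P c \<omega> \<and> ?R c \<omega>"
    by (elim bexE conjE) blast
  \<comment> \<open>The norm bounds discharge the proviso that column \<open>c\<close> does not
    vanish.\<close>
  have "0 < (1 - \<tau>) * real n" using \<tau> n by simp
  then have "colnorm2 n p \<omega> c \<noteq> 0" if "\<omega> \<in> space (Omega n p) - E" "c \<le> p" for \<omega> c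
    using E(3)[OF that] by linarith
  then have "\<forall>\<omega>\<in>space (Omega n p) - E. design_regular n p \<tau> \<omega>"
    unfolding design_regular_def using E(3) by blast
  then show ?thesis using E(1,2) by (intro bexI[of _ E]) (auto simp: add.commute)
qed

lemma noise_events:
  assumes p: "1 \<le> p" and a: "1 \<le> a" and q: "0 < q" "q < 1" and B: "1 \<le> B" "B \<le> p" and x: "0 < x" and \<theta>: "0 < \<theta>"
    and t: "0 \<le> t"
  shows "\<exists>E\<in>sets (Omega n p). measure (Omega n p) E \<le> real p * (2 * (1 - Phi t))
      + (real p * (2 * (1 - Phi (a * zq q p B))) / x
      + (\<Sum>m\<in>{B<..p}. exp (- ((\<theta> * ((1 + q) / 2) - q * (exp \<theta> - 1)) * real m)))) \<and>
    (\<forall>\<omega>\<in>space (Omega n p) - E. colnorm2 n p \<omega> p \<noteq> 0 \<longrightarrow> noise_regular a q t x B p (proj n p \<omega> p))"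
proof -
  interpret prob_space "Omega n p" by (rule prob_space_Omega)
  let ?I = "{..<p}"
  let ?N = "\<lambda>t (u :: nat \<Rightarrow> real). real (card {j\<in>?I. t < \<bar>u j\<bar>})"
  have I: "?I \<subseteq> {..p} - {p}" "?I \<noteq> {}" using p by (auto simp: lessThan_empty_iff)
  have count: "?N t (\<lambda>j\<in>?I. proj n p \<omega> p j) = real (card {j. j < p \<and> t < \<bar>proj n p \<omega> p j\<bar>})" for t \<omega>
    by (intro arg_cong[where f = "\<lambda>A. real (card A)"]) auto
  have countmeas: "{u \<in> space (N01s ?I). s < ?N t u} \<in> sets (N01s ?I)" for s t
  proof -
    have [measurable]: "?N t \<in> borel_measurable (N01s ?I)" by (rule measurable_exceedance_count) simp
    show ?thesis by measurable
  qed
  have 1: "\<exists>E\<in>events. prob E \<le> real p * (2 * (1 - Phi t)) \<and>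
    (\<forall>\<omega>\<in>space (Omega n p) - E. colnorm2 n p \<omega> p \<noteq> 0 \<longrightarrow> (\<forall>j<p. \<bar>proj n p \<omega> p j\<bar> \<le> t))"
  proof -
    have meas: "{u \<in> space (N01s ?I). \<exists>i\<in>?I. t < \<bar>u i\<bar>} \<in> sets (N01s ?I)"
      by measurable
    have "measure (N01s ?I) {u \<in> space (N01s ?I). \<exists>i\<in>?I. t < \<bar>u i\<bar>} \<le> real p * (2 * (1 - Phi t))"
      using max_tail[of ?I t] t by simp
    from proj_event_prob[where n = n, OF order_refl I meas this] obtain E where E: "E \<in> events" "prob E \<le> real p * (2 * (1 - Phi t))"
      "\<forall>\<omega>\<in>space (Omega n p) - E. colnorm2 n p \<omega> p \<noteq> 0 \<longrightarrow> \<not> (\<exists>i\<in>?I. t < \<bar>(\<lambda>j\<in>?I. proj n p \<omega> p j) i\<bar>)"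
      by (elim bexE conjE) blast
    then have "\<forall>\<omega>\<in>space (Omega n p) - E. colnorm2 n p \<omega> p \<noteq> 0 \<longrightarrow> (\<forall>j<p. \<bar>proj n p \<omega> p j\<bar> \<le> t)"
      by (force simp: not_less)
    then show ?thesis using E(1,2) by blast
  qed
  have cnt: "\<exists>E\<in>events. prob E \<le> y \<and>
    (\<forall>\<omega>\<in>space (Omega n p) - E. colnorm2 n p \<omega> p \<noteq> 0 \<longrightarrow> real (card {j. j < p \<and> s < \<bar>proj n p \<omega> p j\<bar>}) \<le> x)"
    if "measure (N01s ?I) {u \<in> space (N01s ?I). x < ?N s u} \<le> y" for s x y
  proof -
    from proj_event_prob[where n = n, OF order_refl I countmeas that] obtain E where E: "E \<in> events" "prob E \<le> y"
      "\<forall>\<omega>\<in>space (Omega n p) - E. colnorm2 n p \<omega> p \<noteq> 0 \<longrightarrow> \<not> x < ?N s (\<lambda>j\<in>?I. proj n p \<omega> p j)"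
      by (elim bexE conjE) blast
    then show ?thesis unfolding count not_less by blast
  qed
  have zB: "0 \<le> a * zq q p m" if "1 \<le> m" "m \<le> p" for m using zq_pos[OF q that] a by simp
  have 2: "\<exists>E\<in>events. prob E \<le> real p * (2 * (1 - Phi (a * zq q p B))) / x \<and>
    (\<forall>\<omega>\<in>space (Omega n p) - E. colnorm2 n p \<omega> p \<noteq> 0 \<longrightarrow> real (card {j. j < p \<and> a * zq q p B < \<bar>proj n p \<omega> p j\<bar>}) \<le> x)"
    using exceedance_count_markov[of ?I "a * zq q p B" x] zB[OF B] x by (intro cnt) simp
  have 3: "\<exists>E\<in>events. prob E \<le> (\<Sum>m\<in>{B<..p}. exp (- ((\<theta> * ((1 + q) / 2) - q * (exp \<theta> - 1)) * real m))) \<and>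
    (\<forall>\<omega>\<in>space (Omega n p) - E. \<forall>m\<in>{B<..p}. colnorm2 n p \<omega> p \<noteq> 0 \<longrightarrow>
      real (card {j. j < p \<and> a * zq q p m < \<bar>proj n p \<omega> p j\<bar>}) \<le> (1 + q) / 2 * real m)"
  proof (rule ex_union_bound[OF finite_greaterThanAtMost], rule cnt, rule exceedance_count_chernoff)
    fix m assume that: "m \<in> {B<..p}"
    have m: "1 \<le> m" "m \<le> p" using that B by auto
    show "0 \<le> a * zq q p m" using zB[OF m] .
    \<comment> \<open>At the quantile itself the mean count is \<open>q * m\<close>, and inflating
      the threshold can only lower it.\<close>
    have "zq q p m \<le> a * zq q p m" using zq_pos[OF q m] a by simp
    then have "1 - Phi (a * zq q p m) \<le> q * real m / (2 * real p)"
      using Phi_zq[OF q m] strict_mono_less_eq[OF Phi_strict_mono, of "zq q p m" "a * zq q p m"] by simp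
    then have "real p * (2 * (1 - Phi (a * zq q p m))) \<le> real p * (2 * (q * real m / (2 * real p)))"
      by (intro mult_left_mono) auto
    then show "real (card ?I) * (2 * (1 - Phi (a * zq q p m))) \<le> q * real m"
      using p by simp
  qed (use \<theta> in auto)
  have "noise_regular a q t x B p (proj n p \<omega> p)"
    if "(colnorm2 n p \<omega> p \<noteq> 0 \<longrightarrow> (\<forall>j<p. \<bar>proj n p \<omega> p j\<bar> \<le> t)) \<and>
      (colnorm2 n p \<omega> p \<noteq> 0 \<longrightarrow> real (card {j. j < p \<and> a * zq q p B < \<bar>proj n p \<omega> p j\<bar>}) \<le> x) \<and>
      (\<forall>m\<in>{B<..p}. colnorm2 n p \<omega> p \<noteq> 0 \<longrightarrow>
        real (card {j. j < p \<and> a * zq q p m < \<bar>proj n p \<omega> p j\<bar>}) \<le> (1 + q) / 2 * real m)"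
      "colnorm2 n p \<omega> p \<noteq> 0" for \<omega>
    using that unfolding noise_regular_def by blast
  moreover note ex_event_union[OF 1 ex_event_union[OF 2 3]]
  ultimately show ?thesis by blast
qed

section \<open>Asymptotics\<close>

text \<open>The rate vanishes at 0 with slope (1 - q) / 2. A quarter of 1 - q is small enough for
  exp \<theta> - 1 \<le> \<theta> + \<theta>^2 to keep it positive.\<close>

lemma chernoff_rate_pos:
  assumes q: "0 < q" "q < (1 :: real)"
  obtains \<theta> where "0 < \<theta>" "0 < \<theta> * ((1 + q) / 2) - q * (exp \<theta> - 1)"
proof
  define \<theta> where "\<theta> = (1 - q) / 4"
  have \<theta>: "0 < \<theta>" "\<theta> \<le> 1" using q by (auto simp: \<theta>_def)
  show "0 < (1 - q) / 4" using q by simp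
  have "q * (exp \<theta> - 1) \<le> q * (\<theta> + \<theta>\<^sup>2)"
    using exp_bound[of \<theta>] \<theta> q by (intro mult_left_mono) auto
  moreover have "\<theta> * ((1 + q) / 2) - q * (\<theta> + \<theta>\<^sup>2) = \<theta> * ((1 - q) / 4 * (2 - q))"
    by (simp add: \<theta>_def power2_eq_square field_simps)
  moreover have "0 < \<theta> * ((1 - q) / 4 * (2 - q))" using \<theta> q by simp
  ultimately show "0 < (1 - q) / 4 * ((1 + q) / 2) - q * (exp ((1 - q) / 4) - 1)"
    unfolding \<theta>_def by linarith
qed

lemma geometric_tail_le:
  fixes x :: real
  assumes "0 < x" "x < 1" "L \<le> B"
  shows "(\<Sum>m\<in>{B<..p}. x ^ m) \<le> x ^ L / (1 - x)"
proof -
  have "(\<Sum>m\<in>{B<..p}. x ^ m) = (\<Sum>m=Suc B..p. x ^ m)"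
    by (simp add: atLeastSucAtMost_greaterThanAtMost)
  also have "\<dots> \<le> x ^ Suc B / (1 - x)"
    using assms by (subst sum_gp) (auto intro!: divide_right_mono)
  also have "\<dots> \<le> x ^ L / (1 - x)"
    using assms by (intro divide_right_mono power_decreasing) auto
  finally show ?thesis .
qed

locale slope_sequence =
  fixes p :: "nat \<Rightarrow> nat"
    and b0 :: "nat \<Rightarrow> nat \<Rightarrow> real"
    and \<sigma> \<delta> q :: real
    and bhat :: "nat \<Rightarrow> (((nat \<times> nat) + nat) \<Rightarrow> real) \<Rightarrow> nat \<Rightarrow> real"
  fixes k :: "nat \<Rightarrow> nat"
  defines "k \<equiv> \<lambda>n. sparsity (p n) (b0 n)"
  assumes sigma_pos: "\<sigma> > 0"
    and delta_pos: "\<delta> > 0"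
    and q: "0 < q" "q < 1"
    and b0_Rp: "\<And>n. b0 n \<in> Rp (p n)"
    and k_pos: "\<And>n. k n \<ge> 1"
    and signal: "\<And>n j. j < p n \<Longrightarrow> b0 n j \<noteq> 0 \<Longrightarrow>
                   \<bar>b0 n j\<bar> \<ge> 2 * \<sigma> * (1 + \<delta>) * sqrt (2 * ln (real (p n)))"
    and p_inf: "filterlim p at_top sequentially"
    and k_over_p: "(\<lambda>n. real (k n) / real (p n)) \<longlonglongrightarrow> 0"
    and k2logp_over_n: "(\<lambda>n. real (k n)^2 * ln (real (p n)) / real n) \<longlonglongrightarrow> 0"
    and bhat_Rp: "\<And>n \<omega>. \<omega> \<in> space (Omega n (p n)) \<Longrightarrow> bhat n \<omega> \<in> Rp (p n)"
    and bhat_argmin: "\<And>n \<omega> b. \<omega> \<in> space (Omega n (p n)) \<Longrightarrow> b \<in> Rp (p n) \<Longrightarrow>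
          slope_obj n (p n) (Xmat n \<omega>) (Yvec n (p n) \<sigma> (b0 n) \<omega>) (slope_lambda \<sigma> \<delta> q (p n)) (bhat n \<omega>)
          \<le> slope_obj n (p n) (Xmat n \<omega>) (Yvec n (p n) \<sigma> (b0 n) \<omega>) (slope_lambda \<sigma> \<delta> q (p n)) b"
    and bhat_meas: "\<And>n j. (\<lambda>\<omega>. bhat n \<omega> j) \<in> borel_measurable (Omega n (p n))"
begin

section \<open>Limits of the individual error terms\<close>

abbreviation "M n \<equiv> Omega n (p n)"

abbreviation "FD n \<omega> \<equiv> real (false_disc (p n) (b0 n) (bhat n \<omega>))"

abbreviation "TD n \<omega> \<equiv> true_disc (p n) (b0 n) (bhat n \<omega>)"

lemma p_real_inf: "filterlim (\<lambda>n. real (p n)) at_top sequentially"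
  by (rule filterlim_compose[OF filterlim_real_sequentially p_inf])

lemma p_ge: "1 \<le> p n"
proof -
  have "k n \<le> card {..<p n}" unfolding k_def sparsity_def by (intro card_mono) auto
  then show ?thesis using k_pos[of n] by simp
qed

text \<open>Because \<open>k n \<ge> 1\<close>, the sparsity condition already forces log p = o(n);
  the union bound over all column norms rests on this.\<close>

lemma ln_p_over_n: "(\<lambda>n. ln (real (p n)) / real n) \<longlonglongrightarrow> 0"
proof (rule tendsto_sandwich[OF _ _ tendsto_const k2logp_over_n])
  show "\<forall>\<^sub>F n in sequentially. 0 \<le> ln (real (p n)) / real n" using p_ge by simp
  show "\<forall>\<^sub>F n in sequentially. ln (real (p n)) / real n \<le> real (k n)^2 * ln (real (p n)) / real n"
  proof (intro always_eventually allI divide_right_mono)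
    fix n
    have "1 * ln (real (p n)) \<le> real (k n)^2 * ln (real (p n))"
      using k_pos[of n] p_ge[of n] by (intro mult_right_mono one_le_power) auto
    then show "ln (real (p n)) \<le> real (k n)^2 * ln (real (p n))" by simp
  qed simp
qed

lemma eventually_p_ge: "\<forall>\<^sub>F n in sequentially. C * k n \<le> p n"
proof -
  have "\<forall>\<^sub>F n in sequentially. real (k n) / real (p n) < 1 / (real C + 1)"
    by (rule order_tendstoD(2)[OF k_over_p]) simp
  then show ?thesis
  proof eventually_elim
    case (elim n)
    have "0 < real (p n)" using p_ge[of n] by simp
    then have "real (k n) * (real C + 1) < real (p n)" using elim by (simp add: field_simps)
    moreover have "real C * real (k n) \<le> real (k n) * (real C + 1)" by (simp add: algebra_simps)
    ultimately have "real (C * k n) < real (p n)" by simp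
    then show ?case by (simp only: of_nat_less_iff less_imp_le)
  qed
qed

lemma theta_tendsto: "(\<lambda>n. real (k n) * sqrt (ln (2 * real (p n)) / real n)) \<longlonglongrightarrow> 0"
proof (rule tendsto_sandwich[OF _ _ tendsto_const])
  show "\<forall>\<^sub>F n in sequentially. 0 \<le> real (k n) * sqrt (ln (2 * real (p n)) / real n)"
    using p_ge by (intro always_eventually allI mult_nonneg_nonneg) (auto intro!: divide_nonneg_nonneg ln_ge_zero simp: order_trans[of 1 "2 * 1"])
  have "(\<lambda>n. sqrt (2 * (real (k n)^2 * ln (real (p n)) / real n))) \<longlonglongrightarrow> sqrt (2 * 0)"
    by (intro tendsto_intros k2logp_over_n)
  then show "(\<lambda>n. sqrt (2 * (real (k n)^2 * ln (real (p n)) / real n))) \<longlonglongrightarrow> 0" by simp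
  have "\<forall>\<^sub>F n in sequentially. 2 \<le> real (p n)"
    using p_real_inf unfolding filterlim_at_top by blast
  then show "\<forall>\<^sub>F n in sequentially. real (k n) * sqrt (ln (2 * real (p n)) / real n)
    \<le> sqrt (2 * (real (k n)^2 * ln (real (p n)) / real n))"
  proof eventually_elim
    case (elim n)
    have "ln (2 * real (p n)) \<le> 2 * ln (real (p n))"
      using elim ln_mono[of 2 "real (p n)"] by (simp add: ln_mult)
    then have "real (k n)^2 * (ln (2 * real (p n)) / real n) \<le> real (k n)^2 * (2 * ln (real (p n)) / real n)"
      by (intro mult_left_mono divide_right_mono) auto
    then have "sqrt (real (k n)^2 * (ln (2 * real (p n)) / real n)) \<le> sqrt (2 * (real (k n)^2 * ln (real (p n)) / real n))"
      by (simp add: mult_ac)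
    moreover have "sqrt (real (k n)^2 * (ln (2 * real (p n)) / real n)) = real (k n) * sqrt (ln (2 * real (p n)) / real n)"
      unfolding real_sqrt_mult[of "real (k n)^2"] by simp
    ultimately show ?case by linarith
  qed
qed

lemma column_norm_bound_tendsto:
  assumes "0 < c"
  shows "(\<lambda>n. (real (p n) + 1) * (2 * exp (- (c * real n)))) \<longlonglongrightarrow> 0"
proof (rule tendsto_sandwich[OF _ _ tendsto_const])
  show "\<forall>\<^sub>F n in sequentially. 0 \<le> (real (p n) + 1) * (2 * exp (- (c * real n)))" by simp
  show "(\<lambda>n. 4 * exp (- (c / 2) * real n)) \<longlonglongrightarrow> 0"
    using assms by real_asymp
  have "\<forall>\<^sub>F n in sequentially. ln (real (p n)) / real n < c / 2"
    by (rule order_tendstoD(2)[OF ln_p_over_n]) (use assms in simp)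
  then show "\<forall>\<^sub>F n in sequentially. (real (p n) + 1) * (2 * exp (- (c * real n))) \<le> 4 * exp (- (c / 2) * real n)"
    using eventually_gt_at_top[of 0]
  proof eventually_elim
    case (elim n)
    have p1: "1 \<le> real (p n)" using p_ge[of n] by simp
    have "ln (real (p n)) \<le> c / 2 * real n" using elim by (simp add: field_simps)
    then have "exp (ln (real (p n))) \<le> exp (c / 2 * real n)" by simp
    then have "real (p n) \<le> exp (c / 2 * real n)" using p1 by simp
    then have "(real (p n) + 1) * (2 * exp (- (c * real n))) \<le> (2 * exp (c / 2 * real n)) * (2 * exp (- (c * real n)))"
      using p1 by (intro mult_right_mono) auto
    also have "\<dots> = 4 * exp (- (c / 2) * real n)" by (simp flip: exp_add)
    finally show ?case .
  qed
qed

lemma gram_bound_tendsto: "(\<lambda>n. (real (p n) + 1) / real (p n) ^ 3) \<longlonglongrightarrow> 0"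
proof -
  have "((\<lambda>x :: real. (x + 1) / x ^ 3) \<longlongrightarrow> 0) at_top" by real_asymp
  from filterlim_compose[OF this p_real_inf] show ?thesis .
qed

text \<open>The union bound over \<open>p\<close> coordinates leaves the power p^(1 - a^2), and the
  exponent is negative.\<close>

lemma max_noise_bound_tendsto:
  assumes a: "1 < a"
  shows "(\<lambda>n. real (p n) * (2 * (1 - Phi (a * sqrt (2 * ln (real (p n))))))) \<longlonglongrightarrow> 0"
proof (rule tendsto_sandwich[OF _ _ tendsto_const])
  define c where "c = a\<^sup>2 - 1"
  have c: "0 < c" using a by (simp add: c_def)
  show "\<forall>\<^sub>F n in sequentially. 0 \<le> real (p n) * (2 * (1 - Phi (a * sqrt (2 * ln (real (p n))))))"
    by (simp add: Phi_def)
  have "((\<lambda>x :: real. 2 * exp (- c * ln x)) \<longlongrightarrow> 0) at_top" using c by real_asymp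
  from filterlim_compose[OF this p_real_inf]
  show "(\<lambda>n. 2 * exp (- c * ln (real (p n)))) \<longlonglongrightarrow> 0" .
  show "\<forall>\<^sub>F n in sequentially. real (p n) * (2 * (1 - Phi (a * sqrt (2 * ln (real (p n)))))) \<le> 2 * exp (- c * ln (real (p n)))"
  proof (intro always_eventually allI)
    fix n
    have p1: "1 \<le> real (p n)" using p_ge[of n] by simp
    have "1 - Phi (a * sqrt (2 * ln (real (p n)))) \<le> exp (- (a * sqrt (2 * ln (real (p n))))\<^sup>2 / 2)"
      using a p1 by (intro Phi_tail_upper) auto
    also have "(a * sqrt (2 * ln (real (p n))))\<^sup>2 = 2 * a\<^sup>2 * ln (real (p n))"
      using p1 by (simp add: power_mult_distrib)
    finally have "real (p n) * (2 * (1 - Phi (a * sqrt (2 * ln (real (p n)))))) \<le> real (p n) * (2 * exp (- (2 * a\<^sup>2 * ln (real (p n))) / 2))"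
      by (intro mult_left_mono) auto
    moreover have "exp l * (2 * exp (- (2 * a\<^sup>2 * l) / 2)) = 2 * exp (- c * l)" for l
      by (simp add: c_def algebra_simps flip: exp_add)
    from this[of "ln (real (p n))"] have "real (p n) * (2 * exp (- (2 * a\<^sup>2 * ln (real (p n))) / 2)) = 2 * exp (- c * ln (real (p n)))"
      using p1 by simp
    ultimately show "real (p n) * (2 * (1 - Phi (a * sqrt (2 * ln (real (p n)))))) \<le> 2 * exp (- c * ln (real (p n)))"
      by linarith
  qed
qed

lemma zq_at_top:
  assumes L: "1 \<le> L"
  shows "filterlim (\<lambda>n. zq q (p n) (L * k n)) at_top sequentially"
proof -
  obtain c where c: "0 < c" "\<And>p m. 1 \<le> m \<Longrightarrow> m \<le> p \<Longrightarrow> c * sqrt (ln (2 * real p / real m)) \<le> zq q p m"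
    using zq_lower[OF q] by blast
  have "filterlim (\<lambda>n. real (k n) / real (p n)) (at_right 0) sequentially"
    using k_over_p k_pos p_ge
    by (auto simp: filterlim_at intro!: always_eventually divide_pos_pos) (auto simp: Suc_le_eq)
  moreover have "filterlim (\<lambda>x. c * sqrt (ln (2 / (real L * x)))) at_top (at_right 0)"
    using c(1) L by real_asymp
  ultimately have "filterlim (\<lambda>n. c * sqrt (ln (2 / (real L * (real (k n) / real (p n)))))) at_top sequentially"
    by (rule filterlim_compose[rotated])
  then show ?thesis
  proof (rule filterlim_at_top_mono)
    show "\<forall>\<^sub>F n in sequentially. c * sqrt (ln (2 / (real L * (real (k n) / real (p n))))) \<le> zq q (p n) (L * k n)"
      using eventually_p_ge[of L]
    proof eventually_elim
      case (elim n)
      have "1 \<le> L * k n" using L k_pos[of n] by (simp add: Suc_le_eq)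
      then have "c * sqrt (ln (2 * real (p n) / real (L * k n))) \<le> zq q (p n) (L * k n)"
        using elim by (rule c(2))
      then show ?case by simp
    qed
  qed
qed

text \<open>For fixed \<open>L\<close> the mean number of exceedances equals
  \<open>q * L * k\<close> times the ratio of the tails at \<open>a * z\<close> and
  \<open>z\<close>. The quantile tends to infinity as k / p -> 0, so this number is o(k).\<close>

lemma exceedance_bound_tendsto:
  assumes a: "1 < a" and L: "1 \<le> L" and \<epsilon>: "0 < \<epsilon>"
  shows "(\<lambda>n. real (p n) * (2 * (1 - Phi (a * zq q (p n) (L * k n)))) / (\<epsilon> * real (k n))) \<longlonglongrightarrow> 0"
proof -
  have "(\<lambda>n. q * real L / \<epsilon> * ((1 - Phi (a * zq q (p n) (L * k n))) / (1 - Phi (zq q (p n) (L * k n))))) \<longlonglongrightarrow> q * real L / \<epsilon> * 0"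
    by (intro tendsto_mult tendsto_const filterlim_compose[OF Phi_tail_ratio[OF a] zq_at_top[OF L]])
  then have lim: "(\<lambda>n. q * real L / \<epsilon> * ((1 - Phi (a * zq q (p n) (L * k n))) / (1 - Phi (zq q (p n) (L * k n))))) \<longlonglongrightarrow> 0"
    by simp
  have "\<forall>\<^sub>F n in sequentially. q * real L / \<epsilon> * ((1 - Phi (a * zq q (p n) (L * k n))) / (1 - Phi (zq q (p n) (L * k n))))
    = real (p n) * (2 * (1 - Phi (a * zq q (p n) (L * k n)))) / (\<epsilon> * real (k n))"
    using eventually_p_ge[of L]
  proof eventually_elim
    case (elim n)
    have m: "1 \<le> L * k n" using L k_pos[of n] by (simp add: Suc_le_eq)
    have pos: "0 < real (p n)" "0 < real (k n)" "0 < real L" using p_ge[of n] k_pos[of n] L by auto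
    show ?case unfolding Phi_zq[OF q m elim] using pos \<epsilon> q by (simp add: field_simps)
  qed
  from Lim_transform_eventually[OF lim this] show ?thesis .
qed

text \<open>The order of choices matters: \<open>L\<close> depends on \<open>\<eta>\<close> and
  \<open>q\<close> but not on \<open>n\<close>, and the limits are then taken for this fixed
  \<open>L\<close>.\<close>

lemma eventually_selection_consistent:
  assumes \<epsilon>: "0 < \<epsilon>" "\<epsilon> \<le> 1" and \<eta>: "0 < \<eta>"
  shows "\<forall>\<^sub>F n in sequentially. \<exists>E\<in>sets (M n). measure (M n) E \<le> \<eta> \<and>
    (\<forall>\<omega>\<in>space (M n) - E. FD n \<omega> \<le> \<epsilon> * real (k n)
       \<and> TD n \<omega> = k n)"
proof -
  define \<tau> where "\<tau> = \<delta> / (16 * (1 + \<delta>))"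
  define a where "a = 1 + \<delta> / 4"
  define D where "D = 2 * (1 + \<delta>) * sqrt (3 + 2 * ln (1 / q))"
  have \<tau>: "0 < \<tau>" "\<tau> \<le> 1" and a: "1 < a" using delta_pos by (auto simp: \<tau>_def a_def field_simps)
  have D: "0 \<le> D" using delta_pos q by (simp add: D_def)
  obtain c0 where c0: "0 < c0" "\<And>p m. 1 \<le> m \<Longrightarrow> m \<le> p \<Longrightarrow> c0 * sqrt (ln (2 * real p / real m)) \<le> zq q p m"
    using zq_lower[OF q] by blast
  obtain \<theta> where \<theta>: "0 < \<theta>" "0 < \<theta> * ((1 + q) / 2) - q * (exp \<theta> - 1)"
    using chernoff_rate_pos[OF q] by blast
  define \<gamma> where "\<gamma> = \<theta> * ((1 + q) / 2) - q * (exp \<theta> - 1)"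
  define x where "x = exp (- \<gamma>)"
  have x: "0 < x" "x < 1" using \<theta> by (auto simp: x_def \<gamma>_def)
  have "(\<lambda>L. x ^ L / (1 - x)) \<longlonglongrightarrow> 0 / (1 - x)"
    by (intro tendsto_divide tendsto_const LIMSEQ_power_zero) (use x in auto)
  then have "\<forall>\<^sub>F L in sequentially. x ^ L / (1 - x) < \<eta> / 2"
    by (rule order_tendstoD(2)) (use \<eta> in simp)
  moreover have "\<forall>\<^sub>F L in sequentially. max 1 (4 / (1 - q)) \<le> real L"
    using filterlim_real_sequentially unfolding filterlim_at_top by blast
  ultimately have "\<forall>\<^sub>F L in sequentially. x ^ L / (1 - x) < \<eta> / 2 \<and> max 1 (4 / (1 - q)) \<le> real L"
    by (rule eventually_conj)
  then obtain L where L: "x ^ L / (1 - x) < \<eta> / 2" "1 \<le> L" "4 / (1 - q) \<le> real L"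
    by (auto simp: eventually_sequentially)
  have L4: "4 \<le> real L * (1 - q)" using L(3) q by (simp add: field_simps)
  \<comment> \<open>All error terms that vanish as n grows. The geometric tail over ranks above
    \<open>L * k\<close> is missing, since it is made small by the choice of \<open>L\<close>,
    uniformly in \<open>n\<close>.\<close>
  define err where "err n = (real (p n) + 1) * (2 * exp (- (\<tau>\<^sup>2 / 16 * real n))) + (real (p n) + 1) / real (p n) ^ 3
    + (real (p n) * (2 * (1 - Phi (a * sqrt (2 * ln (real (p n))))))
      + real (p n) * (2 * (1 - Phi (a * zq q (p n) (L * k n)))) / (\<epsilon> * real (k n)))" for n
  have "err \<longlonglongrightarrow> 0 + 0 + (0 + 0)"
    unfolding err_def using \<tau>
    by (intro tendsto_add column_norm_bound_tendsto gram_bound_tendsto max_noise_bound_tendsto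
        exceedance_bound_tendsto a \<epsilon>(1) L(2)) simp
  then have ev_err: "\<forall>\<^sub>F n in sequentially. err n < \<eta> / 2"
    by (rule order_tendstoD(2)) (use \<eta> in simp)
  define \<Theta> where "\<Theta> n = real (k n) * sqrt (ln (2 * real (p n)) / real n)" for n
  have Th: "\<Theta> \<longlonglongrightarrow> 0" unfolding \<Theta>_def by (rule theta_tendsto)
  have ev: "\<forall>\<^sub>F n in sequentially. C * \<Theta> n < d" if "0 < d" for C d
  proof -
    have "(\<lambda>n. C * \<Theta> n) \<longlonglongrightarrow> C * 0" by (intro tendsto_mult tendsto_const Th)
    then show ?thesis by (rule order_tendstoD(2)) (use that in simp)
  qed
  have ev1: "\<forall>\<^sub>F n in sequentially. 1 * \<Theta> n < 1 / 64" by (rule ev) simp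
  have ev2: "\<forall>\<^sub>F n in sequentially. 16 * (4 * (9 + D)) * \<Theta> n < \<delta> / (4 * (1 + \<delta>)) * (1 + \<delta>) * c0"
    by (rule ev) (use c0 delta_pos in simp)
  have ev3: "\<forall>\<^sub>F n in sequentially. 8 * (4 * (9 + D)) * \<Theta> n < \<delta> / 4"
    by (rule ev) (use delta_pos in simp)
  have "filterlim (\<lambda>n. ln (real (p n))) at_top sequentially"
    by (rule filterlim_compose[OF ln_at_top p_real_inf])
  then have ev4: "\<forall>\<^sub>F n in sequentially. ln (2 / q) / \<tau> \<le> ln (real (p n))"
    by (simp add: filterlim_at_top)
  have ev5: "\<forall>\<^sub>F n in sequentially. 2 \<le> p n" using p_inf by (simp add: filterlim_at_top)
  show ?thesis
    using ev_err ev1 ev2 ev3 ev4 ev5 eventually_p_ge[of 8] eventually_p_ge[of L] eventually_ge_at_top[of 1]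
  proof eventually_elim
    case (elim n)
    interpret prob_space "M n" by (rule prob_space_Omega)
    have B: "1 \<le> L * k n" using L(2) k_pos[of n] by (simp add: Suc_le_eq)
    have t: "0 \<le> a * sqrt (2 * ln (real (p n)))" using a p_ge[of n] by simp
    have ek: "0 < \<epsilon> * real (k n)" using \<epsilon> k_pos[of n] by simp
    have \<tau>1: "\<tau> < 1" using delta_pos by (simp add: \<tau>_def field_simps)
    obtain E1 where E1: "E1 \<in> events"
      "prob E1 \<le> (real (p n) + 1) * (2 * exp (- (\<tau>\<^sup>2 / 16 * real n))) + (real (p n) + 1) / real (p n) ^ 3"
      "\<forall>\<omega>\<in>space (M n) - E1. design_regular n (p n) \<tau> \<omega>"
      using design_events[OF elim(9) p_ge[of n] \<tau>(1) \<tau>1] by (elim bexE conjE) blast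
    obtain E2 where E2: "E2 \<in> events"
      "prob E2 \<le> real (p n) * (2 * (1 - Phi (a * sqrt (2 * ln (real (p n))))))
        + (real (p n) * (2 * (1 - Phi (a * zq q (p n) (L * k n)))) / (\<epsilon> * real (k n))
        + (\<Sum>m\<in>{L * k n<..p n}. exp (- (\<gamma> * real m))))"
      "\<forall>\<omega>\<in>space (M n) - E2. colnorm2 n (p n) \<omega> (p n) \<noteq> 0 \<longrightarrow>
        noise_regular a q (a * sqrt (2 * ln (real (p n)))) (\<epsilon> * real (k n)) (L * k n) (p n) (proj n (p n) \<omega> (p n))"
      using noise_events[OF p_ge[of n] less_imp_le[OF a] q B elim(8) ek \<theta>(1) t, of n] unfolding \<gamma>_def[symmetric]
      by (elim bexE conjE) blast
    have "(\<Sum>m\<in>{L * k n<..p n}. exp (- (\<gamma> * real m))) = (\<Sum>m\<in>{L * k n<..p n}. x ^ m)"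
      by (intro sum.cong) (auto simp: x_def mult.commute simp flip: exp_of_nat_mult)
    also have "\<dots> \<le> x ^ L / (1 - x)"
      using x k_pos[of n] by (intro geometric_tail_le) auto
    finally have "(\<Sum>m\<in>{L * k n<..p n}. exp (- (\<gamma> * real m))) < \<eta> / 2" using L(1) by linarith
    moreover have "prob (E1 \<union> E2) \<le> prob E1 + prob E2" using E1(1) E2(1) by (rule measure_Un_le)
    ultimately have "prob (E1 \<union> E2) \<le> \<eta>"
      using E1(2) E2(2) elim(1) unfolding err_def by linarith
    moreover have "FD n \<omega> \<le> \<epsilon> * real (k n)
       \<and> TD n \<omega> = k n" if \<omega>: "\<omega> \<in> space (M n) - (E1 \<union> E2)" for \<omega>
    proof -
      have design: "design_regular n (p n) \<tau> \<omega>" using E1(3) \<omega> by blast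
      then have "(1 - \<tau>) * real n \<le> colnorm2 n (p n) \<omega> (p n)" by (simp add: design_regular_def)
      moreover have "0 < (1 - \<tau>) * real n" using \<tau>1 elim(9) by simp
      ultimately have noise: "noise_regular a q (a * sqrt (2 * ln (real (p n)))) (\<epsilon> * real (k n)) (L * k n) (p n) (proj n (p n) \<omega> (p n))"
        using E2(3) \<omega> by force
      have event: "slope_event n (p n) (k n) L \<sigma> \<delta> q \<epsilon> c0 \<omega> (b0 n)"
      proof
        show "k n = sparsity (p n) (b0 n)" by (simp add: k_def)
        show "design_regular n (p n) (\<delta> / (16 * (1 + \<delta>))) \<omega>" using design by (simp only: \<tau>_def)
        show "noise_regular (1 + \<delta> / 4) q ((1 + \<delta> / 4) * sqrt (2 * ln (real (p n)))) (\<epsilon> * real (k n)) (L * k n) (p n) (proj n (p n) \<omega> (p n))"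
          using noise by (simp only: a_def)
        show "ln (2 / q) \<le> \<delta> / (16 * (1 + \<delta>)) * ln (real (p n))"
        proof -
          have "ln (2 / q) \<le> \<tau> * ln (real (p n))" using elim(5) \<tau> by (simp add: field_simps)
          then show ?thesis unfolding \<tau>_def .
        qed
      qed (use sigma_pos delta_pos q \<epsilon> b0_Rp[of n] k_pos[of n] signal[of _ n] c0 elim L4
          in \<open>auto simp: \<tau>_def a_def D_def \<Theta>_def\<close>)
      have "\<omega> \<in> space (M n)" using \<omega> by simp
      note opt = bhat_Rp[OF this] bhat_argmin[OF this]
      show ?thesis using slope_event.selection_consistent[OF event opt] by simp
    qed
    ultimately show ?case using E1(1) E2(1) by (intro bexI[of _ "E1 \<union> E2"]) auto
  qed
qed

section \<open>From the exceptional event to expectations\<close>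

lemma measurable_count:
  "(\<lambda>\<omega>. real (card {j \<in> {..<p n}. P j \<and> bhat n \<omega> j \<noteq> 0})) \<in> borel_measurable (M n)"
proof -
  have [measurable]: "(\<lambda>\<omega>. bhat n \<omega> j) \<in> borel_measurable (M n)" for j by (rule bhat_meas)
  have "real (card {j \<in> {..<p n}. P j \<and> bhat n \<omega> j \<noteq> 0}) = (\<Sum>j<p n. if P j \<and> bhat n \<omega> j \<noteq> 0 then 1 else 0)" for \<omega>
    using sum.inter_filter[of "{..<p n}" "\<lambda>_. 1 :: real" "\<lambda>j. P j \<and> bhat n \<omega> j \<noteq> 0"] by simp
  then show ?thesis by simp
qed

lemma num_disc_eq: "num_disc (p n) b = false_disc (p n) (b0 n) b + true_disc (p n) (b0 n) b"
proof -
  have "{j\<in>{..<p n}. b j \<noteq> 0} = {j\<in>{..<p n}. b0 n j = 0 \<and> b j \<noteq> 0} \<union> {j\<in>{..<p n}. b0 n j \<noteq> 0 \<and> b j \<noteq> 0}"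
    by auto
  then show ?thesis
    unfolding num_disc_def false_disc_def true_disc_def by (simp only:) (rule card_Un_disjoint, auto)
qed

lemma true_disc_le: "true_disc (p n) (b0 n) b \<le> k n"
  unfolding true_disc_def k_def sparsity_def by (intro card_mono) auto

lemma measurable_FDP:
  "(\<lambda>\<omega>. FD n \<omega> / real (max (num_disc (p n) (bhat n \<omega>)) 1)) \<in> borel_measurable (M n)"
proof -
  have [measurable]: "(\<lambda>\<omega>. FD n \<omega>) \<in> borel_measurable (M n)"
    unfolding false_disc_def by (rule measurable_count)
  have [measurable]: "(\<lambda>\<omega>. real (num_disc (p n) (bhat n \<omega>))) \<in> borel_measurable (M n)"
    unfolding num_disc_def using measurable_count[of n "\<lambda>_. True"] by (simp only: simp_thms)
  show ?thesis unfolding of_nat_max of_nat_1 by measurable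
qed

lemma FDP_le_1: "real (false_disc (p n) (b0 n) b) / real (max (num_disc (p n) b) 1) \<le> 1"
  by (simp add: num_disc_eq max_def)

text \<open>Outside \<open>E\<close> all \<open>k\<close> signals are found, so the number of
  discoveries is at least \<open>k\<close> and the proportion at most \<open>\<epsilon>\<close>; on
  \<open>E\<close> it is at most 1.\<close>

lemma eventually_FDR_le:
  assumes "0 < \<epsilon>" "\<epsilon> \<le> 1"
  shows "\<forall>\<^sub>F n in sequentially. FDR n (p n) (b0 n) (bhat n) \<le> 2 * \<epsilon>"
  using eventually_selection_consistent[OF assms assms(1)]
proof eventually_elim
  case (elim n)
  interpret prob_space "M n" by (rule prob_space_Omega)
  obtain E where E: "E \<in> events" "prob E \<le> \<epsilon>"
    "\<And>\<omega>. \<omega> \<in> space (M n) - E \<Longrightarrow> FD n \<omega> \<le> \<epsilon> * real (k n)"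
    "\<And>\<omega>. \<omega> \<in> space (M n) - E \<Longrightarrow> TD n \<omega> = k n"
    using elim by blast
  have ind: "integrable (M n) (indicator E :: _ \<Rightarrow> real)"
    by (rule integrable_real_indicator[OF E(1)]) (simp add: emeasure_eq_measure)
  let ?F = "\<lambda>\<omega>. FD n \<omega> / real (max (num_disc (p n) (bhat n \<omega>)) 1)"
  have "(\<integral>\<omega>. ?F \<omega> \<partial>M n) \<le> (\<integral>\<omega>. \<epsilon> + indicator E \<omega> \<partial>M n)"
  proof (rule integral_mono)
    show "integrable (M n) ?F"
      by (rule integrable_const_bound[of _ 1]) (use FDP_le_1 measurable_FDP in auto)
    show "integrable (M n) (\<lambda>\<omega>. \<epsilon> + indicator E \<omega>)"
      using ind by (intro Bochner_Integration.integrable_add) auto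
    fix \<omega> assume \<omega>: "\<omega> \<in> space (M n)"
    show "?F \<omega> \<le> \<epsilon> + indicator E \<omega>"
    proof (cases "\<omega> \<in> E")
      case True
      have "?F \<omega> \<le> 1" by (rule FDP_le_1)
      moreover have "indicator E \<omega> = (1 :: real)" using True by simp
      ultimately show ?thesis using assms by linarith
    next
      case False
      then have g: "FD n \<omega> \<le> \<epsilon> * real (k n)" "TD n \<omega> = k n"
        using E(3,4) \<omega> by auto
      have "k n \<le> max (num_disc (p n) (bhat n \<omega>)) 1" using g(2) by (simp add: num_disc_eq)
      then have "\<epsilon> * real (k n) \<le> \<epsilon> * real (max (num_disc (p n) (bhat n \<omega>)) 1)"
        using assms by (intro mult_left_mono) auto
      then have "?F \<omega> \<le> \<epsilon>" using g(1) by (subst pos_divide_le_eq) auto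
      then show ?thesis using False by simp
    qed
  qed
  also have "\<dots> = \<epsilon> + prob E" using E(1) ind by (subst Bochner_Integration.integral_add) (auto simp: prob_space)
  finally show ?case using E(2) by (simp add: FDR_def)
qed

text \<open>The number of true discoveries is at least \<open>k\<close> times the indicator of the
  complement of \<open>E\<close>, so the power loses at most the probability of
  \<open>E\<close>.\<close>

lemma eventually_Power_ge:
  assumes "0 < \<epsilon>" "\<epsilon> \<le> 1"
  shows "\<forall>\<^sub>F n in sequentially. 1 - \<epsilon> \<le> Power n (p n) (b0 n) (bhat n)"
  using eventually_selection_consistent[OF assms assms(1)]
proof eventually_elim
  case (elim n)
  interpret prob_space "M n" by (rule prob_space_Omega)
  obtain E where E: "E \<in> events" "prob E \<le> \<epsilon>"
    "\<And>\<omega>. \<omega> \<in> space (M n) - E \<Longrightarrow> TD n \<omega> = k n"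
    using elim by blast
  have ind: "integrable (M n) (indicator E :: _ \<Rightarrow> real)"
    by (rule integrable_real_indicator[OF E(1)]) (simp add: emeasure_eq_measure)
  let ?T = "\<lambda>\<omega>. real (TD n \<omega>)"
  have meas: "?T \<in> borel_measurable (M n)"
    unfolding true_disc_def by (rule measurable_count)
  have "(\<integral>\<omega>. real (k n) * (1 - indicator E \<omega>) \<partial>M n) \<le> (\<integral>\<omega>. ?T \<omega> \<partial>M n)"
  proof (rule integral_mono)
    show "integrable (M n) ?T"
      by (rule integrable_const_bound[of _ "real (k n)"]) (use true_disc_le meas in auto)
    show "integrable (M n) (\<lambda>\<omega>. real (k n) * (1 - indicator E \<omega>))"
      using ind by (intro integrable_mult_right Bochner_Integration.integrable_diff) auto
    show "real (k n) * (1 - indicator E \<omega>) \<le> ?T \<omega>" if "\<omega> \<in> space (M n)" for \<omega>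
      using E(3)[of \<omega>] that by (cases "\<omega> \<in> E") auto
  qed
  moreover have "(\<integral>\<omega>. real (k n) * (1 - indicator E \<omega>) \<partial>M n) = real (k n) * (1 - prob E)"
    using E(1) ind by (subst Bochner_Integration.integral_mult_right_zero, subst Bochner_Integration.integral_diff) (auto simp: prob_space)
  ultimately have "real (k n) * (1 - prob E) / real (k n) \<le> (\<integral>\<omega>. ?T \<omega> \<partial>M n) / real (k n)"
    by (intro divide_right_mono) auto
  then have "1 - prob E \<le> Power n (p n) (b0 n) (bhat n)"
    using k_pos[of n] by (simp add: Power_def k_def)
  then show ?case using E(2) by simp
qed

lemma Power_le_1: "Power n (p n) (b0 n) (bhat n) \<le> 1"
proof -
  interpret prob_space "M n" by (rule prob_space_Omega)
  let ?T = "\<lambda>\<omega>. real (TD n \<omega>)"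
  have meas: "?T \<in> borel_measurable (M n)"
    unfolding true_disc_def by (rule measurable_count)
  have "(\<integral>\<omega>. ?T \<omega> \<partial>M n) \<le> (\<integral>\<omega>. real (k n) \<partial>M n)"
  proof (rule integral_mono)
    show "integrable (M n) ?T"
      by (rule integrable_const_bound[of _ "real (k n)"]) (use true_disc_le meas in auto)
  qed (use true_disc_le in auto)
  then show ?thesis using k_pos[of n] by (simp add: Power_def k_def prob_space divide_le_eq)
qed

lemma FDR_tendsto: "(\<lambda>n. FDR n (p n) (b0 n) (bhat n)) \<longlonglongrightarrow> 0"
proof (rule order_tendstoI)
  fix x :: real assume "x < 0"
  moreover have "0 \<le> FDR n (p n) (b0 n) (bhat n)" for n by (simp add: FDR_def)
  ultimately show "\<forall>\<^sub>F n in sequentially. x < FDR n (p n) (b0 n) (bhat n)"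
    by (intro always_eventually allI) (rule less_le_trans)
next
  fix x :: real assume x: "0 < x"
  define \<epsilon> where "\<epsilon> = min 1 (x / 4)"
  have \<epsilon>: "0 < \<epsilon>" "\<epsilon> \<le> 1" "2 * \<epsilon> < x" using x by (auto simp: \<epsilon>_def)
  show "\<forall>\<^sub>F n in sequentially. FDR n (p n) (b0 n) (bhat n) < x"
    using eventually_FDR_le[OF \<epsilon>(1,2)] by eventually_elim (use \<epsilon>(3) in simp)
qed

lemma Power_tendsto: "(\<lambda>n. Power n (p n) (b0 n) (bhat n)) \<longlonglongrightarrow> 1"
proof (rule order_tendstoI)
  fix x :: real assume x: "x < 1"
  define \<epsilon> where "\<epsilon> = min 1 ((1 - x) / 2)"
  have "\<epsilon> \<le> (1 - x) / 2" unfolding \<epsilon>_def by (rule min.cobounded2)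
  then have \<epsilon>: "0 < \<epsilon>" "\<epsilon> \<le> 1" "x < 1 - \<epsilon>" using x by (auto simp: \<epsilon>_def)
  show "\<forall>\<^sub>F n in sequentially. x < Power n (p n) (b0 n) (bhat n)"
    using eventually_Power_ge[OF \<epsilon>(1,2)] by eventually_elim (use \<epsilon>(3) in simp)
next
  fix x :: real assume "1 < x"
  then show "\<forall>\<^sub>F n in sequentially. Power n (p n) (b0 n) (bhat n) < x"
    by (intro always_eventually allI le_less_trans[OF Power_le_1])
qed

end

theorem theorem1:
  fixes p :: "nat \<Rightarrow> nat"
    and b0 :: "nat \<Rightarrow> nat \<Rightarrow> real"
    and \<sigma> \<delta> q :: real
    and bhat :: "nat \<Rightarrow> (((nat \<times> nat) + nat) \<Rightarrow> real) \<Rightarrow> nat \<Rightarrow> real"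
  assumes sigma_pos: "\<sigma> > 0"
    and delta_pos: "\<delta> > 0"
    and q: "0 < q" "q < 1"
    and b0_Rp: "\<And>n. b0 n \<in> Rp (p n)"
    and k_pos: "\<And>n. sparsity (p n) (b0 n) \<ge> 1"
    and signal: "\<And>n j. j < p n \<Longrightarrow> b0 n j \<noteq> 0 \<Longrightarrow>
                   \<bar>b0 n j\<bar> \<ge> 2 * \<sigma> * (1 + \<delta>) * sqrt (2 * ln (real (p n)))"
    and p_inf: "filterlim p at_top sequentially"
    and k_over_p: "(\<lambda>n. real (sparsity (p n) (b0 n)) / real (p n)) \<longlonglongrightarrow> 0"
    and k2logp_over_n: "(\<lambda>n. real (sparsity (p n) (b0 n))^2 * ln (real (p n)) / real n) \<longlonglongrightarrow> 0"
    and bhat_Rp: "\<And>n \<omega>. \<omega> \<in> space (Omega n (p n)) \<Longrightarrow> bhat n \<omega> \<in> Rp (p n)"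
    and bhat_argmin: "\<And>n \<omega> b. \<omega> \<in> space (Omega n (p n)) \<Longrightarrow> b \<in> Rp (p n) \<Longrightarrow>
          slope_obj n (p n) (Xmat n \<omega>) (Yvec n (p n) \<sigma> (b0 n) \<omega>) (slope_lambda \<sigma> \<delta> q (p n)) (bhat n \<omega>)
          \<le> slope_obj n (p n) (Xmat n \<omega>) (Yvec n (p n) \<sigma> (b0 n) \<omega>) (slope_lambda \<sigma> \<delta> q (p n)) b"
    and bhat_meas: "\<And>n j. (\<lambda>\<omega>. bhat n \<omega> j) \<in> borel_measurable (Omega n (p n))"
  shows "(\<lambda>n. FDR n (p n) (b0 n) (bhat n)) \<longlonglongrightarrow> 0 \<and>
         (\<lambda>n. Power n (p n) (b0 n) (bhat n)) \<longlonglongrightarrow> 1"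
proof -
  have "slope_sequence p b0 \<sigma> \<delta> q bhat"
    by (rule slope_sequence.intro[OF sigma_pos delta_pos q b0_Rp k_pos signal p_inf k_over_p
          k2logp_over_n bhat_Rp bhat_argmin bhat_meas])
  then show ?thesis
    using slope_sequence.FDR_tendsto slope_sequence.Power_tendsto by blast
qed

end
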